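(* Suppose that $\Omega\subset\mathbb{C}$ is a doubly connected domain, with $\Omega_b$ and $\Omega_u$ denoting the bounded and the unbounded component of $\hat{\mathbb{C}}\setminus\Omega$, respectively. For $\theta\in[0,\pi)$ let $\pi_\theta(z)=\operatorname{Re}(e^{-i\theta}z)$. If (1) $\Omega_b$ is not a line segment, and (2) for every $\theta\in[0,\pi)$, $\pi_\theta(\Omega_b)\cap\pi_\theta(\Omega_u)\neq\emptyset$, then there exists an affine transformation $\phi$ such that $\operatorname{Mod}_{\mathrm{aff}}\Omega=\operatorname{Mod}\phi(\Omega)$.
   Context: A domain $\Omega\subset\mathbb{C}$ is doubly connected if $\hat{\mathbb{C}}\setminus\Omega$ (complement in the Riemann sphere) has exactly two connected components. One of them is bounded (does not contain $\infty$) and is denoted $\Omega_b$; the other, containing $\infty$, is denoted $\Omega_u$. The projection $\pi_\theta(\Omega_u)$ is understood as the image under $\pi_\theta$ of the finite points of $\Omega_u$, i.e. of $\Omega_u\setminus\{\infty\}$. The domain $\Omega$ is non-degenerate if both complement components contain more than one point, and degenerate otherwise; the domain in the claim may be degenerate. Every non-degenerate doubly connected domain is conformally equivalent to an annulus $\{z: r<|z|<R\}$ with $0<r<R<\infty$, where $R/r$ is uniquely determined; its conformal modulus is $\operatorname{Mod}\Omega=\log(R/r)$. If $\Omega$ is degenerate, set $\operatorname{Mod}\Omega=\infty$. An affine transformation of $\mathbb{C}$ is a map $z\mapsto az+b\bar z+c$ with $a,b,c\in\mathbb{C}$ and $|a|^2-|b|^2\neq 0$. The affine modulus of $\Omega$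 is \[ \operatorname{Mod}_{\mathrm{aff}}\Omega=\sup\{\operatorname{Mod}\phi(\Omega):\ \phi \text{ is an affine transformation}\}. \] *)

theory Defs
  imports "HOL-Complex_Analysis.Complex_Analysis" "HOL-Library.Extended_Real"
begin

(* Riemann sphere: \<open>None\<close> is the point at infinity, \<open>Some z\<close> a finite point. *)

definition riemann_sphere :: "complex option topology" where
  "riemann_sphere = Alexandroff_compactification euclidean"

definition complement_components :: "complex set \<Rightarrow> complex option set set" where
  "complement_components \<Omega> =
     connected_components_of (subtopology riemann_sphere (UNIV - Some ` \<Omega>))"

definition doubly_connected_domain :: "complex set \<Rightarrow> bool" where
  "doubly_connected_domain \<Omega> \<longleftrightarrow>
     open \<Omega> \<and> connected \<Omega> \<and> \<Omega> \<noteq> {} \<and> card (complement_components \<Omega>) = 2"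

(* The next two are meaningful only for doubly connected domains, where exactly
   one component contains \<open>None\<close> and exactly one does not. *)

definition bounded_component :: "complex set \<Rightarrow> complex option set" where
  "bounded_component \<Omega> = (THE C. C \<in> complement_components \<Omega> \<and> None \<notin> C)"

definition unbounded_component :: "complex set \<Rightarrow> complex option set" where
  "unbounded_component \<Omega> = (THE C. C \<in> complement_components \<Omega> \<and> None \<in> C)"

definition finite_points :: "complex option set \<Rightarrow> complex set" where
  "finite_points C = {z. Some z \<in> C}"

definition non_degenerate :: "complex set \<Rightarrow> bool" where
  "non_degenerate \<Omega> \<longleftrightarrow> (\<forall>C \<in> complement_components \<Omega>. \<exists>x\<in>C. \<exists>y\<in>C. x \<noteq> y)"

definition conformally_equivalent :: "complex set \<Rightarrow> complex set \<Rightarrow> bool" where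
  "conformally_equivalent U V \<longleftrightarrow>
     (\<exists>f g. f holomorphic_on U \<and> g holomorphic_on V \<and>
        (\<forall>z\<in>U. f z \<in> V \<and> g (f z) = z) \<and> (\<forall>w\<in>V. g w \<in> U \<and> f (g w) = w))"

definition annulus :: "real \<Rightarrow> real \<Rightarrow> complex set" where
  "annulus r R = {z. r < cmod z \<and> cmod z < R}"

(* Meaningful only for doubly connected domains, where in the non-degenerate case
   the described real number exists and is unique. *)

definition conformal_modulus :: "complex set \<Rightarrow> ereal" where
  "conformal_modulus \<Omega> =
     (if non_degenerate \<Omega>
      then ereal (THE m. \<exists>r R. 0 < r \<and> r < R \<and>
                    conformally_equivalent \<Omega> (annulus r R) \<and> m = ln (R / r))
      else \<infinity>)"

definition affine_transformation :: "(complex \<Rightarrow> complex) \<Rightarrow> bool" where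
  "affine_transformation \<phi> \<longleftrightarrow>
     (\<exists>a b c. (cmod a)\<^sup>2 - (cmod b)\<^sup>2 \<noteq> 0 \<and> \<phi> = (\<lambda>z. a * z + b * cnj z + c))"

definition affine_modulus :: "complex set \<Rightarrow> ereal" where
  "affine_modulus \<Omega> = Sup {conformal_modulus (\<phi> ` \<Omega>) | \<phi>. affine_transformation \<phi>}"

definition proj_dir :: "real \<Rightarrow> complex \<Rightarrow> real" where
  "proj_dir \<theta> z = Re (exp (- \<i> * complex_of_real \<theta>) * z)"

(* A single point is not counted as a line segment, so a domain whose bounded
   complementary component is a point (modulus \<open>\<infinity>\<close>) is not excluded. *)

definition is_line_segment :: "complex set \<Rightarrow> bool" where
  "is_line_segment S \<longleftrightarrow> (\<exists>a b. a \<noteq> b \<and> S = closed_segment a b)"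

end

theory Submission
  imports Defs
begin

text \<open>
Write K for the bounded and L for the finite part of the unbounded complementary component of
\<Omega>. If one of the two components is a point, every affine image of \<Omega> has modulus \<open>\<infinity>\<close>. In the
non-degenerate case the modulus of an affine image does not change under complex affine maps, so the
supremum may be taken over the real-linear maps \<open>z \<mapsto> a * z + b * cnj z\<close> with
\<open>\<bar>a\<bar>\<^sup>2 + \<bar>b\<bar>\<^sup>2 = 1\<close> and \<open>\<bar>a\<bar> \<noteq> \<bar>b\<bar>\<close>. Take such maps whose moduli tend to the supremum, and
a convergent subsequence of their coefficients, with limit map \<Lambda>. Two things have to be shown:
the modulus is upper semicontinuous at \<Lambda> if \<Lambda> is invertible, and \<Lambda> cannot be a projection.

Both follow from one compactness argument, because the modulus is the solution of an extremal
problem: it is the largest m for which there is an essential map, that is, a holomorphic and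
possibly non-injective map from \<open>{exp (- m / 2) < \<bar>z\<bar> < exp (m / 2)}\<close> into the domain that sends the
unit circle to a curve with non-zero winding number about K (theorem \<open>conformal_modulus_extremal\<close>).
Now let essential maps f n, from one fixed annulus, into the linear images of \<Omega> be given.
The curve \<open>f n (unit circle)\<close> winds about the images of two points p and p' of K and does not wind
about the image of a point l of L. If \<Lambda> p and \<Lambda> p' differ, this is enough to make the f n a
normal family with only non-constant limits (theorem \<open>essential_maps_compactness\<close>): the f n omit two
values that stay apart, which gives normality by the theorem of Montel; a sequence tending to
\<open>\<infinity>\<close> would wind equally often about the images of p and l, and one tending to a constant would not
wind about one of the images of p and p'. By the theorem of Hurwitz a limit g still omits
\<open>\<Lambda> ` (K \<union> L)\<close>, and winding numbers pass to the limit (theorem \<open>essential_map_limit\<close>).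

If \<Lambda> is invertible, then g is an essential map into \<open>\<Lambda> ` \<Omega>\<close>, hence the supremum is at most
the modulus of \<open>\<Lambda> ` \<Omega>\<close>, and \<Lambda> attains it. If \<Lambda> is not invertible, it is a multiple
of a projection \<open>proj_dir \<theta>\<close>. The second hypothesis provides p in K and l in L with \<Lambda> p = \<Lambda> l. The
first provides p' in K with \<open>\<Lambda> p' \<noteq> \<Lambda> p\<close>, since a connected compact set with more than one point on
which the projection is constant is a segment. Then g would have a winding number about the point
\<Lambda> p = \<Lambda> l that is both zero and non-zero, which is absurd.

The extremal description needs the uniformization of \<Omega> by a round annulus and the uniqueness of
that annulus. For existence (theorem \<open>ring_domain_uniformization\<close>), a component V of the logarithm
of \<open>\<Omega> - p\<close> is simply connected and invariant under a translation by a multiple of \<open>2 \<pi> \<i>\<close>; by the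
Riemann mapping theorem the translation becomes an automorphism of the disc without fixed points,
hence either a dilation or a translation of a half plane. The quotient is an annulus in the first
case. In the second it would be a punctured disc, which the great Picard theorem rules out.
Uniqueness and maximality are the inequality \<open>modulus_le_of_nonzero_degree\<close> for maps between
annuli, which is the Schwarz-Pick lemma applied to logarithmic lifts.
\<close>

section \<open>Ring domains on the Riemann sphere\<close>

text \<open>
The last conjunct says in terms of the plane that L together with the point at infinity is connected:
a non-empty compact, relatively open part of L would split off from \<open>\<infinity>\<close>. It is the form in which
connectedness of the unbounded component is used below.
\<close>
definition ring_domain :: "complex set \<Rightarrow> complex set \<Rightarrow> complex set \<Rightarrow> bool" where
  "ring_domain \<Omega> K L \<longleftrightarrow>
     open \<Omega> \<and> connected \<Omega> \<and> \<Omega> \<noteq> {} \<and> K \<union> L = - \<Omega> \<and> K \<inter> L = {} \<and>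
     compact K \<and> connected K \<and> K \<noteq> {} \<and> closed L \<and>
     (\<forall>C. compact C \<and> openin (top_of_set L) C \<longrightarrow> C = {})"

lemma topspace_riemann_sphere [simp]: "topspace riemann_sphere = UNIV"
  by (simp add: riemann_sphere_def UNIV_option_conv)

lemma eq_Some_image: "None \<notin> A \<Longrightarrow> A = Some ` {z. Some z \<in> A}"
proof (rule set_eqI)
  show "x \<in> A \<longleftrightarrow> x \<in> Some ` {z. Some z \<in> A}" if "None \<notin> A" for x using that by (cases x) auto
qed

lemma eq_insert_None_image: "None \<in> A \<Longrightarrow> A = insert None (Some ` {z. Some z \<in> A})"
proof (rule set_eqI)
  show "x \<in> A \<longleftrightarrow> x \<in> insert None (Some ` {z. Some z \<in> A})" if "None \<in> A" for x using that by (cases x) auto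
qed

lemma closedin_riemann_sphere_Some: "closedin riemann_sphere (Some ` K) \<longleftrightarrow> compact K"
  by (auto simp: riemann_sphere_def compact_imp_closed)

lemma closedin_riemann_sphere_None: "closedin riemann_sphere (insert None (Some ` L)) \<longleftrightarrow> closed L"
proof -
  have eq: "insert None (Some ` L) = UNIV - Some ` U \<longleftrightarrow> L = - U" for U :: "complex set"
  proof
    assume "insert None (Some ` L) = UNIV - Some ` U"
    then have "Some z \<in> insert None (Some ` L) \<longleftrightarrow> Some z \<in> UNIV - Some ` U" for z by simp
    then show "L = - U" by auto
  next
    assume "L = - U"
    then show "insert None (Some ` L) = UNIV - Some ` U"
      using eq_insert_None_image [of "UNIV - Some ` U"] by (auto simp: set_eq_iff image_iff)
  qed
  have "closedin riemann_sphere (insert None (Some ` L)) \<longleftrightarrow> (\<exists>U. open U \<and> insert None (Some ` L) = UNIV - Some ` U)"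
    unfolding riemann_sphere_def closedin_Alexandroff_compactification
    using topspace_riemann_sphere by (auto simp: riemann_sphere_def)
  also have "\<dots> \<longleftrightarrow> closed L" unfolding eq closed_def by (metis double_complement)
  finally show ?thesis .
qed

lemma closedin_riemann_sphere_cases:
  assumes "closedin riemann_sphere C"
  obtains K where "compact K" "C = Some ` K" | L where "closed L" "C = insert None (Some ` L)"
proof (cases "None \<in> C")
  case True
  then have eq: "C = insert None (Some ` {z. Some z \<in> C})" by (rule eq_insert_None_image)
  then show thesis using that(2) closedin_riemann_sphere_None assms by metis
next
  case False
  then have eq: "C = Some ` {z. Some z \<in> C}" by (rule eq_Some_image)
  then show thesis using that(1) closedin_riemann_sphere_Some assms by metis
qed

lemma connected_of_connectedin_riemann_sphere:
  assumes "connectedin riemann_sphere (Some ` K)" "compact K"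
  shows "connected K"
  unfolding connected_closed
proof clarify
  fix A B assume AB: "closed A" "closed B" "K \<subseteq> A \<union> B" "A \<inter> B \<inter> K = {}" "A \<inter> K \<noteq> {}" "B \<inter> K \<noteq> {}"
  have "closedin riemann_sphere (Some ` (K \<inter> A))" "closedin riemann_sphere (Some ` (K \<inter> B))"
    using AB assms by (simp_all add: closedin_riemann_sphere_Some compact_Int_closed)
  moreover have "Some ` K \<subseteq> Some ` (K \<inter> A) \<union> Some ` (K \<inter> B)" using AB(3) by auto
  moreover have "Some ` (K \<inter> A) \<inter> Some ` (K \<inter> B) \<inter> Some ` K = {}" using AB(4) by auto
  moreover have "Some ` (K \<inter> A) \<inter> Some ` K \<noteq> {}" "Some ` (K \<inter> B) \<inter> Some ` K \<noteq> {}" using AB(5,6) by auto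
  ultimately show False using assms(1) unfolding connectedin_closedin by blast
qed

text \<open>
Closed sets of the sphere are compact sets of the plane and closed sets together with \<open>\<infinity>\<close>, so all
conditions on K and L can be read off from the two components. A compact relatively open part C
of L would make C and \<open>\<infinity> \<union> (L - C)\<close> a separation of the unbounded component.
\<close>
lemma complement_components_ring_domain:
  assumes "doubly_connected_domain \<Omega>"
  obtains K L where "ring_domain \<Omega> K L" "complement_components \<Omega> = {Some ` K, insert None (Some ` L)}"
proof -
  let ?S = "UNIV - Some ` \<Omega>"
  let ?X = "subtopology riemann_sphere ?S"
  have \<Omega>: "open \<Omega>" "connected \<Omega>" "\<Omega> \<noteq> {}" "card (complement_components \<Omega>) = 2"
    using assms by (auto simp: doubly_connected_domain_def)
  obtain A' B' where AB': "complement_components \<Omega> = {A', B'}" "A' \<noteq> B'"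
    using \<Omega>(4) by (auto simp: card_2_iff)
  have comps: "connected_components_of ?X = {A', B'}"
    using AB' by (simp add: complement_components_def)
  have un: "A' \<union> B' = ?S"
    using Union_connected_components_of [of ?X] comps by simp
  have disj: "A' \<inter> B' = {}"
    using pairwise_disjoint_connected_components_of [of ?X] comps AB'(2)
    by (auto simp: pairwise_def disjnt_def)
  have "\<exists>A B. {A', B'} = {A, B} \<and> None \<notin> A \<and> None \<in> B \<and> A \<inter> B = {} \<and> A \<union> B = ?S"
  proof (cases "None \<in> B'")
    case True
    then show ?thesis using un disj by (intro exI [of _ A'] exI [of _ B']) auto
  next
    case False
    have "None \<in> ?S" by auto
    then have "None \<in> A'" using un False by blast
    then show ?thesis using un disj False by (intro exI [of _ B'] exI [of _ A']) auto
  qed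
  then obtain A B where AB0: "{A', B'} = {A, B} \<and> None \<notin> A \<and> None \<in> B \<and> A \<inter> B = {} \<and> A \<union> B = ?S"
    by (elim exE)
  then have AB: "{A', B'} = {A, B}" "None \<notin> A" "None \<in> B" "A \<inter> B = {}" "A \<union> B = ?S"
    by simp_all
  define K where "K = {z. Some z \<in> A}"
  define L where "L = {z. Some z \<in> B}"
  have A: "A = Some ` K"
    unfolding K_def using AB(2) by (rule eq_Some_image)
  have B: "B = insert None (Some ` L)"
    unfolding L_def using AB(3) by (rule eq_insert_None_image)
  have S: "?S = insert None (Some ` (- \<Omega>))"
    using eq_insert_None_image [of ?S] by (auto simp: set_eq_iff image_iff)
  have clS: "closedin riemann_sphere ?S"
    unfolding S closedin_riemann_sphere_None using \<Omega> by auto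
  have cl: "closedin riemann_sphere A" "closedin riemann_sphere B"
    using closedin_connected_components_of [of _ ?X] comps AB(1) clS
    by (auto intro: closedin_trans_full)
  have con: "connectedin riemann_sphere A" "connectedin riemann_sphere B"
    using connectedin_connected_components_of [of _ ?X] comps AB(1)
    by (auto simp: connectedin_subtopology)
  have "compact K" using cl(1) unfolding A closedin_riemann_sphere_Some .
  have "closed L" using cl(2) unfolding B closedin_riemann_sphere_None .
  have "K \<noteq> {}"
    using nonempty_connected_components_of [of A ?X] comps AB(1) A by auto
  have KL: "K \<union> L = - \<Omega>" "K \<inter> L = {}"
  proof -
    have "z \<in> K \<union> L \<longleftrightarrow> z \<notin> \<Omega>" for z
      using AB(5) by (auto simp: K_def L_def)
    then show "K \<union> L = - \<Omega>" by auto
    show "K \<inter> L = {}" using AB(4) by (auto simp: K_def L_def)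
  qed
  have "C = {}" if C: "compact C" "openin (top_of_set L) C" for C
  proof (rule ccontr)
    assume "C \<noteq> {}"
    have "C \<subseteq> L" using C(2) openin_imp_subset by blast
    have "closed (L - C)"
      using C(2) \<open>closed L\<close> by (metis closedin_closed_trans closedin_diff closedin_subtopology_refl openin_closedin_eq openin_imp_subset topspace_euclidean_subtopology)
    then have "closedin riemann_sphere (Some ` C)" "closedin riemann_sphere (insert None (Some ` (L - C)))"
      using C by (simp_all only: closedin_riemann_sphere_Some closedin_riemann_sphere_None)
    moreover have "B \<subseteq> Some ` C \<union> insert None (Some ` (L - C))" using B \<open>C \<subseteq> L\<close> by auto
    moreover have "Some ` C \<inter> insert None (Some ` (L - C)) \<inter> B = {}" by auto
    moreover have "Some ` C \<inter> B \<noteq> {}" using \<open>C \<subseteq> L\<close> \<open>C \<noteq> {}\<close> B by auto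
    moreover have "insert None (Some ` (L - C)) \<inter> B \<noteq> {}" using AB(3) by auto
    ultimately show False using con(2) unfolding connectedin_closedin by blast
  qed
  then have "ring_domain \<Omega> K L"
    using \<Omega> KL \<open>compact K\<close> \<open>closed L\<close> \<open>K \<noteq> {}\<close>
      connected_of_connectedin_riemann_sphere [of K] con(1) A
    by (auto simp: ring_domain_def)
  then show thesis using that AB'(1) AB(1) A B by metis
qed

text \<open>
A homeomorphism of the plane extends to the sphere by fixing the point at infinity, since it
preserves compactness of sets in both directions.
\<close>
lemma complement_components_homeomorphic_image:
  assumes "homeomorphism UNIV UNIV \<phi> \<psi>"
  shows "complement_components (\<phi> ` \<Omega>) = image (map_option \<phi>) ` complement_components \<Omega>"
proof -
  have inv: "\<And>x. \<psi> (\<phi> x) = x" "\<And>x. \<phi> (\<psi> x) = x" and cont: "continuous_on UNIV \<phi>" "continuous_on UNIV \<psi>"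
    using assms by (auto simp: homeomorphism_def)
  have cm: "continuous_map riemann_sphere riemann_sphere (map_option f)"
    if fg: "\<And>x. g (f x) = x" "\<And>x. f (g x) = x" "continuous_on UNIV f" "continuous_on UNIV g" for f g :: "complex \<Rightarrow> complex"
    unfolding continuous_map_closedin
  proof (intro conjI allI impI)
    fix C assume "closedin riemann_sphere C"
    then show "closedin riemann_sphere {x \<in> topspace riemann_sphere. map_option f x \<in> C}"
    proof (cases rule: closedin_riemann_sphere_cases)
      case (1 K)
      have "f z \<in> K \<longleftrightarrow> z \<in> g ` K" for z
        using fg(1,2) by (metis imageE imageI)
      then have "map_option f x \<in> Some ` K \<longleftrightarrow> x \<in> Some ` (g ` K)" for x
        by (cases x) auto
      then have "{x. map_option f x \<in> Some ` K} = Some ` (g ` K)" by blast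
      moreover have "compact (g ` K)"
        using fg(4) 1 compact_continuous_image continuous_on_subset by blast
      ultimately show ?thesis using 1 closedin_riemann_sphere_Some by simp
    next
      case (2 L)
      have "map_option f x \<in> insert None (Some ` L) \<longleftrightarrow> x \<in> insert None (Some ` (f -` L))" for x
        by (cases x) auto
      then have "{x. map_option f x \<in> insert None (Some ` L)} = insert None (Some ` (f -` L))" by blast
      moreover have "closed (f -` L)" using fg(3) 2 by (simp add: closed_vimage)
      ultimately show ?thesis using 2 closedin_riemann_sphere_None by simp
    qed
  qed auto
  have "homeomorphic_maps riemann_sphere riemann_sphere (map_option \<phi>) (map_option \<psi>)"
    unfolding homeomorphic_maps_def using cm [of \<psi> \<phi>] cm [of \<phi> \<psi>] inv cont
    by (simp add: option.map_comp o_def option.map_ident)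
  then have "homeomorphic_map riemann_sphere riemann_sphere (map_option \<phi>)"
    using homeomorphic_map_maps by blast
  then have "homeomorphic_map (subtopology riemann_sphere (UNIV - Some ` \<Omega>))
      (subtopology riemann_sphere (UNIV - Some ` \<phi> ` \<Omega>)) (map_option \<phi>)"
  proof (rule homeomorphic_map_subtopologies)
    have Some_iff: "Some (\<phi> z) \<in> Some ` \<phi> ` \<Omega> \<longleftrightarrow> Some z \<in> Some ` \<Omega>" for z
      using inv(1) by (auto simp: image_iff dest: arg_cong [of _ _ \<psi>])
    have "x \<in> map_option \<phi> ` (UNIV - Some ` \<Omega>) \<longleftrightarrow> x \<notin> Some ` \<phi> ` \<Omega>" for x
    proof
      assume "x \<in> map_option \<phi> ` (UNIV - Some ` \<Omega>)"
      then obtain y where "y \<notin> Some ` \<Omega>" "x = map_option \<phi> y" by auto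
      then show "x \<notin> Some ` \<phi> ` \<Omega>" using Some_iff by (cases y) auto
    next
      assume x: "x \<notin> Some ` \<phi> ` \<Omega>"
      have eq: "x = map_option \<phi> (map_option \<psi> x)" using inv by (cases x) auto
      moreover have "map_option \<psi> x \<notin> Some ` \<Omega>"
        using x eq Some_iff by (cases "map_option \<psi> x") auto
      ultimately show "x \<in> map_option \<phi> ` (UNIV - Some ` \<Omega>)" by blast
    qed
    then have "map_option \<phi> ` (UNIV - Some ` \<Omega>) = UNIV - Some ` \<phi> ` \<Omega>"
      by (intro set_eqI) (simp only: Diff_iff UNIV_I simp_thms)
    then show "map_option \<phi> ` (topspace riemann_sphere \<inter> (UNIV - Some ` \<Omega>)) =
      topspace riemann_sphere \<inter> (UNIV - Some ` \<phi> ` \<Omega>)"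
      by (simp only: topspace_riemann_sphere Int_UNIV_left)
  qed
  then show ?thesis
    unfolding complement_components_def by (rule homeomorphic_map_connected_components_of)
qed

lemma non_degenerate_homeomorphic_image:
  assumes "homeomorphism UNIV UNIV \<phi> \<psi>"
  shows "non_degenerate (\<phi> ` \<Omega>) \<longleftrightarrow> non_degenerate \<Omega>"
proof -
  have "inj \<phi>" using assms by (metis homeomorphism_def inj_on_inverseI)
  then have "inj (map_option \<phi>)" by (rule option.inj_map)
  then show ?thesis
    unfolding non_degenerate_def complement_components_homeomorphic_image [OF assms]
    by (simp add: inj_eq)
qed

lemma ring_domain_homeomorphic_image:
  assumes hom: "homeomorphism UNIV UNIV \<phi> \<psi>" and ring: "ring_domain \<Omega> K L"
  shows "ring_domain (\<phi> ` \<Omega>) (\<phi> ` K) (\<phi> ` L)"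
proof -
  have inv: "\<And>x. \<psi> (\<phi> x) = x" "\<And>x. \<phi> (\<psi> x) = x" and cont: "continuous_on UNIV \<phi>" "continuous_on UNIV \<psi>"
    using hom by (auto simp: homeomorphism_def)
  have im: "\<phi> ` X = \<psi> -` X" for X using inv by (auto simp: image_iff) (metis inv)
  have "C = {}" if C: "compact C" "openin (top_of_set (\<phi> ` L)) C" for C
  proof -
    obtain T where T: "open T" "C = \<phi> ` L \<inter> T" using C(2) by (auto simp: openin_open)
    have "\<psi> ` X = \<phi> -` X" for X using inv by (auto simp: image_iff) (metis inv)
    then have "\<psi> ` C = L \<inter> \<phi> -` T" using T inv by (auto simp: im)
    moreover have "open (\<phi> -` T)" using T cont by (simp add: open_vimage)
    moreover have "compact (\<psi> ` C)" using C cont compact_continuous_image continuous_on_subset by blast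
    ultimately have "\<psi> ` C = {}" using ring unfolding ring_domain_def openin_open by metis
    then show ?thesis by simp
  qed
  moreover have "compact (\<phi> ` K)" "connected (\<phi> ` K)" "connected (\<phi> ` \<Omega>)"
    using ring unfolding ring_domain_def
    by (auto intro!: compact_continuous_image connected_continuous_image continuous_on_subset [OF cont(1)])
  moreover have "open (\<phi> ` \<Omega>)" "closed (\<phi> ` L)"
    unfolding im using ring cont by (auto simp: ring_domain_def open_vimage closed_vimage)
  moreover have "\<phi> ` K \<union> \<phi> ` L = - \<phi> ` \<Omega>" "\<phi> ` K \<inter> \<phi> ` L = {}"
    unfolding im using ring by (auto simp: ring_domain_def)
  ultimately show ?thesis using ring by (simp add: ring_domain_def)
qed

section \<open>Round annuli and the degree of maps between them\<close>

text \<open>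
Up to scaling, these are all annuli of modulus m. The normalisation puts the unit circle
into every one of them, so that one circle can serve for all winding numbers.
\<close>
definition round_annulus :: "real \<Rightarrow> complex set" where
  "round_annulus m = annulus (exp (- m / 2)) (exp (m / 2))"

lemma mem_round_annulus:
  "z \<in> round_annulus m \<longleftrightarrow> exp (- m / 2) < cmod z \<and> cmod z < exp (m / 2)"
  by (auto simp: round_annulus_def annulus_def)

lemma exp_mem_round_annulus: "exp s \<in> round_annulus m \<longleftrightarrow> \<bar>Re s\<bar> < m / 2"
  by (auto simp: mem_round_annulus)

lemma round_annulus_nonzero: "z \<in> round_annulus m \<Longrightarrow> z \<noteq> 0"
  by (auto simp: mem_round_annulus)

lemma round_annulus_eq_exp_image: "round_annulus m = exp ` {s. \<bar>Re s\<bar> < m / 2}"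
proof -
  have "z \<in> exp ` {s. \<bar>Re s\<bar> < m / 2}" if "z \<in> round_annulus m" for z
  proof (rule image_eqI)
    show "z = exp (Ln z)" using round_annulus_nonzero [OF that] by simp
    with that show "Ln z \<in> {s. \<bar>Re s\<bar> < m / 2}" by (metis exp_mem_round_annulus mem_Collect_eq)
  qed
  then show ?thesis using exp_mem_round_annulus by blast
qed

lemma convex_strip: "convex {s::complex. \<bar>Re s\<bar> < c}"
proof -
  have "{s. \<bar>Re s\<bar> < c} = {s. Re s < c} \<inter> {s. - c < Re s}" by auto
  then show ?thesis
    using convex_halfspace_Re_lt convex_halfspace_Re_gt convex_Int by metis
qed

lemma open_strip: "open {s::complex. \<bar>Re s\<bar> < c}"
  by (intro open_Collect_less continuous_intros)

lemma open_round_annulus: "open (round_annulus m)"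
proof -
  have "round_annulus m = {z. exp (- m / 2) < cmod z} \<inter> {z. cmod z < exp (m / 2)}"
    by (auto simp: mem_round_annulus)
  moreover have "open {z. exp (- m / 2) < cmod z}" "open {z. cmod z < exp (m / 2)}"
    by (intro open_Collect_less continuous_intros)+
  ultimately show ?thesis by auto
qed

lemma connected_round_annulus: "connected (round_annulus m)"
  unfolding round_annulus_eq_exp_image
  by (intro connected_continuous_image convex_connected convex_strip continuous_intros)

lemma circle_in_round_annulus: "0 < m \<Longrightarrow> path_image (circlepath 0 1) \<subseteq> round_annulus m"
  by (auto simp: mem_round_annulus)

lemma path_compose_circle:
  assumes "continuous_on (sphere 0 r) f" "0 \<le> r"
  shows "path (f \<circ> circlepath 0 r)" "pathfinish (f \<circ> circlepath 0 r) = pathstart (f \<circ> circlepath 0 r)"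
    "path_image (f \<circ> circlepath 0 r) = f ` sphere 0 r"
proof -
  show "path (f \<circ> circlepath 0 r)"
    by (rule path_continuous_image) (use assms in auto)
  show "pathfinish (f \<circ> circlepath 0 r) = pathstart (f \<circ> circlepath 0 r)"
    by (metis pathfinish_circlepath pathstart_circlepath pathfinish_compose pathstart_compose)
  show "path_image (f \<circ> circlepath 0 r) = f ` sphere 0 r"
    using assms by (simp add: path_image_compose)
qed

lemma loop_through_annulus:
  assumes "f holomorphic_on round_annulus m" "0 < m"
  shows "path (f \<circ> circlepath 0 1)" "pathfinish (f \<circ> circlepath 0 1) = pathstart (f \<circ> circlepath 0 1)"
    "path_image (f \<circ> circlepath 0 1) = f ` sphere 0 1" "path_image (f \<circ> circlepath 0 1) \<subseteq> f ` round_annulus m"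
proof -
  have sub: "sphere 0 1 \<subseteq> round_annulus m"
    using circle_in_round_annulus [OF assms(2)] by simp
  then have cont: "continuous_on (sphere 0 1) f"
    using assms(1) holomorphic_on_imp_continuous_on continuous_on_subset by blast
  show "path (f \<circ> circlepath 0 1)" "pathfinish (f \<circ> circlepath 0 1) = pathstart (f \<circ> circlepath 0 1)"
    "path_image (f \<circ> circlepath 0 1) = f ` sphere 0 1"
    using path_compose_circle [OF cont] by auto
  then show "path_image (f \<circ> circlepath 0 1) \<subseteq> f ` round_annulus m"
    using sub by auto
qed

text \<open>
Along the circle of radius \<open>exp x\<close> the function g is a continuous logarithm of f - p, so its
increment over one period measures the winding.
\<close>
lemma winding_number_lift:
  assumes "\<And>s. Re s = x \<Longrightarrow> f (exp s) = p + exp (g s)"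
    and "continuous_on {s. Re s = x} g"
  shows "winding_number (f \<circ> circlepath 0 (exp x)) p
           = (g (of_real x + 2 * of_real pi * \<i>) - g (of_real x)) / (2 * of_real pi * \<i>)"
proof -
  define q where "q = (\<lambda>t::real. g (of_real x + 2 * of_real pi * \<i> * of_real t))"
  have "path q"
    unfolding path_def q_def
    by (rule continuous_on_compose2 [OF assms(2)]) (auto intro!: continuous_intros)
  have eq: "(\<lambda>t. (f \<circ> circlepath 0 (exp x)) t - p) = exp \<circ> q"
  proof
    fix t :: real
    have "circlepath 0 (exp x) t = exp (of_real x + 2 * of_real pi * \<i> * of_real t)"
      by (simp add: circlepath exp_add exp_of_real)
    then show "(f \<circ> circlepath 0 (exp x)) t - p = (exp \<circ> q) t"
      using assms(1) [of "of_real x + 2 * of_real pi * \<i> * of_real t"] by (simp add: q_def)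
  qed
  show ?thesis
    unfolding winding_number_offset [of "f \<circ> circlepath 0 (exp x)"] eq winding_number_compose_exp [OF \<open>path q\<close>]
    by (simp add: q_def pathfinish_def pathstart_def)
qed

text \<open>
Both half planes are mapped to the disc by Cayley transforms, the source with 1 and the
target with f 1 as centre; this turns the claim into the Schwarz lemma.
\<close>
lemma Schwarz_Pick_right_half_plane:
  assumes holf: "f holomorphic_on {z. 0 < Re z}"
    and f: "\<And>z. 0 < Re z \<Longrightarrow> 0 < Re (f z)"
    and x: "0 < x"
  shows "cmod (f (of_real x) - f 1) / cmod (f (of_real x) + cnj (f 1)) \<le> \<bar>x - 1\<bar> / (x + 1)"
proof -
  define C where "C = (\<lambda>\<zeta>::complex. (1 + \<zeta>) / (1 - \<zeta>))"
  define w where "w = f 1"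
  define F where "F = (\<lambda>\<zeta>. (f (C \<zeta>) - w) / (f (C \<zeta>) + cnj w))"
  have wpos: "0 < Re w" using f [of 1] by (simp add: w_def)
  have ReC: "0 < Re (C \<zeta>)" if "cmod \<zeta> < 1" for \<zeta>
  proof -
    have "1 - \<zeta> \<noteq> 0" using that by auto
    have "Re (C \<zeta>) = (1 - (cmod \<zeta>)\<^sup>2) / (cmod (1 - \<zeta>))\<^sup>2"
      unfolding C_def Re_divide cmod_power2 by (simp add: power2_eq_square algebra_simps)
    moreover have "(cmod \<zeta>)\<^sup>2 < 1" using that by (simp add: power_less_one_iff abs_square_less_1)
    ultimately show ?thesis using \<open>1 - \<zeta> \<noteq> 0\<close> by simp
  qed
  have small: "cmod (u - w) < cmod (u + cnj w)" if "0 < Re u" for u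
  proof -
    have "(cmod (u + cnj w))\<^sup>2 - (cmod (u - w))\<^sup>2 = 4 * Re u * Re w"
      unfolding cmod_power2 by (simp add: power2_eq_square algebra_simps)
    then have "(cmod (u - w))\<^sup>2 < (cmod (u + cnj w))\<^sup>2"
      using mult_pos_pos [OF that wpos] by simp
    then show ?thesis using power2_less_imp_less by (metis norm_ge_zero)
  qed
  have nz: "f (C \<zeta>) + cnj w \<noteq> 0" if "cmod \<zeta> < 1" for \<zeta>
    using small [OF f [OF ReC [OF that]]] by auto
  have "C holomorphic_on ball 0 1"
    unfolding C_def by (intro holomorphic_intros) auto
  then have "(f \<circ> C) holomorphic_on ball 0 1"
    by (rule holomorphic_on_compose_gen [OF _ holf]) (use ReC in auto)
  then have holF: "F holomorphic_on ball 0 1"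
    unfolding F_def o_def by (intro holomorphic_intros) (use nz in auto)
  have F0: "F 0 = 0" by (simp add: F_def C_def w_def)
  have F1: "cmod (F \<zeta>) < 1" if "cmod \<zeta> < 1" for \<zeta>
    using small [OF f [OF ReC [OF that]]] nz [OF that] by (simp add: F_def norm_divide)
  define \<zeta> where "\<zeta> = complex_of_real ((x - 1) / (x + 1))"
  have cz: "cmod \<zeta> = \<bar>x - 1\<bar> / (x + 1)" using x by (simp add: \<zeta>_def norm_divide del: of_real_divide)
  have "cmod \<zeta> < 1" using x unfolding cz by (simp add: divide_simps abs_if)
  have "C \<zeta> = of_real ((1 + (x - 1) / (x + 1)) / (1 - (x - 1) / (x + 1)))"
    by (simp add: C_def \<zeta>_def)
  also have "(1 + (x - 1) / (x + 1)) / (1 - (x - 1) / (x + 1)) = x"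
    using x by (simp add: field_simps)
  finally have "C \<zeta> = of_real x" .
  then show ?thesis
    using Schwarz_Lemma(1) [OF holF F0 F1 \<open>cmod \<zeta> < 1\<close>] cz
    by (simp add: F_def w_def norm_divide)
qed

lemma exp_eq_imp_diff_period:
  fixes a b :: complex
  assumes "exp a = exp b"
  obtains n :: int where "a - b = 2 * of_real pi * \<i> * of_int n"
  using assms unfolding exp_eq by (auto simp: algebra_simps)

text \<open>
The function f - p has no logarithm on the annulus itself, but it has one on the strip
that covers the annulus, and the winding number is the obstruction to periodicity of that logarithm.
\<close>
lemma holomorphic_log_on_annulus:
  assumes m: "0 < m"
    and hol: "f holomorphic_on round_annulus m"
    and omit: "\<And>z. z \<in> round_annulus m \<Longrightarrow> f z \<noteq> p"
  obtains g where "g holomorphic_on {s. \<bar>Re s\<bar> < m / 2}"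
    "\<And>s. \<bar>Re s\<bar> < m / 2 \<Longrightarrow> f (exp s) = p + exp (g s)"
    "winding_number (f \<circ> circlepath 0 1) p = (g (2 * of_real pi * \<i>) - g 0) / (2 * of_real pi * \<i>)"
proof -
  let ?S = "{s::complex. \<bar>Re s\<bar> < m / 2}"
  have "exp holomorphic_on ?S" by (intro holomorphic_intros)
  then have "(f \<circ> exp) holomorphic_on ?S"
    by (rule holomorphic_on_compose_gen [OF _ hol]) (auto simp: exp_mem_round_annulus)
  then have "(\<lambda>s. f (exp s) - p) holomorphic_on ?S" unfolding o_def by (intro holomorphic_intros)
  then obtain g where holg: "g holomorphic_on ?S" and g': "\<And>s. s \<in> ?S \<Longrightarrow> f (exp s) - p = exp (g s)"
  proof (rule contractible_imp_holomorphic_log)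
    show "contractible ?S" by (rule convex_imp_contractible [OF convex_strip])
    show "f (exp s) - p \<noteq> 0" if "s \<in> ?S" for s
      using omit [of "exp s"] that by (simp add: exp_mem_round_annulus)
  qed blast
  have g: "f (exp s) = p + exp (g s)" if "\<bar>Re s\<bar> < m / 2" for s
    using g' [of s] that by (simp add: diff_eq_eq add.commute)
  have "winding_number (f \<circ> circlepath 0 (exp 0)) p
      = (g (of_real 0 + 2 * of_real pi * \<i>) - g (of_real 0)) / (2 * of_real pi * \<i>)"
  proof (rule winding_number_lift)
    show "f (exp s) = p + exp (g s)" if "Re s = 0" for s using g that m by auto
    show "continuous_on {s. Re s = 0} g"
      using holomorphic_on_imp_continuous_on [OF holg] m by (rule_tac continuous_on_subset) auto
  qed
  then show thesis using that [OF holg g] by simp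
qed

text \<open>
If h had degree zero, its logarithmic lift would be periodic, and so would be its composition with
a logarithm of F - p; this makes the winding number of the composite vanish.
\<close>
lemma degree_nonzero_of_composite:
  assumes m: "0 < m" "0 < m'"
    and holh: "h holomorphic_on round_annulus m"
    and h: "h ` round_annulus m \<subseteq> round_annulus m'"
    and holF: "F holomorphic_on round_annulus m'"
    and omit: "\<And>z. z \<in> round_annulus m' \<Longrightarrow> F z \<noteq> p"
    and wn: "winding_number (F \<circ> h \<circ> circlepath 0 1) p \<noteq> 0"
  shows "winding_number (h \<circ> circlepath 0 1) 0 \<noteq> 0"
proof
  assume wn0: "winding_number (h \<circ> circlepath 0 1) 0 = 0"
  have h0: "h z \<noteq> 0" if "z \<in> round_annulus m" for z
    using h that round_annulus_nonzero by blast
  obtain g where holg: "g holomorphic_on {s. \<bar>Re s\<bar> < m / 2}"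
    and g: "\<And>s. \<bar>Re s\<bar> < m / 2 \<Longrightarrow> h (exp s) = 0 + exp (g s)"
    and gper: "winding_number (h \<circ> circlepath 0 1) 0 = (g (2 * of_real pi * \<i>) - g 0) / (2 * of_real pi * \<i>)"
    using holomorphic_log_on_annulus [OF m(1) holh h0] by blast
  obtain G where holG: "G holomorphic_on {s. \<bar>Re s\<bar> < m' / 2}"
    and G: "\<And>s. \<bar>Re s\<bar> < m' / 2 \<Longrightarrow> F (exp s) = p + exp (G s)"
    using holomorphic_log_on_annulus [OF m(2) holF omit] by blast
  have Reg: "\<bar>Re (g s)\<bar> < m' / 2" if "\<bar>Re s\<bar> < m / 2" for s
    using h that g [OF that] exp_mem_round_annulus [of s m] exp_mem_round_annulus [of "g s" m'] by auto
  have "winding_number ((F \<circ> h) \<circ> circlepath 0 (exp 0)) p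
      = ((G \<circ> g) (of_real 0 + 2 * of_real pi * \<i>) - (G \<circ> g) (of_real 0)) / (2 * of_real pi * \<i>)"
  proof (rule winding_number_lift)
    show "(F \<circ> h) (exp s) = p + exp ((G \<circ> g) s)" if "Re s = 0" for s
      using g [of s] G [OF Reg, of s] that m by simp
    have "(G \<circ> g) holomorphic_on {s. \<bar>Re s\<bar> < m / 2}"
      by (rule holomorphic_on_compose_gen [OF holg holG]) (use Reg in auto)
    then show "continuous_on {s. Re s = 0} (G \<circ> g)"
      by (rule continuous_on_subset [OF holomorphic_on_imp_continuous_on]) (use m in auto)
  qed
  moreover have "g (2 * of_real pi * \<i>) = g 0" using gper wn0 by simp
  ultimately show False using wn by simp
qed

text \<open>
The core curve of the annulus of modulus m has hyperbolic length \<open>2 * pi\<^sup>2 / m\<close>, and a curve of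
degree d in the annulus of modulus m' has length at least \<open>2 * pi\<^sup>2 * \<bar>d\<bar> / m'\<close>. Holomorphic maps do not
increase hyperbolic length, so \<open>\<bar>d\<bar> * m \<le> m'\<close>. The proof makes the comparison for the end points of
one period in the strips that cover the annuli, which exponentials carry to half planes.
\<close>
theorem modulus_le_of_nonzero_degree:
  assumes m: "0 < m" "0 < m'"
    and holh: "h holomorphic_on round_annulus m"
    and h: "h ` round_annulus m \<subseteq> round_annulus m'"
    and deg: "winding_number (h \<circ> circlepath 0 1) 0 \<noteq> 0"
  shows "m \<le> m'"
proof -
  let ?S = "{s::complex. \<bar>Re s\<bar> < m / 2}"
  have h0: "h z \<noteq> 0" if "z \<in> round_annulus m" for z
    using h that round_annulus_nonzero by blast
  obtain g where holg: "g holomorphic_on ?S"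
    and g: "\<And>s. \<bar>Re s\<bar> < m / 2 \<Longrightarrow> h (exp s) = 0 + exp (g s)"
    and gper: "winding_number (h \<circ> circlepath 0 1) 0 = (g (2 * of_real pi * \<i>) - g 0) / (2 * of_real pi * \<i>)"
    using holomorphic_log_on_annulus [OF m(1) holh h0] by blast
  have Reg: "\<bar>Re (g s)\<bar> < m' / 2" if "s \<in> ?S" for s
    using h that g [of s] exp_mem_round_annulus [of s m] exp_mem_round_annulus [of "g s" m'] by auto
  obtain d :: int where d: "g (2 * of_real pi * \<i>) - g 0 = 2 * of_real pi * \<i> * of_int d"
  proof (rule exp_eq_imp_diff_period)
    show "exp (g (2 * of_real pi * \<i>)) = exp (g 0)"
      using g [of "2 * of_real pi * \<i>"] g [of 0] m by simp
  qed
  have "d \<noteq> 0" using deg gper d by auto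
  define \<phi> where "\<phi> = (\<lambda>z. - (\<i> * of_real (m / pi)) * Ln z)"
  define f where "f = (\<lambda>z. exp (\<i> * of_real (pi / m') * g (\<phi> z)))"
  have \<phi>: "\<phi> z \<in> ?S" if "0 < Re z" for z
  proof -
    have "\<bar>Im (Ln z)\<bar> < pi / 2" using Re_Ln_pos_lt_imp [OF that] .
    then have "m / pi * \<bar>Im (Ln z)\<bar> < m / pi * (pi / 2)"
      using m by (intro mult_strict_left_mono) auto
    moreover have "Re (\<phi> z) = m / pi * Im (Ln z)" by (simp add: \<phi>_def)
    ultimately show ?thesis using m by (simp add: abs_mult)
  qed
  have pos_nonneg: "z \<notin> \<real>\<^sub>\<le>\<^sub>0" if "0 < Re z" for z :: complex
    using that by (auto simp: complex_nonpos_Reals_iff)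
  have "\<phi> holomorphic_on {z. 0 < Re z}"
    unfolding \<phi>_def by (intro holomorphic_intros) (use pos_nonneg in auto)
  then have "(g \<circ> \<phi>) holomorphic_on {z. 0 < Re z}"
    by (rule holomorphic_on_compose_gen [OF _ holg]) (use \<phi> in auto)
  then have holf: "f holomorphic_on {z. 0 < Re z}"
    unfolding f_def o_def by (intro holomorphic_intros)
  have fpos: "0 < Re (f z)" if "0 < Re z" for z
  proof -
    have "pi / m' * \<bar>Re (g (\<phi> z))\<bar> < pi / m' * (m' / 2)"
      using Reg [OF \<phi> [OF that]] m by (intro mult_strict_left_mono) auto
    then have "\<bar>pi / m' * Re (g (\<phi> z))\<bar> < pi / 2" using m by (simp add: abs_mult)
    then have "- (pi / 2) < pi / m' * Re (g (\<phi> z))" "pi / m' * Re (g (\<phi> z)) < pi / 2"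
      unfolding abs_less_iff by linarith+
    then have "0 < cos (pi / m' * Re (g (\<phi> z)))" by (rule cos_gt_zero_pi)
    then show ?thesis by (simp add: f_def Re_exp)
  qed
  define t where "t = exp (- 2 * pi\<^sup>2 / m)"
  define l where "l = exp (- 2 * pi\<^sup>2 * of_int d / m')"
  have tl: "0 < t" "t < 1" "0 < l" using m by (auto simp: t_def l_def)
  \<comment> \<open>The half-plane points 1 and t correspond to the end points 0 and \<open>2 \<pi> \<i>\<close> of one period of
  the strip; their images under f differ by the real factor l.\<close>
  have "Ln (of_real t) = of_real (- 2 * pi\<^sup>2 / m)"
    using tl by (simp add: Ln_of_real t_def del: of_real_divide of_real_mult)
  then have \<phi>t: "\<phi> (of_real t) = 2 * of_real pi * \<i>"
    using m by (simp add: \<phi>_def field_simps power2_eq_square)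
  have \<phi>1: "\<phi> 1 = 0" by (simp add: \<phi>_def)
  have "g (2 * of_real pi * \<i>) = g 0 + 2 * of_real pi * \<i> * of_int d"
    using d by (simp add: diff_eq_eq add.commute)
  moreover have "\<i> * of_real (pi / m') * (2 * of_real pi * \<i> * of_int d)
      = complex_of_real (- 2 * pi\<^sup>2 * of_int d / m')"
    by (simp add: complex_eq_iff power2_eq_square)
  ultimately have lift_t: "\<i> * of_real (pi / m') * g (2 * of_real pi * \<i>)
      = \<i> * of_real (pi / m') * g 0 + of_real (- 2 * pi\<^sup>2 * of_int d / m')"
    by (metis distrib_left)
  have ft: "f (of_real t) = f 1 * of_real l"
    unfolding f_def \<phi>t \<phi>1 l_def exp_of_real [symmetric] lift_t exp_add ..
  have f1: "f 1 \<noteq> 0" by (simp add: f_def)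
  have "\<bar>l - 1\<bar> / (l + 1) \<le> cmod (f (of_real t) - f 1) / cmod (f (of_real t) + cnj (f 1))"
  proof -
    have "f (of_real t) - f 1 = of_real (l - 1) * f 1" by (simp add: ft algebra_simps)
    then have num: "cmod (f (of_real t) - f 1) = \<bar>l - 1\<bar> * cmod (f 1)"
      by (simp only: norm_mult norm_of_real)
    have "cmod (f (of_real t) + cnj (f 1)) \<le> l * cmod (f 1) + cmod (f 1)"
      using norm_triangle_ineq [of "f (of_real t)" "cnj (f 1)"] tl by (simp add: ft norm_mult mult.commute)
    then have den: "cmod (f (of_real t) + cnj (f 1)) \<le> (l + 1) * cmod (f 1)"
      by (simp add: algebra_simps)
    have "0 < Re (f (of_real t)) + Re (f 1)"
      using fpos [of "of_real t"] fpos [of 1] tl by simp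
    then have "Re (f (of_real t) + cnj (f 1)) \<noteq> 0" by simp
    then have "f (of_real t) + cnj (f 1) \<noteq> 0" by (metis zero_complex.simps(1))
    then have dpos: "0 < cmod (f (of_real t) + cnj (f 1))" by simp
    have "\<bar>l - 1\<bar> / (l + 1) = (\<bar>l - 1\<bar> * cmod (f 1)) / ((l + 1) * cmod (f 1))"
      using f1 by simp
    also have "\<dots> \<le> (\<bar>l - 1\<bar> * cmod (f 1)) / cmod (f (of_real t) + cnj (f 1))"
      using den dpos by (intro divide_left_mono mult_pos_pos) (use dpos f1 tl in auto)
    finally show ?thesis using num by simp
  qed
  also have "\<dots> \<le> \<bar>t - 1\<bar> / (t + 1)"
    using Schwarz_Pick_right_half_plane [OF holf fpos tl(1)] by simp
  finally have "\<bar>l - 1\<bar> * (t + 1) \<le> (1 - t) * (l + 1)"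
    using tl by (simp add: field_simps)
  then have "t \<le> l \<and> t * l \<le> 1"
  proof (cases "l < 1")
    case True
    then have "t * l \<le> 1" using tl by (intro mult_le_one) auto
    then show ?thesis
      using \<open>\<bar>l - 1\<bar> * (t + 1) \<le> (1 - t) * (l + 1)\<close> True by (simp add: algebra_simps)
  next
    case False
    then show ?thesis
      using \<open>\<bar>l - 1\<bar> * (t + 1) \<le> (1 - t) * (l + 1)\<close> tl by (simp add: algebra_simps)
  qed
  then have "- 2 * pi\<^sup>2 / m \<le> - 2 * pi\<^sup>2 * of_int d / m'"
       "- 2 * pi\<^sup>2 / m + - 2 * pi\<^sup>2 * of_int d / m' \<le> 0"
    unfolding t_def l_def exp_add [symmetric] by auto
  then have "(2 * pi\<^sup>2) * (of_int \<bar>d\<bar> / m') \<le> (2 * pi\<^sup>2) * (1 / m)"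
    by (auto simp: abs_if)
  then have "of_int \<bar>d\<bar> / m' \<le> 1 / m"
    using mult_le_cancel_left_pos [of "2 * pi\<^sup>2" "of_int \<bar>d\<bar> / m'" "1 / m"] by simp
  then have "of_int \<bar>d\<bar> * m \<le> m'" using m by (simp add: field_simps)
  moreover have "1 \<le> real_of_int \<bar>d\<bar>" using \<open>d \<noteq> 0\<close> by linarith
  ultimately have "1 * m \<le> real_of_int \<bar>d\<bar> * m" using m by (intro mult_right_mono) auto
  then show ?thesis using \<open>of_int \<bar>d\<bar> * m \<le> m'\<close> by linarith
qed

section \<open>Fixed-point-free automorphisms of the disc\<close>

text \<open>
Composing with the Moebius map that sends \<open>\<tau> 0\<close> to 0 gives an automorphism fixing 0. By the Schwarz
lemma, for it and for its inverse, that automorphism is a rotation.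
\<close>
lemma disc_automorphism_form:
  assumes hol: "\<tau> holomorphic_on ball 0 1" "\<tau>' holomorphic_on ball 0 1"
    and inv: "\<And>z. z \<in> ball 0 1 \<Longrightarrow> \<tau> z \<in> ball 0 1 \<and> \<tau>' (\<tau> z) = z"
      "\<And>z. z \<in> ball 0 1 \<Longrightarrow> \<tau>' z \<in> ball 0 1 \<and> \<tau> (\<tau>' z) = z"
  obtains \<alpha> where "cmod \<alpha> = 1"
    "\<And>z. z \<in> ball 0 1 \<Longrightarrow> \<tau> z = (\<alpha> * z + \<tau> 0) / (1 + cnj (\<tau> 0) * \<alpha> * z)"
proof -
  define a where "a = \<tau> 0"
  have a: "cmod a < 1" using inv(1) [of 0] by (simp add: a_def)
  define h where "h = (\<lambda>z. Moebius_function 0 a (\<tau> z))"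
  define h' where "h' = (\<lambda>z. \<tau>' (Moebius_function 0 (- a) z))"
  have M: "cmod (Moebius_function 0 c z) < 1" if "cmod c < 1" "cmod z < 1" for c z
    using Moebius_function_norm_lt_1 that by blast
  have M1: "Moebius_function 0 (- a) (Moebius_function 0 a z) = z" if "cmod z < 1" for z
    by (rule Moebius_function_compose) (use a that in auto)
  have M2: "Moebius_function 0 a (Moebius_function 0 (- a) z) = z" if "cmod z < 1" for z
    by (rule Moebius_function_compose) (use a that in auto)
  have "(Moebius_function 0 a \<circ> \<tau>) holomorphic_on ball 0 1"
    by (rule holomorphic_on_compose_gen [OF hol(1) Moebius_function_holomorphic [OF a]]) (use inv in blast)
  then have holh: "h holomorphic_on ball 0 1" by (simp add: h_def o_def)
  have "(\<tau>' \<circ> Moebius_function 0 (- a)) holomorphic_on ball 0 1"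
    by (rule holomorphic_on_compose_gen [OF Moebius_function_holomorphic hol(2)]) (use a M in auto)
  then have holh': "h' holomorphic_on ball 0 1" by (simp add: h'_def o_def)
  have \<tau>1: "cmod (\<tau> z) < 1" "cmod (\<tau>' z) < 1" if "cmod z < 1" for z
    using inv that by auto
  have h1: "cmod (h z) < 1" "cmod (h' z) < 1" if "cmod z < 1" for z
    using M \<tau>1 a that by (simp_all add: h_def h'_def)
  have h0: "h 0 = 0" by (simp add: h_def a_def Moebius_function_def)
  have "h' 0 = \<tau>' a" by (simp add: h'_def Moebius_function_def)
  also have "\<dots> = 0" using inv(1) [of 0] by (simp add: a_def)
  finally have h'0: "h' 0 = 0" .
  have h'h: "h' (h z) = z" if "cmod z < 1" for z
    using M1 [OF \<tau>1(1) [OF that]] inv(1) [of z] that by (simp add: h_def h'_def)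
  let ?x = "1 / 2 :: complex"
  have x: "cmod ?x < 1" "?x \<noteq> 0" by (simp_all add: norm_divide)
  have "cmod (h ?x) \<le> cmod ?x"
    by (rule Schwarz_Lemma(1) [OF holh h0]) (use h1 x in auto)
  moreover have "cmod (h' (h ?x)) \<le> cmod (h ?x)"
    by (rule Schwarz_Lemma(1) [OF holh' h'0]) (use h1 x in auto)
  ultimately have "cmod (h ?x) = cmod ?x" using h'h [OF x(1)] by simp
  then have "\<exists>\<alpha>. (\<forall>z. cmod z < 1 \<longrightarrow> h z = \<alpha> * z) \<and> cmod \<alpha> = 1"
    using x by (intro Schwarz_Lemma(3) [OF holh h0 h1(1) x(1)]) blast+
  then obtain \<alpha> where \<alpha>: "\<And>z. cmod z < 1 \<Longrightarrow> h z = \<alpha> * z" "cmod \<alpha> = 1" by blast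
  have form: "\<tau> z = (\<alpha> * z + a) / (1 + cnj a * \<alpha> * z)" if "cmod z < 1" for z
  proof -
    have "\<tau> z = Moebius_function 0 (- a) (h z)" using M1 [OF \<tau>1(1) [OF that]] by (simp add: h_def)
    then show ?thesis using \<alpha>(1) [OF that] by (simp add: Moebius_function_def mult.assoc)
  qed
  show thesis
  proof (rule that [OF \<alpha>(2)])
    show "\<tau> z = (\<alpha> * z + \<tau> 0) / (1 + cnj (\<tau> 0) * \<alpha> * z)" if "z \<in> ball 0 1" for z
      using form [of z] that unfolding a_def by simp
  qed
qed

lemma affine_map_of_half_plane:
  assumes pos: "\<And>w. 0 < Re w \<Longrightarrow> 0 < Re (l * w + \<mu>)"
    and surj: "\<And>w. 0 < Re w \<Longrightarrow> \<exists>v. 0 < Re v \<and> w = l * v + \<mu>"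
    and l: "l \<noteq> 0"
  shows "0 < Re l \<and> Im l = 0 \<and> Re \<mu> = 0"
proof -
  have p: "0 < Re l * x - Im l * y + Re \<mu>" if "0 < x" for x y
    using pos [of "Complex x y"] that by simp
  have "Im l = 0"
    using p [of 1 "(Re l + Re \<mu>) / Im l"] by (cases "Im l = 0") auto
  have p': "0 < Re l * x + Re \<mu>" if "0 < x" for x
    using p [OF that, of 0] by simp
  have "Re l \<noteq> 0" using l \<open>Im l = 0\<close> by (simp add: complex_eq_iff)
  have "0 < Re l"
  proof (rule ccontr)
    assume "\<not> 0 < Re l"
    then have neg: "Re l < 0" using \<open>Re l \<noteq> 0\<close> by simp
    have "0 < (\<bar>Re \<mu>\<bar> + 1) / (- Re l)" using neg by (intro divide_pos_pos) auto
    from p' [OF this] show False using neg by simp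
  qed
  have "\<not> Re \<mu> < 0"
  proof
    assume "Re \<mu> < 0"
    then have "0 < - Re \<mu> / Re l" using \<open>0 < Re l\<close> by (simp add: divide_neg_pos)
    from p' [OF this] show False using \<open>0 < Re l\<close> by simp
  qed
  moreover have "\<not> 0 < Re \<mu>"
  proof
    assume "0 < Re \<mu>"
    then obtain v where v: "0 < Re v" "\<mu> = l * v + \<mu>" using surj by blast
    then have "l * v = 0" by simp
    then show False using l v(1) by auto
  qed
  ultimately show ?thesis using \<open>0 < Re l\<close> \<open>Im l = 0\<close> by simp
qed

text \<open>
The fixed-point equation is quadratic with roots whose product has modulus 1. As no root lies in the
open disc, there is a root \<zeta> on the unit circle. The Cayley transform \<psi> that sends \<zeta> to \<open>\<infinity>\<close> conjugates
\<tau> to an affine self-map of the right half plane: a dilation, possibly followed by a vertical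
translation, or a vertical translation alone.
\<close>
theorem fixed_point_free_disc_automorphism:
  assumes hol: "\<tau> holomorphic_on ball 0 1" "\<tau>' holomorphic_on ball 0 1"
    and inv: "\<And>z. z \<in> ball 0 1 \<Longrightarrow> \<tau> z \<in> ball 0 1 \<and> \<tau>' (\<tau> z) = z"
      "\<And>z. z \<in> ball 0 1 \<Longrightarrow> \<tau>' z \<in> ball 0 1 \<and> \<tau> (\<tau>' z) = z"
    and free: "\<And>z. z \<in> ball 0 1 \<Longrightarrow> \<tau> z \<noteq> z"
  obtains \<psi> \<kappa> l b where
    "\<psi> holomorphic_on ball 0 1" "\<kappa> holomorphic_on {w. 0 < Re w}"
    "\<And>z. z \<in> ball 0 1 \<Longrightarrow> 0 < Re (\<psi> z) \<and> \<kappa> (\<psi> z) = z"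
    "\<And>w. 0 < Re w \<Longrightarrow> \<kappa> w \<in> ball 0 1 \<and> \<psi> (\<kappa> w) = w"
    "0 < l" "l = 1 \<Longrightarrow> b \<noteq> 0"
    "\<And>z. z \<in> ball 0 1 \<Longrightarrow> \<psi> (\<tau> z) = of_real l * \<psi> z + \<i> * of_real b"
proof -
  obtain \<alpha> where \<alpha>: "cmod \<alpha> = 1"
    and form: "\<And>z. z \<in> ball 0 1 \<Longrightarrow> \<tau> z = (\<alpha> * z + \<tau> 0) / (1 + cnj (\<tau> 0) * \<alpha> * z)"
    using disc_automorphism_form [OF hol inv] by blast
  define a where "a = \<tau> 0"
  have a: "cmod a < 1" "a \<noteq> 0" using inv(1) [of 0] free [of 0] by (auto simp: a_def)
  have \<alpha>0: "\<alpha> \<noteq> 0" using \<alpha> by auto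
  have den: "1 + cnj a * \<alpha> * z \<noteq> 0" if "cmod z \<le> 1" for z
  proof
    assume "1 + cnj a * \<alpha> * z = 0"
    then have "cnj a * \<alpha> * z = - 1" by (simp add: add_eq_0_iff)
    then have "cmod (cnj a * \<alpha> * z) = 1" by simp
    then have "cmod a * cmod z = 1" using \<alpha> by (simp add: norm_mult)
    moreover have "cmod a * cmod z \<le> cmod a" using that by (intro mult_left_le) auto
    ultimately show False using a by simp
  qed
  have no_root: "cnj a * \<alpha> * z\<^sup>2 + (1 - \<alpha>) * z - a \<noteq> 0" if "cmod z < 1" for z
  proof
    assume "cnj a * \<alpha> * z\<^sup>2 + (1 - \<alpha>) * z - a = 0"
    then have "\<alpha> * z + a = z * (1 + cnj a * \<alpha> * z)"
      by (simp add: algebra_simps power2_eq_square)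
    then have "\<tau> z = z"
      using form [of z] den [of z] that by (simp add: a_def [symmetric])
    then show False using free that by simp
  qed
  define A where "A = cnj a * \<alpha>"
  define B where "B = 1 - \<alpha>"
  \<comment> \<open>A root of the fixed-point equation \<open>A z\<^sup>2 + B z - a = 0\<close>.\<close>
  define \<zeta> where "\<zeta> = (- B + csqrt (B\<^sup>2 + 4 * A * a)) / (2 * A)"
  have A: "A \<noteq> 0" using a \<alpha>0 by (simp add: A_def)
  have root: "A * \<zeta>\<^sup>2 + B * \<zeta> - a = 0"
  proof -
    have "2 * A * \<zeta> + B = csqrt (B\<^sup>2 + 4 * A * a)" using A by (simp add: \<zeta>_def)
    then have "(2 * A * \<zeta> + B)\<^sup>2 = B\<^sup>2 + 4 * A * a" by simp
    then have "4 * A * (A * \<zeta>\<^sup>2 + B * \<zeta> - a) = 0"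
      by (simp add: power2_eq_square algebra_simps)
    then show ?thesis using A by simp
  qed
  have \<zeta>0: "\<zeta> \<noteq> 0" using root a by auto
  have "cmod \<zeta> = 1"
  proof (rule ccontr)
    assume "cmod \<zeta> \<noteq> 1"
    moreover have "\<not> cmod \<zeta> < 1" using no_root root by (auto simp: A_def B_def)
    ultimately have big: "1 < cmod \<zeta>" by simp
    \<comment> \<open>The other root, which would lie in the open disc.\<close>
    define z where "z = - a / (A * \<zeta>)"
    have "A * z\<^sup>2 + B * z - a = - a / (A * \<zeta>\<^sup>2) * (A * \<zeta>\<^sup>2 + B * \<zeta> - a)"
      using A \<zeta>0 unfolding z_def by (simp add: field_simps power2_eq_square)
    also have "\<dots> = 0" using root by simp
    finally have "A * z\<^sup>2 + B * z - a = 0" .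
    moreover have "cmod z < 1"
      using big a \<alpha> by (simp add: z_def A_def norm_divide norm_mult divide_simps)
    ultimately show False using no_root by (auto simp: A_def B_def)
  qed
  define \<psi> where "\<psi> = (\<lambda>z. (\<zeta> + z) / (\<zeta> - z))"
  define \<kappa> where "\<kappa> = (\<lambda>w. \<zeta> * (w - 1) / (w + 1))"
  have ne: "\<zeta> - z \<noteq> 0" if "cmod z < 1" for z using \<open>cmod \<zeta> = 1\<close> that by auto
  have w1: "w + 1 \<noteq> 0" if "0 < Re w" for w
    using that by (auto simp: complex_eq_iff)
  have "cmod \<zeta> ^ 2 = 1" using \<open>cmod \<zeta> = 1\<close> by simp
  then have \<zeta>2: "(Re \<zeta>)\<^sup>2 + (Im \<zeta>)\<^sup>2 = 1" by (simp add: cmod_power2)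
  have Re\<psi>: "0 < Re (\<psi> z)" if "cmod z < 1" for z
  proof -
    have "Re (\<psi> z) = ((Re \<zeta>)\<^sup>2 + (Im \<zeta>)\<^sup>2 - (cmod z)\<^sup>2) / (cmod (\<zeta> - z))\<^sup>2"
      unfolding \<psi>_def Re_divide cmod_power2 by (simp add: power2_eq_square algebra_simps)
    moreover have "(cmod z)\<^sup>2 < 1" using that by (simp add: abs_square_less_1)
    ultimately show ?thesis using ne [OF that] \<zeta>2 by simp
  qed
  have \<kappa>1: "cmod (\<kappa> w) < 1" if "0 < Re w" for w
  proof -
    have "(cmod (w - 1))\<^sup>2 < (cmod (w + 1))\<^sup>2"
      using that unfolding cmod_power2 by (simp add: power2_eq_square algebra_simps)
    then have "cmod (w - 1) < cmod (w + 1)" using power2_less_imp_less by (metis norm_ge_zero)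
    then show ?thesis
      using \<open>cmod \<zeta> = 1\<close> w1 [OF that] by (simp add: \<kappa>_def norm_divide norm_mult)
  qed
  have \<kappa>\<psi>: "\<kappa> (\<psi> z) = z" if "cmod z < 1" for z
  proof -
    have eqs: "\<psi> z - 1 = 2 * z / (\<zeta> - z)" "\<psi> z + 1 = 2 * \<zeta> / (\<zeta> - z)"
      using ne [OF that] by (simp_all add: \<psi>_def field_simps)
    show ?thesis unfolding \<kappa>_def eqs using ne [OF that] \<zeta>0 by simp
  qed
  have \<psi>\<kappa>: "\<psi> (\<kappa> w) = w" if "0 < Re w" for w
  proof -
    have eqs: "\<zeta> + \<kappa> w = 2 * \<zeta> * w / (w + 1)" "\<zeta> - \<kappa> w = 2 * \<zeta> / (w + 1)"
      using w1 [OF that] by (simp_all add: \<kappa>_def field_simps)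
    show ?thesis unfolding \<psi>_def eqs using w1 [OF that] \<zeta>0 by simp
  qed
  have hol\<psi>: "\<psi> holomorphic_on ball 0 1"
    unfolding \<psi>_def by (intro holomorphic_intros) (use ne in auto)
  have hol\<kappa>: "\<kappa> holomorphic_on {w. 0 < Re w}"
    unfolding \<kappa>_def by (intro holomorphic_intros) (use w1 in auto)
  define E where "E = 1 + cnj a * \<alpha> * \<zeta>"
  define H where "H = 1 - cnj a * \<zeta>"
  have E0: "E \<noteq> 0" using den [of \<zeta>] \<open>cmod \<zeta> = 1\<close> by (simp add: E_def)
  have H0: "H \<noteq> 0"
  proof
    assume "H = 0"
    then have "cnj a * \<zeta> = 1" by (simp add: H_def)
    then have "cmod a * cmod \<zeta> = 1" by (metis complex_mod_cnj norm_mult norm_one)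
    then show False using a \<open>cmod \<zeta> = 1\<close> by simp
  qed
  define L where "L = E / (\<alpha> * H)"
  define \<mu> where "\<mu> = L - 1 - 2 * \<zeta> * cnj a / H"
  have conj: "\<psi> (\<tau> z) = L * \<psi> z + \<mu>" if z: "cmod z < 1" for z
  proof -
    define D where "D = 1 + cnj a * \<alpha> * z"
    have D0: "D \<noteq> 0" using den [of z] z by (simp add: D_def)
    have \<tau>z: "\<tau> z = (\<alpha> * z + a) / D" using form [of z] z by (simp add: a_def D_def)
    have "a = \<zeta> * E - \<alpha> * \<zeta>"
      using root by (simp add: E_def A_def B_def algebra_simps power2_eq_square)
    then have diff: "\<zeta> * D - (\<alpha> * z + a) = \<alpha> * H * (\<zeta> - z)"
      by (simp add: E_def D_def H_def) (simp add: algebra_simps)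
    have "\<psi> (\<tau> z) = (\<zeta> * D + (\<alpha> * z + a)) / (\<zeta> * D - (\<alpha> * z + a))"
    proof -
      have "\<zeta> + \<tau> z = (\<zeta> * D + (\<alpha> * z + a)) / D" "\<zeta> - \<tau> z = (\<zeta> * D - (\<alpha> * z + a)) / D"
        using D0 unfolding \<tau>z by (simp_all add: field_simps)
      then show ?thesis using D0 unfolding \<psi>_def by simp
    qed
    also have "\<dots> = (2 * \<zeta> * D - \<alpha> * H * (\<zeta> - z)) / (\<alpha> * H * (\<zeta> - z))"
      unfolding diff [symmetric] by simp
    also have "D = E - cnj a * \<alpha> * (\<zeta> - z)" by (simp add: D_def E_def algebra_simps)
    also have "(2 * \<zeta> * (E - cnj a * \<alpha> * (\<zeta> - z)) - \<alpha> * H * (\<zeta> - z)) / (\<alpha> * H * (\<zeta> - z))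
        = L * (2 * \<zeta> / (\<zeta> - z)) - 2 * \<zeta> * cnj a / H - 1"
      using ne [OF z] H0 \<alpha>0 by (simp add: L_def divide_simps) (simp add: algebra_simps)
    also have "2 * \<zeta> / (\<zeta> - z) = \<psi> z + 1" using ne [OF z] by (simp add: \<psi>_def field_simps)
    finally show ?thesis by (simp add: \<mu>_def algebra_simps)
  qed
  have pos: "0 < Re (L * w + \<mu>)" if "0 < Re w" for w
  proof -
    have "L * w + \<mu> = \<psi> (\<tau> (\<kappa> w))" using conj [OF \<kappa>1 [OF that]] \<psi>\<kappa> [OF that] by simp
    then show ?thesis using Re\<psi> inv(1) [of "\<kappa> w"] \<kappa>1 [OF that] by simp
  qed
  have surj: "\<exists>v. 0 < Re v \<and> w = L * v + \<mu>" if "0 < Re w" for w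
  proof (intro exI conjI)
    have \<tau>': "cmod (\<tau>' (\<kappa> w)) < 1" "\<tau> (\<tau>' (\<kappa> w)) = \<kappa> w" using inv(2) [of "\<kappa> w"] \<kappa>1 [OF that] by auto
    show "0 < Re (\<psi> (\<tau>' (\<kappa> w)))" using Re\<psi> \<tau>' by simp
    show "w = L * \<psi> (\<tau>' (\<kappa> w)) + \<mu>" using conj [OF \<tau>'(1)] \<tau>'(2) \<psi>\<kappa> [OF that] by simp
  qed
  have "L \<noteq> 0" using E0 \<alpha>0 H0 by (simp add: L_def)
  have L: "0 < Re L" "Im L = 0" "Re \<mu> = 0"
    using affine_map_of_half_plane [OF pos surj \<open>L \<noteq> 0\<close>] by auto
  have conj': "\<psi> (\<tau> z) = of_real (Re L) * \<psi> z + \<i> * of_real (Im \<mu>)" if "z \<in> ball 0 1" for z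
  proof -
    have "L = of_real (Re L)" "\<mu> = \<i> * of_real (Im \<mu>)" using L by (simp_all add: complex_eq_iff)
    then show ?thesis using conj [of z] that by simp
  qed
  show thesis
  proof (rule that [OF hol\<psi> hol\<kappa> _ _ L(1) _ conj'])
    show "0 < Re (\<psi> z) \<and> \<kappa> (\<psi> z) = z" if "z \<in> ball 0 1" for z using that Re\<psi> \<kappa>\<psi> by simp
    show "\<kappa> w \<in> ball 0 1 \<and> \<psi> (\<kappa> w) = w" if "0 < Re w" for w using that \<kappa>1 \<psi>\<kappa> by simp
    show "Im \<mu> \<noteq> 0" if "Re L = 1"
    proof
      assume "Im \<mu> = 0"
      then have "\<psi> (\<tau> 0) = \<psi> 0" using conj' [of 0] that by simp
      then have "\<tau> 0 = 0" using \<kappa>\<psi> [of "\<tau> 0"] \<kappa>\<psi> [of 0] inv(1) [of 0] by simp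
      then show False using free by simp
    qed
  qed
qed

section \<open>Winding numbers and simple connectedness\<close>

lemma open_image_translated_exp:
  fixes p :: complex
  assumes "open T"
  shows "open ((\<lambda>w. p + exp w) ` T)"
proof (rule open_mapping_thm [where S = UNIV and U = T])
  show "\<not> (\<lambda>w. p + exp w) constant_on UNIV"
  proof
    assume "(\<lambda>w. p + exp w) constant_on UNIV"
    then have "p + exp 0 = p + exp (1::complex)" unfolding constant_on_def by (metis UNIV_I)
    then show False by (simp add: complex_eq_iff Re_exp)
  qed
qed (use assms in \<open>auto intro!: holomorphic_intros\<close>)

text \<open>
Winding numbers are locally constant off the curve and vanish near infinity. Combined with the
definition of a ring domain this will show that curves in \<Omega> do not wind about L.
\<close>
lemma nonzero_winding_part:
  assumes \<gamma>: "path \<gamma>" "pathfinish \<gamma> = pathstart \<gamma>" and F: "closed F" "F \<inter> path_image \<gamma> = {}"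
  shows "compact {z \<in> F. winding_number \<gamma> z \<noteq> 0}"
    and "openin (top_of_set F) {z \<in> F. winding_number \<gamma> z \<noteq> 0}"
proof -
  let ?lev = "\<lambda>k. {z. z \<notin> path_image \<gamma> \<and> winding_number \<gamma> z = k}"
  have op: "open (?lev k)" for k by (rule open_winding_number_levelsets [OF \<gamma>])
  have "{z \<in> F. winding_number \<gamma> z \<noteq> 0} = F \<inter> - ?lev 0" using F by auto
  then have "closed {z \<in> F. winding_number \<gamma> z \<noteq> 0}" using F op by (simp add: closed_Int closed_Compl)
  moreover have "bounded {z \<in> F. winding_number \<gamma> z \<noteq> 0}"
    by (rule bounded_subset [OF bounded_winding_number_nz [OF \<gamma>]]) auto
  ultimately show "compact {z \<in> F. winding_number \<gamma> z \<noteq> 0}" by (simp add: compact_eq_bounded_closed)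
  have "{z \<in> F. winding_number \<gamma> z \<noteq> 0} = F \<inter> (\<Union>k\<in>- {0}. ?lev k)" using F by auto
  moreover have "open (\<Union>k\<in>- {0}. ?lev k)" using op by blast
  ultimately show "openin (top_of_set F) {z \<in> F. winding_number \<gamma> z \<noteq> 0}"
    by (simp only: openin_open_Int)
qed

lemma ring_domain_winding_outer:
  assumes ring: "ring_domain \<Omega> K L" and \<gamma>: "path \<gamma>" "pathfinish \<gamma> = pathstart \<gamma>" "path_image \<gamma> \<subseteq> \<Omega>"
    and z: "z \<in> L"
  shows "winding_number \<gamma> z = 0"
proof -
  have "closed L" "L \<inter> path_image \<gamma> = {}" using ring \<gamma> by (auto simp: ring_domain_def)
  then have "{z \<in> L. winding_number \<gamma> z \<noteq> 0} = {}"
    using nonzero_winding_part [OF \<gamma>(1,2), of L] ring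
    unfolding ring_domain_def by (elim conjE) (drule spec, erule mp, blast)
  then show ?thesis using z by blast
qed

lemma ring_domain_winding_inner:
  assumes ring: "ring_domain \<Omega> K L" and \<gamma>: "path \<gamma>" "pathfinish \<gamma> = pathstart \<gamma>" "path_image \<gamma> \<subseteq> \<Omega>"
    and z: "z \<in> K" "z' \<in> K"
  shows "winding_number \<gamma> z = winding_number \<gamma> z'"
  by (rule winding_number_eq [OF \<gamma>(1,2) z]) (use ring \<gamma> in \<open>auto simp: ring_domain_def\<close>)

text \<open>
The points of the complement of the logarithmic preimage about which \<gamma> winds form a compact,
relatively open set C of that complement. The local homeomorphism \<open>w \<mapsto> p + exp w\<close> maps C to a compact and relatively
open part E of \<open>K \<union> L\<close>. The part in L is empty since \<Omega> is a ring domain. The part in K is empty or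
all of K since K is connected, and it is not all of K because p is not a value of the map.
\<close>
lemma log_preimage_winding:
  assumes ring: "ring_domain \<Omega> K L" and p: "p \<in> K"
    and \<gamma>: "path \<gamma>" "pathfinish \<gamma> = pathstart \<gamma>" "path_image \<gamma> \<subseteq> {w. p + exp w \<in> \<Omega>}"
    and z: "p + exp z \<notin> \<Omega>"
  shows "winding_number \<gamma> z = 0"
proof (rule ccontr)
  assume nz: "winding_number \<gamma> z \<noteq> 0"
  define F where "F = - {w. p + exp w \<in> \<Omega>}"
  have "open \<Omega>" using ring by (simp add: ring_domain_def)
  then have "open ((\<lambda>w. p + exp w) -` \<Omega>)"
    by (intro open_vimage continuous_intros)
  then have "open {w. p + exp w \<in> \<Omega>}" by (simp add: vimage_def)
  then have F: "closed F" "F \<inter> path_image \<gamma> = {}" using \<gamma>(3) by (auto simp: F_def)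
  define C where "C = {z \<in> F. winding_number \<gamma> z \<noteq> 0}"
  have C: "compact C" "openin (top_of_set F) C"
    unfolding C_def using nonzero_winding_part [OF \<gamma>(1,2) F] by auto
  have "z \<in> C" using z nz by (simp add: C_def F_def)
  obtain T where T: "open T" "C = F \<inter> T" using C(2) by (auto simp: openin_open)
  define E where "E = (\<lambda>w. p + exp w) ` C"
  define N where "N = (\<lambda>w. p + exp w) ` T"
  have "open N" unfolding N_def by (rule open_image_translated_exp [OF T(1)])
  have "compact E" unfolding E_def by (intro compact_continuous_image continuous_intros C)
  have EN: "E = (K \<union> L) \<inter> N"
    using T ring unfolding E_def N_def F_def ring_domain_def by auto
  have "compact (E \<inter> L)" using \<open>compact E\<close> ring by (auto simp: ring_domain_def)
  moreover have "openin (top_of_set L) (E \<inter> L)"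
    using EN \<open>open N\<close> by (auto simp: openin_open)
  ultimately have "E \<inter> L = {}" using ring by (simp add: ring_domain_def)
  have "closedin (top_of_set K) (E \<inter> K)"
    using \<open>compact E\<close> compact_imp_closed by (metis closedin_closed inf_commute)
  moreover have "openin (top_of_set K) (E \<inter> K)"
    using EN \<open>open N\<close> by (auto simp: openin_open)
  ultimately have "E \<inter> K = {} \<or> E \<inter> K = K"
    using ring unfolding ring_domain_def connected_clopen by blast
  moreover have "p \<notin> E" by (auto simp: E_def)
  ultimately have "E \<inter> K = {}" using p by blast
  then have "E = {}" using \<open>E \<inter> L = {}\<close> EN by blast
  then show False using \<open>z \<in> C\<close> by (simp add: E_def)
qed

text \<open>
A curve in one component of U does not wind about points outside U by assumption. About
a point z of another component it winds as often as about a boundary point of that component,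
which lies outside U; if the component has no boundary point it is unbounded, and then the winding
number vanishes anyway.
\<close>
lemma simply_connected_component:
  fixes U :: "complex set"
  assumes U: "open U"
    and wn: "\<And>\<gamma> z. path \<gamma> \<Longrightarrow> pathfinish \<gamma> = pathstart \<gamma> \<Longrightarrow> path_image \<gamma> \<subseteq> U \<Longrightarrow> z \<notin> U \<Longrightarrow> winding_number \<gamma> z = 0"
  shows "simply_connected (connected_component_set U w)"
proof -
  let ?U0 = "connected_component_set U w"
  have "winding_number \<gamma> z = 0" if \<gamma>: "path \<gamma>" "path_image \<gamma> \<subseteq> ?U0" "pathfinish \<gamma> = pathstart \<gamma>" and z: "z \<notin> ?U0" for \<gamma> z
  proof (cases "z \<in> U")
    case False
    then show ?thesis using wn \<gamma> connected_component_subset by (metis subset_trans)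
  next
    case True
    define U1 where "U1 = connected_component_set U z"
    have U1: "open U1" "connected U1" "z \<in> U1" "U1 \<inter> ?U0 = {}"
      unfolding U1_def using U True z
      by (auto simp: open_connected_component connected_component_disjoint connected_component_refl)
    show ?thesis
    proof (rule ccontr)
      assume nz: "winding_number \<gamma> z \<noteq> 0"
      have "U1 \<inter> path_image \<gamma> = {}" using U1(4) \<gamma>(2) by blast
      then have "winding_number \<gamma> u \<noteq> 0" if "u \<in> U1" for u
        using winding_number_eq [OF \<gamma>(1,3) that U1(3,2)] nz by simp
      then have "bounded U1"
        by (intro bounded_subset [OF bounded_winding_number_nz [OF \<gamma>(1,3)]]) auto
      then have "U1 \<noteq> UNIV" using not_bounded_UNIV by blast
      then obtain q where q: "q \<in> frontier U1" using U1(3) frontier_not_empty by blast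
      have "q \<notin> U1" using q U1(1) by (simp add: frontier_def interior_open)
      have "q \<notin> U"
      proof
        assume "q \<in> U"
        then have "open (connected_component_set U q)" "q \<in> connected_component_set U q"
          using U by (auto simp: open_connected_component connected_component_refl)
        moreover have "q \<in> closure U1" using q by (simp add: frontier_def)
        ultimately obtain x where "x \<in> connected_component_set U q" "x \<in> U1"
          by (meson closure_iff_nhds_not_empty disjoint_iff subset_refl)
        then have "q \<in> U1" unfolding U1_def
          by (metis connected_component_eq connected_component_refl \<open>q \<in> U\<close> mem_Collect_eq)
        then show False using \<open>q \<notin> U1\<close> by blast
      qed
      then have "winding_number \<gamma> q = 0" using wn \<gamma> connected_component_subset by (metis subset_trans)
      moreover have "winding_number \<gamma> z = winding_number \<gamma> q"
      proof (rule winding_number_eq [OF \<gamma>(1,3)])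
        show "z \<in> closure U1" using U1(3) closure_subset by blast
        show "q \<in> closure U1" using q by (simp add: frontier_def)
        show "connected (closure U1)" using U1(2) by (rule connected_imp_connected_closure)
        have "closure U1 \<inter> ?U0 = {}"
          using open_Int_closure_eq_empty [of ?U0 U1] U1(4) U by (auto simp: open_connected_component Int_commute)
        then show "closure U1 \<inter> path_image \<gamma> = {}" using \<gamma>(2) by blast
      qed
      ultimately show False using nz by simp
    qed
  qed
  then show ?thesis
    using simply_connected_eq_winding_number_zero [OF open_connected_component [OF U]]
      connected_connected_component by blast
qed

section \<open>The logarithmic cover of a ring domain\<close>

lemma component_translation:
  fixes c :: complex
  assumes U: "\<And>w. w + c \<in> U \<longleftrightarrow> w \<in> U"
  shows "connected_component_set U (w + c) = (\<lambda>u. u + c) ` connected_component_set U w"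
proof -
  have incl: "(\<lambda>u. u + d) ` connected_component_set U v \<subseteq> connected_component_set U (v + d)"
    if "\<And>w. w + d \<in> U \<longleftrightarrow> w \<in> U" for d v
  proof (cases "v \<in> U")
    case True
    show ?thesis
    proof (rule connected_component_maximal)
      show "v + d \<in> (\<lambda>u. u + d) ` connected_component_set U v"
        using True by (auto simp: connected_component_refl)
      show "connected ((\<lambda>u. u + d) ` connected_component_set U v)"
        by (intro connected_continuous_image continuous_intros connected_connected_component)
      show "(\<lambda>u. u + d) ` connected_component_set U v \<subseteq> U"
        using that connected_component_subset by auto
    qed
  next
    case False
    then have "connected_component_set U v = {}" by (rule connected_component_eq_empty [THEN iffD2])
    then show ?thesis by (simp only: image_empty empty_subsetI)
  qed
  have "w - c \<in> U \<longleftrightarrow> w \<in> U" for w using U [of "w - c"] by simp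
  then have "(\<lambda>u. u + - c) ` connected_component_set U (w + c) \<subseteq> connected_component_set U w"
    using incl [of "- c" "w + c"] by simp
  then have "connected_component_set U (w + c) \<subseteq> (\<lambda>u. u + c) ` connected_component_set U w"
    by (force simp: image_subset_iff image_iff)
  then show ?thesis using incl [OF U] by blast
qed

text \<open>
The set K would be a bounded component of the complement.
\<close>
lemma ring_domain_not_simply_connected:
  assumes "ring_domain \<Omega> K L"
  shows "\<not> simply_connected \<Omega>"
proof
  assume sc: "simply_connected \<Omega>"
  have K: "K \<union> L = - \<Omega>" "K \<inter> L = {}" "compact K" "connected K" "K \<noteq> {}" "closed L" "open \<Omega>"
    using assms by (auto simp: ring_domain_def)
  have "K \<in> components (- \<Omega>)"
    unfolding in_components_maximal
  proof (intro conjI allI impI)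
    show "K \<noteq> {}" "K \<subseteq> - \<Omega>" "connected K" using K by auto
    fix d assume d: "d \<noteq> {} \<and> K \<subseteq> d \<and> d \<subseteq> - \<Omega> \<and> connected d"
    show "d = K"
    proof (rule ccontr)
      assume "d \<noteq> K"
      then have "L \<inter> d \<noteq> {}" "K \<inter> d \<noteq> {}" "d \<subseteq> K \<union> L" "K \<inter> L \<inter> d = {}" using d K by auto
      moreover have "connected d" using d by blast
      ultimately show False
        using compact_imp_closed [OF K(3)] K(6) unfolding connected_closed by blast
    qed
  qed
  then have "\<not> bounded K"
    using sc simply_connected_eq_unbounded_complement_components [OF K(7)] by blast
  then show False using K(3) compact_imp_bounded by blast
qed

text \<open>
The set V is a component of \<open>{w. p + exp w \<in> \<Omega>}\<close>. Translations by \<open>2 \<pi> \<i> k\<close> permute the components,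
transitively because \<Omega> is connected, and those that preserve V form a subgroup S of the integers.
If S were trivial, V would be homeomorphic to \<Omega>, which is not simply connected. Hence S is
generated by its least positive element n.
\<close>
theorem logarithmic_cover:
  assumes ring: "ring_domain \<Omega> K L" and p: "p \<in> K" and p': "p' \<in> K" "p' \<noteq> p"
  obtains V and n :: int where "open V" "simply_connected V" "V \<noteq> {}" "V \<noteq> UNIV" "0 < n"
    "(\<lambda>w. p + exp w) ` V = \<Omega>"
    "\<And>w. w + 2 * of_real pi * \<i> * of_int n \<in> V \<longleftrightarrow> w \<in> V"
    "\<And>w w'. w \<in> V \<Longrightarrow> w' \<in> V \<Longrightarrow> exp w = exp w' \<Longrightarrow>
       \<exists>j::int. w' = w + of_int j * (2 * of_real pi * \<i> * of_int n)"
proof -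
  have \<Omega>: "open \<Omega>" "connected \<Omega>" "\<Omega> \<noteq> {}" "p \<notin> \<Omega>" "p' \<notin> \<Omega>"
    using ring p p' by (auto simp: ring_domain_def)
  define U where "U = {w. p + exp w \<in> \<Omega>}"
  have "open ((\<lambda>w. p + exp w) -` \<Omega>)" by (intro open_vimage continuous_intros \<Omega>)
  then have opU: "open U" by (simp add: vimage_def U_def)
  define c where "c = (\<lambda>k::int. 2 * of_real pi * \<i> * of_int k :: complex)"
  have c_add: "c (j + k) = c j + c k" and c_minus: "c (- k) = - c k" for j k
    by (simp_all add: c_def algebra_simps)
  have exp_c: "exp (w + c k) = exp w" for w k
    unfolding exp_eq by (intro exI [of _ k]) (simp add: c_def)
  have exp_eqD: "\<exists>k. w' = w + c k" if "exp w = exp w'" for w w'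
    using exp_eq_imp_diff_period [of w' w] that unfolding c_def by (metis add.commute diff_add_cancel)
  have Uc: "w + c k \<in> U \<longleftrightarrow> w \<in> U" for w k by (simp add: U_def exp_c)
  obtain x where x: "x \<in> \<Omega>" using \<Omega> by blast
  define w0 where "w0 = Ln (x - p)"
  have lnU: "Ln (y - p) \<in> U \<and> p + exp (Ln (y - p)) = y" if "y \<in> \<Omega>" for y
  proof -
    have "y - p \<noteq> 0" using that \<Omega>(4) by auto
    then show ?thesis using that by (simp add: U_def)
  qed
  then have w0: "w0 \<in> U" using x by (simp add: w0_def)
  define comp where "comp = (\<lambda>w. connected_component_set U w)"
  have comp_shift: "comp (w + c k) = (\<lambda>u. u + c k) ` comp w" for w k
    unfolding comp_def by (rule component_translation) (rule Uc)
  have comp_eq: "comp v = comp w" if "v \<in> comp w" for v w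
    using that unfolding comp_def by (metis connected_component_eq mem_Collect_eq)
  have comp_refl: "w \<in> comp w" if "w \<in> U" for w
    using that by (simp add: comp_def connected_component_refl)
  have comp_sub: "comp w \<subseteq> U" for w unfolding comp_def by (rule connected_component_subset)
  define V where "V = comp w0"
  have V: "open V" "V \<subseteq> U" "w0 \<in> V"
    unfolding V_def using comp_sub comp_refl [OF w0] opU by (auto simp: comp_def open_connected_component)
  have scV: "simply_connected V"
    unfolding V_def comp_def
  proof (rule simply_connected_component [OF opU])
    fix \<gamma> z assume \<gamma>: "path \<gamma>" "pathfinish \<gamma> = pathstart \<gamma>" "path_image \<gamma> \<subseteq> U" "z \<notin> U"
    show "winding_number \<gamma> z = 0"
      by (rule log_preimage_winding [OF ring p \<gamma>(1,2)]) (use \<gamma>(3,4) in \<open>auto simp: U_def\<close>)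
  qed
  have "V \<noteq> UNIV"
  proof
    assume "V = UNIV"
    then have "Ln (p' - p) \<in> U" using V by auto
    then show False using p'(2) \<Omega>(5) by (simp add: U_def)
  qed
  define S where "S = {k. w0 + c k \<in> V}"
  have S_iff: "w + c k \<in> V \<longleftrightarrow> k \<in> S" if "w \<in> V" for w k
  proof
    assume "w + c k \<in> V"
    then have "V = comp (w + c k)" using comp_eq V_def by metis
    also have "\<dots> = (\<lambda>u. u + c k) ` V" using comp_shift comp_eq that V_def by metis
    finally show "k \<in> S" using V(3) by (auto simp: S_def)
  next
    assume "k \<in> S"
    then have "V = comp (w0 + c k)" using comp_eq V_def by (auto simp: S_def)
    also have "\<dots> = (\<lambda>u. u + c k) ` V" using comp_shift V_def by simp
    finally show "w + c k \<in> V" using that by blast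
  qed
  have S_add: "j + k \<in> S" if "j \<in> S" "k \<in> S" for j k
    using S_iff [of "w0 + c j" k] that by (simp add: S_def c_add add.assoc)
  have S_minus: "- k \<in> S" if "k \<in> S" for k
    using S_iff [of "w0 + c k" "- k"] that V(3) by (simp add: S_def c_minus)
  have S0: "0 \<in> S" using V(3) by (simp add: S_def c_def)
  have surj: "(\<lambda>w. p + exp w) ` V = \<Omega>"
  proof -
    define q where "q = (\<lambda>w. p + exp w)"
    \<comment> \<open>The images of V and of the components that are not translates of V are disjoint open sets
    covering \<Omega>; so the second one is empty.\<close>
    define A where "A = (\<Union>w\<in>{w \<in> U. q w \<notin> q ` V}. comp w)"
    have op: "open (q ` T)" if "open T" for T
      unfolding q_def by (rule open_image_translated_exp [OF that])
    have V\<Omega>: "q ` V \<subseteq> \<Omega>" using V by (auto simp: U_def q_def)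
    have "open A"
      unfolding A_def by (intro open_UN ballI) (simp add: comp_def open_connected_component opU)
    have cover: "\<Omega> \<subseteq> q ` V \<union> q ` A"
    proof
      fix y assume y: "y \<in> \<Omega>"
      show "y \<in> q ` V \<union> q ` A"
      proof (cases "y \<in> q ` V")
        case False
        define w where "w = Ln (y - p)"
        have w: "w \<in> U" "q w = y" using lnU [OF y] by (simp_all add: w_def q_def)
        then have "w \<in> A" using False comp_refl [OF w(1)] by (auto simp: A_def)
        then show ?thesis using w(2) by blast
      qed auto
    qed
    have "q ` V \<inter> q ` A = {}"
    proof (rule ccontr)
      assume "q ` V \<inter> q ` A \<noteq> {}"
      then obtain a b where ab: "b \<in> V" "a \<in> A" "q a = q b" by fastforce
      then obtain w where w: "w \<in> U" "q w \<notin> q ` V" "a \<in> comp w" by (auto simp: A_def)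
      obtain k where k: "b = a + c k" using exp_eqD [of a b] ab(3) by (auto simp: q_def)
      have "V = comp b" using comp_eq [of b w0] ab(1) by (simp add: V_def)
      also have "\<dots> = (\<lambda>u. u + c k) ` comp w" unfolding k comp_shift using comp_eq [OF w(3)] by simp
      finally have "w + c k \<in> V" using comp_refl [OF w(1)] by blast
      then have "q (w + c k) \<in> q ` V" by blast
      then show False using w(2) by (simp add: q_def exp_c)
    qed
    then have "q ` V \<inter> \<Omega> = {} \<or> q ` A \<inter> \<Omega> = {}"
      using connectedD [OF \<Omega>(2) op [OF V(1)] op [OF \<open>open A\<close>] _ cover] by simp
    moreover have "q ` V \<inter> \<Omega> \<noteq> {}" using V\<Omega> V(3) by blast
    ultimately show ?thesis using cover V\<Omega> unfolding q_def by blast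
  qed
  have "\<exists>k\<in>S. 0 < k"
  proof (rule ccontr)
    assume no: "\<not> (\<exists>k\<in>S. 0 < k)"
    have triv: "k = 0" if "k \<in> S" for k
      using no that S_minus [OF that] by (metis linorder_neqE_linordered_idom neg_0_less_iff_less)
    have inj: "inj_on (\<lambda>w. p + exp w) V"
    proof (rule inj_onI)
      fix w w' assume w: "w \<in> V" "w' \<in> V" "p + exp w = p + exp w'"
      then obtain k where k: "w' = w + c k" using exp_eqD by auto
      then have "k = 0" using triv S_iff [OF w(1)] w(2) by blast
      then show "w = w'" using k by (simp add: c_def)
    qed
    have "(\<lambda>w. p + exp w) holomorphic_on V" by (intro holomorphic_intros)
    then obtain g where g: "g holomorphic_on \<Omega>" "\<And>w. w \<in> V \<Longrightarrow> g (p + exp w) = w"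
      using holomorphic_has_inverse [OF _ V(1) inj] unfolding surj by metis
    have "homeomorphism V \<Omega> (\<lambda>w. p + exp w) g"
      unfolding homeomorphism_def
    proof (intro conjI ballI)
      show "g ` \<Omega> = V" using g(2) unfolding surj [symmetric] by force
      show "p + exp (g y) = y" if "y \<in> \<Omega>" for y using g(2) that unfolding surj [symmetric] by auto
      show "continuous_on \<Omega> g" using g(1) holomorphic_on_imp_continuous_on by blast
    qed (use g surj in \<open>auto intro!: continuous_intros\<close>)
    then have "V homeomorphic \<Omega>" unfolding homeomorphic_def by blast
    then have "simply_connected \<Omega>" using scV homeomorphic_simply_connected_eq by blast
    then show False using ring_domain_not_simply_connected [OF ring] by blast
  qed
  then obtain k0 where k0: "k0 \<in> S" "0 < k0" by blast
  define n where "n = int (LEAST m. 0 < m \<and> int m \<in> S)"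
  have "0 < (LEAST m. 0 < m \<and> int m \<in> S) \<and> n \<in> S"
    unfolding n_def by (rule LeastI [where k = "nat k0"]) (use k0 in auto)
  then have n: "0 < n" "n \<in> S" by (auto simp: n_def)
  have least: "n \<le> k" if "k \<in> S" "0 < k" for k
    using Least_le [of "\<lambda>m. 0 < m \<and> int m \<in> S" "nat k"] that unfolding n_def by auto
  have mult: "int m * n \<in> S" for m
    by (induction m) (use S0 S_add n in \<open>auto simp: algebra_simps\<close>)
  have multi: "m * n \<in> S" for m :: int
  proof (cases "0 \<le> m")
    case True
    then show ?thesis using mult [of "nat m"] by simp
  next
    case False
    then show ?thesis using S_minus [OF mult [of "nat (- m)"]] by simp
  qed
  have dvd: "\<exists>j. k = j * n" if "k \<in> S" for k
  proof -
    have "k mod n = k + (- (k div n)) * n" by (simp add: minus_div_mult_eq_mod [symmetric])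
    then have "k mod n \<in> S" using S_add [OF that multi [of "- (k div n)"]] by simp
    moreover have "0 \<le> k mod n" "k mod n < n" using n by simp_all
    ultimately have "k mod n = 0" using least [of "k mod n"] by linarith
    then show ?thesis by (metis dvd_def mod_eq_0_iff_dvd mult.commute)
  qed
  show thesis
  proof (rule that [OF V(1) scV _ \<open>V \<noteq> UNIV\<close> n(1) surj])
    show "V \<noteq> {}" using V by blast
    show "w + 2 * of_real pi * \<i> * of_int n \<in> V \<longleftrightarrow> w \<in> V" for w
    proof
      assume "w + 2 * of_real pi * \<i> * of_int n \<in> V"
      then have w: "w + c n \<in> V" by (simp add: c_def)
      then have "(w + c n) + c (- n) \<in> V" using S_iff S_minus [OF n(2)] by blast
      then show "w \<in> V" by (simp add: c_minus)
    next
      assume "w \<in> V"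
      then show "w + 2 * of_real pi * \<i> * of_int n \<in> V" using S_iff n(2) by (simp add: c_def)
    qed
    show "\<exists>j::int. w' = w + of_int j * (2 * of_real pi * \<i> * of_int n)"
      if w: "w \<in> V" "w' \<in> V" "exp w = exp w'" for w w'
    proof -
      obtain k where k: "w' = w + c k" using exp_eqD w(3) by blast
      then have "k \<in> S" using S_iff w by blast
      then obtain j where "k = j * n" using dvd by blast
      then show ?thesis using k by (intro exI [of _ j]) (simp add: c_def algebra_simps)
    qed
  qed
qed

section \<open>Conformal quotients by a translation\<close>

text \<open>
Under a Riemann map of V the translation by c becomes an automorphism of the disc without fixed points,
which is conjugate to \<open>w \<mapsto> l * w + \<i> * b\<close> on the right half plane. For \<open>l \<noteq> 1\<close> a shift makes b
vanish and the logarithm turns the half plane into a strip. In either case the coordinate s is scaled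
so that the translation by c becomes a translation by \<open>2 \<pi> \<i>\<close>, up to orientation in the second case.
\<close>
lemma translation_quotient:
  fixes c :: complex
  assumes V: "open V" "simply_connected V" "V \<noteq> {}" "V \<noteq> UNIV" and c: "c \<noteq> 0"
    and shift: "\<And>w. w + c \<in> V \<longleftrightarrow> w \<in> V"
  obtains (strip) m P where "0 < m" "P holomorphic_on {s. \<bar>Re s\<bar> < m / 2}"
      "inj_on P {s. \<bar>Re s\<bar> < m / 2}" "P ` {s. \<bar>Re s\<bar> < m / 2} = V"
      "\<And>s. \<bar>Re s\<bar> < m / 2 \<Longrightarrow> P (s + 2 * of_real pi * \<i>) = P s + c"
    | (half_plane) P d where "P holomorphic_on {s. Re s < 0}" "P ` {s. Re s < 0} = V" "d = c \<or> d = - c"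
      "\<And>s. Re s < 0 \<Longrightarrow> P (s + 2 * of_real pi * \<i>) = P s + d"
proof -
  obtain f g where fg: "f holomorphic_on V" "g holomorphic_on ball 0 1"
    "\<And>z. z \<in> V \<Longrightarrow> f z \<in> ball 0 1 \<and> g (f z) = z" "\<And>z. z \<in> ball 0 1 \<Longrightarrow> g z \<in> V \<and> f (g z) = z"
    using simply_connected_eq_biholomorphic_to_disc [OF V(1)] V(2-4) by blast
  have shift': "w - c \<in> V \<longleftrightarrow> w \<in> V" for w using shift [of "w - c"] by simp
  define \<tau> where "\<tau> = (\<lambda>z. f (g z + c))"
  define \<tau>' where "\<tau>' = (\<lambda>z. f (g z - c))"
  have "(f \<circ> (\<lambda>z. g z + c)) holomorphic_on ball 0 1" "(f \<circ> (\<lambda>z. g z - c)) holomorphic_on ball 0 1"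
    by (rule holomorphic_on_compose_gen [OF _ fg(1)];
        (intro holomorphic_intros fg(2))?; use fg(4) shift shift' in blast)+
  then have hol: "\<tau> holomorphic_on ball 0 1" "\<tau>' holomorphic_on ball 0 1"
    by (simp_all add: \<tau>_def \<tau>'_def o_def)
  have g\<tau>: "g (\<tau> z) = g z + c" "g (\<tau>' z) = g z - c" "\<tau> z \<in> ball 0 1" "\<tau>' z \<in> ball 0 1"
    if "z \<in> ball 0 1" for z
    using fg(4) [OF that] fg(3) [of "g z + c"] fg(3) [of "g z - c"] shift shift'
    unfolding \<tau>_def \<tau>'_def by auto
  have inv1: "\<tau>' (\<tau> z) = z" "\<tau> (\<tau>' z) = z" if "z \<in> ball 0 1" for z
    using g\<tau> [OF that] fg(4) [OF that] unfolding \<tau>_def \<tau>'_def by simp_all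
  have free: "\<tau> z \<noteq> z" if "z \<in> ball 0 1" for z
    using g\<tau>(1) [OF that] c by auto
  obtain \<psi> \<kappa> l b where \<psi>: "\<psi> holomorphic_on ball 0 1" and \<kappa>: "\<kappa> holomorphic_on {w. 0 < Re w}"
    and \<psi>1: "\<And>z. z \<in> ball 0 1 \<Longrightarrow> 0 < Re (\<psi> z) \<and> \<kappa> (\<psi> z) = z"
    and \<kappa>1: "\<And>w. 0 < Re w \<Longrightarrow> \<kappa> w \<in> ball 0 1 \<and> \<psi> (\<kappa> w) = w"
    and l: "0 < l" "l = 1 \<Longrightarrow> b \<noteq> 0"
    and conj: "\<And>z. z \<in> ball 0 1 \<Longrightarrow> \<psi> (\<tau> z) = of_real l * \<psi> z + \<i> * of_real b"
    using fixed_point_free_disc_automorphism [OF hol conjI [OF g\<tau>(3) inv1(1)] conjI [OF g\<tau>(4) inv1(2)] free]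
    by blast
  define G where "G = (\<lambda>w. g (\<kappa> w))"
  have "(g \<circ> \<kappa>) holomorphic_on {w. 0 < Re w}"
    by (rule holomorphic_on_compose_gen [OF \<kappa> fg(2)]) (use \<kappa>1 in blast)
  then have holG: "G holomorphic_on {w. 0 < Re w}" by (simp add: G_def o_def)
  have G_conj: "G (of_real l * w + \<i> * of_real b) = G w + c" if "0 < Re w" for w
  proof -
    have "of_real l * w + \<i> * of_real b = \<psi> (\<tau> (\<kappa> w))" using conj \<kappa>1 [OF that] by simp
    then show ?thesis using \<psi>1 g\<tau> \<kappa>1 [OF that] by (simp add: G_def)
  qed
  have GV: "G w \<in> V" if "0 < Re w" for w using fg(4) \<kappa>1 [OF that] by (simp add: G_def)
  have G_surj: "\<exists>w. 0 < Re w \<and> G w = v" if "v \<in> V" for v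
    using \<psi>1 fg(3) [OF that] by (intro exI [of _ "\<psi> (f v)"]) (simp add: G_def)
  have G_inj: "w = w'" if "0 < Re w" "0 < Re w'" "G w = G w'" for w w'
    using \<kappa>1 [OF that(1)] \<kappa>1 [OF that(2)] fg(4) that(3) unfolding G_def by metis
  show thesis
  proof (cases "l = 1")
    case True
    define P where "P = (\<lambda>s. G (- of_real (\<bar>b\<bar> / (2 * pi)) * s))"
    have b: "b \<noteq> 0" using l True by simp
    have pos: "0 < Re (- of_real (\<bar>b\<bar> / (2 * pi)) * s)" if "Re s < 0" for s
      using that b by (simp add: mult_pos_neg divide_neg_pos)
    have "(G \<circ> (\<lambda>s. - of_real (\<bar>b\<bar> / (2 * pi)) * s)) holomorphic_on {s. Re s < 0}"
      by (rule holomorphic_on_compose_gen [OF _ holG]) (use pos in \<open>auto intro!: holomorphic_intros\<close>)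
    then have holP: "P holomorphic_on {s. Re s < 0}" by (simp add: P_def o_def)
    have "P ` {s. Re s < 0} = V"
    proof
      show "P ` {s. Re s < 0} \<subseteq> V" using GV pos by (auto simp: P_def)
      show "V \<subseteq> P ` {s. Re s < 0}"
      proof
        fix v assume "v \<in> V"
        then obtain w where w: "0 < Re w" "G w = v" using G_surj by blast
        define s where "s = - of_real (2 * pi / \<bar>b\<bar>) * w"
        have "Re s < 0" using w b by (simp add: s_def mult_neg_pos)
        moreover have "- of_real (\<bar>b\<bar> / (2 * pi)) * s = w" using b by (simp add: s_def)
        then have "P s = v" using w by (simp add: P_def)
        ultimately show "v \<in> P ` {s. Re s < 0}" by blast
      qed
    qed
    moreover have "P (s + 2 * of_real pi * \<i>) = P s + (if b < 0 then c else - c)" if "Re s < 0" for s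
    proof -
      define w where "w = - of_real (\<bar>b\<bar> / (2 * pi)) * s"
      have w: "0 < Re w" using pos [OF that] by (simp add: w_def)
      have eq: "- of_real (\<bar>b\<bar> / (2 * pi)) * (s + 2 * of_real pi * \<i>) = w - \<i> * of_real \<bar>b\<bar>"
        by (simp add: w_def distrib_left)
      have "G (w - \<i> * of_real \<bar>b\<bar>) = G w + (if b < 0 then c else - c)"
      proof (cases "b < 0")
        case True
        then show ?thesis using G_conj [OF w] \<open>l = 1\<close> by simp
      next
        case False
        then show ?thesis using G_conj [of "w - \<i> * of_real b"] w \<open>l = 1\<close> by simp
      qed
      then show ?thesis unfolding P_def eq by (simp add: w_def)
    qed
    ultimately show thesis
      by (intro half_plane [of P "if b < 0 then c else - c"] holP) auto
  next
    case False
    define k where "k = ln l"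
    have k: "k \<noteq> 0" using l(1) False by (simp add: k_def)
    \<comment> \<open>The shift by \<open>\<i> * y\<close> moves the fixed point of \<open>w \<mapsto> l * w + \<i> * b\<close> to 0.\<close>
    define y where "y = b / (1 - l)"
    define m where "m = 2 * pi\<^sup>2 / \<bar>k\<bar>"
    have m: "0 < m" using k by (simp add: m_def)
    let ?S = "{s::complex. \<bar>Re s\<bar> < m / 2}"
    define e where "e = (\<lambda>s. - \<i> * of_real (k / (2 * pi)) * s)"
    define P where "P = (\<lambda>s. G (exp (e s) + \<i> * of_real y))"
    have Im_e: "\<bar>Im (e s)\<bar> < pi / 2 \<longleftrightarrow> s \<in> ?S" for s
    proof -
      have "Im (e s) = - (k / (2 * pi) * Re s)" by (simp add: e_def)
      then have "\<bar>Im (e s)\<bar> = \<bar>k\<bar> / (2 * pi) * \<bar>Re s\<bar>" by (simp add: abs_mult)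
      moreover have "pi / 2 = \<bar>k\<bar> / (2 * pi) * (m / 2)"
        using k by (simp add: m_def power2_eq_square)
      moreover have "0 < \<bar>k\<bar> / (2 * pi)" using k by simp
      ultimately show ?thesis by (simp only: mult_less_cancel_left_pos mem_Collect_eq)
    qed
    have pos: "0 < Re (exp (e s) + \<i> * of_real y)" if "s \<in> ?S" for s
    proof -
      have "\<bar>Im (e s)\<bar> < pi / 2" using that Im_e by blast
      then have "0 < cos (Im (e s))" unfolding abs_less_iff by (intro cos_gt_zero_pi) linarith+
      then show ?thesis by (simp add: Re_exp)
    qed
    have "(G \<circ> (\<lambda>s. exp (e s) + \<i> * of_real y)) holomorphic_on ?S"
      unfolding e_def by (rule holomorphic_on_compose_gen [OF _ holG])
        (use pos in \<open>auto intro!: holomorphic_intros simp: e_def\<close>)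
    then have holP: "P holomorphic_on ?S" by (simp add: P_def o_def)
    have injP: "inj_on P ?S"
    proof (rule inj_onI)
      fix s s' assume s: "s \<in> ?S" "s' \<in> ?S" "P s = P s'"
      then have "exp (e s) = exp (e s')"
        using G_inj [OF pos [OF s(1)] pos [OF s(2)]] by (simp add: P_def)
      moreover have "\<bar>Im (e s) - Im (e s')\<bar> < 2 * pi"
        using s(1,2) unfolding Im_e [symmetric] by linarith
      ultimately have "e s = e s'" using exp_complex_eqI by blast
      then show "s = s'" using k by (simp add: e_def)
    qed
    have surjP: "P ` ?S = V"
    proof
      show "P ` ?S \<subseteq> V" using GV pos by (auto simp: P_def)
      show "V \<subseteq> P ` ?S"
      proof
        fix v assume "v \<in> V"
        then obtain w where w: "0 < Re w" "G w = v" using G_surj by blast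
        define u where "u = w - \<i> * of_real y"
        have u: "0 < Re u" "u \<noteq> 0" using w by (auto simp: u_def)
        define s where "s = \<i> * of_real (2 * pi / k) * Ln u"
        have es: "e s = Ln u" using k by (simp add: s_def e_def)
        then have "s \<in> ?S" using Re_Ln_pos_lt_imp [OF u(1)] Im_e by metis
        moreover have "P s = v" unfolding P_def es using u w by (simp add: u_def)
        ultimately show "v \<in> P ` ?S" by blast
      qed
    qed
    have "P (s + 2 * of_real pi * \<i>) = P s + c" if "\<bar>Re s\<bar> < m / 2" for s
    proof -
      have "e (s + 2 * of_real pi * \<i>) = e s + of_real k" by (simp add: e_def complex_eq_iff field_simps)
      moreover have "exp k = l" using l(1) by (simp add: k_def)
      ultimately have "exp (e (s + 2 * of_real pi * \<i>)) = exp (e s) * of_real l"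
        by (simp add: exp_add exp_of_real)
      moreover have "y = l * y + b" using False by (simp add: y_def field_simps)
      then have "\<i> * of_real y = \<i> * of_real (l * y + b)" by simp
      ultimately have "exp (e (s + 2 * of_real pi * \<i>)) + \<i> * of_real y
          = exp (e s) * of_real l + \<i> * of_real (l * y + b)" by (simp only:)
      then have "exp (e (s + 2 * of_real pi * \<i>)) + \<i> * of_real y
          = of_real l * (exp (e s) + \<i> * of_real y) + \<i> * of_real b"
        by (simp add: algebra_simps)
      then show ?thesis using G_conj [OF pos, of s] that by (simp add: P_def)
    qed
    then show thesis using strip [OF m holP injP surjP] by blast
  qed
qed

text \<open>
The map exp has local holomorphic inverses.
\<close>
lemma holomorphic_descends_through_exp:
  assumes S: "open S" and hol: "Q holomorphic_on S"
    and per: "\<And>s s'. s \<in> S \<Longrightarrow> s' \<in> S \<Longrightarrow> exp s = exp s' \<Longrightarrow> Q s = Q s'"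
  obtains f where "f holomorphic_on exp ` S" "\<And>s. s \<in> S \<Longrightarrow> f (exp s) = Q s"
proof -
  define f where "f = (\<lambda>z. Q (SOME s. s \<in> S \<and> exp s = z))"
  have f: "f (exp s) = Q s" if "s \<in> S" for s
  proof -
    have "(SOME u. u \<in> S \<and> exp u = exp s) \<in> S \<and> exp (SOME u. u \<in> S \<and> exp u = exp s) = exp s"
      by (rule someI [of _ s]) (use that in simp)
    then show ?thesis unfolding f_def using per that by blast
  qed
  have "f field_differentiable at (exp s) within exp ` S" if s: "s \<in> S" for s
  proof -
    define L where "L = (\<lambda>z. s + Ln (z / exp s))"
    have "L field_differentiable at (exp s)"
      unfolding L_def by (intro field_differentiable_add field_differentiable_const)
        (auto intro!: derivative_eq_intros simp: field_differentiable_def)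
    moreover have L0: "L (exp s) = s" by (simp add: L_def)
    moreover have "Q field_differentiable at s"
      using hol S s holomorphic_on_imp_differentiable_at by blast
    ultimately have diff: "(Q \<circ> L) field_differentiable at (exp s)"
      by (intro field_differentiable_compose) auto
    have "isCont L (exp s)"
      by (simp add: \<open>L field_differentiable at (exp s)\<close> field_differentiable_imp_continuous_at)
    then obtain T where "open T" "exp s \<in> T" "\<And>z. z \<in> T \<Longrightarrow> L z \<in> S"
      using S s L0 unfolding continuous_at_open by fastforce
    then have "\<forall>\<^sub>F z in nhds (exp s). L z \<in> S"
      using eventually_nhds by blast
    moreover have "\<forall>\<^sub>F z in nhds (exp s). z \<noteq> 0"
      by (rule eventually_nhds_in_open [of "- {0}", simplified]) auto
    ultimately have "\<forall>\<^sub>F z in nhds (exp s). (Q \<circ> L) z = f z"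
    proof eventually_elim
      case (elim z)
      have "exp (L z) = z" using elim by (simp add: L_def exp_add)
      then show ?case using f [of "L z"] elim by simp
    qed
    from DERIV_cong_ev [OF refl this refl] have "f field_differentiable at (exp s)"
      using diff unfolding field_differentiable_def by blast
    then show ?thesis by (rule field_differentiable_at_within)
  qed
  then have "f holomorphic_on exp ` S" unfolding holomorphic_on_def by auto
  then show thesis using that f by blast
qed

section \<open>Uniformization of ring domains\<close>

text \<open>
On small circles f is close to v, so its image does not wind about a point different from v; and v
differs from at least one of p and q.
\<close>
lemma punctured_disc_limit_excluded:
  assumes holf: "f holomorphic_on ball 0 1 - {0}" and lim: "(f \<longlongrightarrow> v) (at 0)"
    and pq: "p \<noteq> q"
    and wn: "\<And>r. 0 < r \<Longrightarrow> r < 1 \<Longrightarrow> winding_number (f \<circ> circlepath 0 r) p \<noteq> 0"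
      "\<And>r. 0 < r \<Longrightarrow> r < 1 \<Longrightarrow> winding_number (f \<circ> circlepath 0 r) q \<noteq> 0"
  shows False
proof -
  obtain d where d: "v \<noteq> d" "\<And>r. 0 < r \<Longrightarrow> r < 1 \<Longrightarrow> winding_number (f \<circ> circlepath 0 r) d \<noteq> 0"
    using pq wn by metis
  have "\<forall>\<^sub>F z in at 0. dist (f z) v < dist v d"
    using tendstoD [OF lim] d(1) by simp
  then obtain e where e: "0 < e" "\<And>z. z \<noteq> 0 \<Longrightarrow> dist z 0 < e \<Longrightarrow> dist (f z) v < dist v d"
    unfolding eventually_at by blast
  define r where "r = min e 1 / 2"
  have r: "0 < r" "r < 1" "r < e" using e(1) by (auto simp: r_def)
  have cont: "continuous_on (sphere 0 r) f"
    using holomorphic_on_imp_continuous_on [OF holf] r by (rule_tac continuous_on_subset) auto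
  note loop = path_compose_circle [OF cont less_imp_le [OF r(1)]]
  have "winding_number (f \<circ> circlepath 0 r) d = 0"
  proof (rule winding_number_zero_outside [OF loop(1) convex_ball loop(2)])
    show "d \<notin> ball v (dist v d)" by simp
    show "path_image (f \<circ> circlepath 0 r) \<subseteq> ball v (dist v d)"
      unfolding loop(3) using e(2) r by (force simp: dist_commute)
  qed
  then show False using d(2) r by blast
qed

text \<open>
Since f omits two values, by the great Picard theorem it has a limit at 0, finite or infinite.
A finite limit is incompatible with winding about both p and p'; an infinite limit would make
the winding about p equal to the winding about a point of L, which is zero.
\<close>
lemma no_essential_map_from_punctured_disc:
  assumes ring: "ring_domain \<Omega> K L" and p: "p \<in> K" "p' \<in> K" "p' \<noteq> p" and L: "L \<noteq> {}"
    and holf: "f holomorphic_on ball 0 1 - {0}" and f: "f ` (ball 0 1 - {0}) \<subseteq> \<Omega>"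
    and wn: "\<And>r. 0 < r \<Longrightarrow> r < 1 \<Longrightarrow> winding_number (f \<circ> circlepath 0 r) p \<noteq> 0"
  shows False
proof -
  obtain c where c: "c \<in> L" using L by blast
  have loop: "path (f \<circ> circlepath 0 r)" "pathfinish (f \<circ> circlepath 0 r) = pathstart (f \<circ> circlepath 0 r)"
    "path_image (f \<circ> circlepath 0 r) = f ` sphere 0 r" "path_image (f \<circ> circlepath 0 r) \<subseteq> \<Omega>"
    if "0 < r" "r < 1" for r
  proof -
    have sub: "sphere 0 r \<subseteq> ball 0 1 - {0}" using that by auto
    then have cont: "continuous_on (sphere 0 r) f"
      using holomorphic_on_imp_continuous_on [OF holf] continuous_on_subset by blast
    show "path (f \<circ> circlepath 0 r)" "pathfinish (f \<circ> circlepath 0 r) = pathstart (f \<circ> circlepath 0 r)"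
      "path_image (f \<circ> circlepath 0 r) = f ` sphere 0 r"
      using path_compose_circle [OF cont] that by auto
    then show "path_image (f \<circ> circlepath 0 r) \<subseteq> \<Omega>" using f sub by blast
  qed
  have wn': "winding_number (f \<circ> circlepath 0 r) p' \<noteq> 0" if "0 < r" "r < 1" for r
    using wn [OF that] ring_domain_winding_inner [OF ring loop(1,2,4) [OF that] p(1,2)] by simp
  have wnc: "winding_number (f \<circ> circlepath 0 r) c = 0" if "0 < r" "r < 1" for r
    by (rule ring_domain_winding_outer [OF ring loop(1,2,4) [OF that] c])
  have no_limit: False if "(f \<longlongrightarrow> v) (at 0)" for v
    by (rule punctured_disc_limit_excluded [OF holf that p(3) wn' wn])
  have omit: "f w \<noteq> p \<and> f w \<noteq> p'" if "w \<in> ball 0 1 - {0}" for w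
  proof -
    have "f w \<in> \<Omega>" using f that by blast
    then show ?thesis using p ring unfolding ring_domain_def by blast
  qed
  define F where "F = (\<lambda>z. f z - p)"
  have no_limit_F: False if "(F \<longlongrightarrow> v) (at 0)" for v
    using no_limit [of "v + p"] tendsto_add [OF that tendsto_const [of p]] by (simp add: F_def)
  obtain v where "(F \<longlongrightarrow> v) (at 0) \<or> ((inverse \<circ> F) \<longlongrightarrow> v) (at 0)"
  proof (rule great_Picard [of "ball 0 1" 0 0 "p' - p" F])
    show "F holomorphic_on ball 0 1 - {0}" unfolding F_def by (intro holomorphic_intros holf)
    show "F w \<noteq> 0 \<and> F w \<noteq> p' - p" if "w \<in> ball 0 1 - {0}" for w
      using omit [OF that] by (simp add: F_def)
  qed (use p(3) in auto)
  then have lim: "((inverse \<circ> F) \<longlongrightarrow> v) (at 0)" using no_limit_F by blast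
  show False
  proof (cases "v = 0")
    case False
    have "((\<lambda>z. inverse ((inverse \<circ> F) z)) \<longlongrightarrow> inverse v) (at 0)"
      by (rule tendsto_inverse [OF lim False])
    then show False using no_limit_F by (simp add: o_def)
  next
    case True
    \<comment> \<open>The ball of radius B about p contains c.\<close>
    define B where "B = cmod (c - p) + 1"
    have B: "0 < B" by (simp add: B_def add_nonneg_pos)
    have "\<forall>\<^sub>F z in at 0. dist ((inverse \<circ> F) z) 0 < inverse B"
      by (rule tendstoD [OF lim [unfolded True]]) (use B in simp)
    then obtain e where e: "0 < e" "\<And>z. z \<noteq> 0 \<Longrightarrow> dist z 0 < e \<Longrightarrow> dist ((inverse \<circ> F) z) 0 < inverse B"
      unfolding eventually_at by blast
    define r where "r = min e 1 / 2"
    have r: "0 < r" "r < 1" "r < e" using e(1) by (auto simp: r_def)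
    have far: "B < cmod (f z - p)" if "z \<in> sphere 0 r" for z
    proof -
      have "f z - p \<noteq> 0" using omit [of z] that r by auto
      moreover have "inverse (cmod (f z - p)) < inverse B"
        using e(2) [of z] that r by (auto simp: norm_inverse F_def)
      ultimately show ?thesis using B inverse_less_iff_less [of "cmod (f z - p)" B] by simp
    qed
    have "winding_number (f \<circ> circlepath 0 r) p = winding_number (f \<circ> circlepath 0 r) c"
    proof (rule winding_number_eq [OF loop(1,2) [OF r(1,2)]])
      show "p \<in> cball p B" "c \<in> cball p B" using B by (auto simp: B_def dist_norm norm_minus_commute)
      show "cball p B \<inter> path_image (f \<circ> circlepath 0 r) = {}"
        unfolding loop(3) [OF r(1,2)] using far by (force simp: dist_norm norm_minus_commute)
    qed simp
    then show False using wn wnc r by simp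
  qed
qed

text \<open>
The composition of \<open>w \<mapsto> p + exp w\<close> with the coordinate P of the quotient has period \<open>2 \<pi> \<i>\<close> and
hence descends to an annulus, or to a punctured disc in the case that has just been excluded.
\<close>
theorem ring_domain_uniformization:
  assumes ring: "ring_domain \<Omega> K L" and p: "p \<in> K" "p' \<in> K" "p' \<noteq> p" and L: "L \<noteq> {}"
  obtains m f where "0 < m" "f holomorphic_on round_annulus m" "inj_on f (round_annulus m)"
    "f ` round_annulus m = \<Omega>" "winding_number (f \<circ> circlepath 0 1) p \<noteq> 0"
proof -
  obtain V and n :: int where V: "open V" "simply_connected V" "V \<noteq> {}" "V \<noteq> UNIV" and n: "0 < n"
    and im: "(\<lambda>w. p + exp w) ` V = \<Omega>"
    and shift: "\<And>w. w + 2 * of_real pi * \<i> * of_int n \<in> V \<longleftrightarrow> w \<in> V"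
    and fibre: "\<And>w w'. w \<in> V \<Longrightarrow> w' \<in> V \<Longrightarrow> exp w = exp w' \<Longrightarrow>
       \<exists>j::int. w' = w + of_int j * (2 * of_real pi * \<i> * of_int n)"
    using logarithmic_cover [OF ring p] by blast
  define c where "c = 2 * of_real pi * \<i> * (of_int n :: complex)"
  have c: "c \<noteq> 0" using n by (simp add: c_def)
  have exp_c: "exp (w + c) = exp w" "exp (w - c) = exp w" for w
    unfolding exp_eq by (rule exI [of _ n], simp add: c_def) (rule exI [of _ "- n"], simp add: c_def)
  from shift have shift': "\<And>w. w + c \<in> V \<longleftrightarrow> w \<in> V" by (simp add: c_def)
  have fibre': "\<exists>j::int. w' = w + of_int j * c" if "w \<in> V" "w' \<in> V" "exp w = exp w'" for w w'
    using fibre [OF that] by (simp add: c_def)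
  show thesis
  proof (rule translation_quotient [OF V c shift'])
    fix m :: real and P
    let ?S = "{s::complex. \<bar>Re s\<bar> < m / 2}"
    assume m: "0 < m" and P: "P holomorphic_on ?S" "inj_on P ?S" "P ` ?S = V"
      and per: "\<And>s. \<bar>Re s\<bar> < m / 2 \<Longrightarrow> P (s + 2 * of_real pi * \<i>) = P s + c"
    have per_nat: "P (s + of_nat j * (2 * of_real pi * \<i>)) = P s + of_nat j * c" if "s \<in> ?S" for s j
    proof (induction j)
      case (Suc j)
      have "P (s + of_nat (Suc j) * (2 * of_real pi * \<i>)) = P (s + of_nat j * (2 * of_real pi * \<i>) + 2 * of_real pi * \<i>)"
        by (simp add: algebra_simps)
      also have "\<dots> = P (s + of_nat j * (2 * of_real pi * \<i>)) + c"
        by (rule per) (use that in simp)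
      finally show ?case using Suc by (simp add: algebra_simps)
    qed simp
    have per_int: "P (s + of_int j * (2 * of_real pi * \<i>)) = P s + of_int j * c" if "s \<in> ?S" for s j
    proof (cases j rule: int_cases2)
      case (nonneg k)
      then show ?thesis using per_nat [OF that, of k] by simp
    next
      case (nonpos k)
      then show ?thesis
        using per_nat [of "s - of_nat k * (2 * of_real pi * \<i>)" k] that by simp
    qed
    define Q where "Q = (\<lambda>s. p + exp (P s))"
    have holQ: "Q holomorphic_on ?S" unfolding Q_def by (intro holomorphic_intros P)
    have Q_eq: "Q s = Q s' \<longleftrightarrow> exp s = exp s'" if s: "s \<in> ?S" "s' \<in> ?S" for s s'
    proof
      assume "exp s = exp s'"
      then obtain j :: int where "s' - s = 2 * of_real pi * \<i> * of_int j"
        using exp_eq_imp_diff_period [of s' s] by auto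
      then have s': "s' = s + of_int j * (2 * of_real pi * \<i>)" by (simp add: algebra_simps)
      have "P s' = P s + of_int j * c" unfolding s' by (rule per_int [OF s(1)])
      moreover have "exp (P s + of_int j * c) = exp (P s)"
        unfolding exp_eq by (intro exI [of _ "j * n"]) (simp add: c_def)
      ultimately show "Q s = Q s'" by (simp add: Q_def)
    next
      assume "Q s = Q s'"
      then have "exp (P s) = exp (P s')" by (simp add: Q_def)
      then obtain j :: int where "P s' = P s + of_int j * c" using fibre' [of "P s" "P s'"] P(3) s by blast
      then have "P s' = P (s + of_int j * (2 * of_real pi * \<i>))" using per_int [OF s(1)] by simp
      then have "s' = s + of_int j * (2 * of_real pi * \<i>)"
        using inj_onD [OF P(2)] s by auto
      then show "exp s = exp s'" unfolding exp_eq by (intro exI [of _ "- j"]) simp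
    qed
    obtain f where f: "f holomorphic_on exp ` ?S" "\<And>s. s \<in> ?S \<Longrightarrow> f (exp s) = Q s"
      using holomorphic_descends_through_exp [OF open_strip holQ] Q_eq by metis
    show thesis
    proof (rule that [OF m])
      show "f holomorphic_on round_annulus m" using f(1) by (simp add: round_annulus_eq_exp_image)
      show "inj_on f (round_annulus m)"
        unfolding round_annulus_eq_exp_image using f(2) Q_eq by (auto simp: inj_on_def)
      have "f ` exp ` ?S = Q ` ?S" using f(2) by (force simp: image_iff)
      also have "\<dots> = \<Omega>" unfolding im [symmetric] P(3) [symmetric] by (force simp: Q_def)
      finally show "f ` round_annulus m = \<Omega>" by (simp add: round_annulus_eq_exp_image)
      have "winding_number (f \<circ> circlepath 0 (exp 0)) p
          = (P (of_real 0 + 2 * of_real pi * \<i>) - P (of_real 0)) / (2 * of_real pi * \<i>)"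
      proof (rule winding_number_lift)
        show "f (exp s) = p + exp (P s)" if "Re s = 0" for s using f(2) [of s] that m by (simp add: Q_def)
        show "continuous_on {s. Re s = 0} P"
          by (rule continuous_on_subset [OF holomorphic_on_imp_continuous_on [OF P(1)]]) (use m in auto)
      qed
      then show "winding_number (f \<circ> circlepath 0 1) p \<noteq> 0"
        using per [of 0] m c by simp
    qed
  next
    fix P d
    let ?S = "{s::complex. Re s < 0}"
    assume P: "P holomorphic_on ?S" "P ` ?S = V" and d: "d = c \<or> d = - c"
      and per: "\<And>s. Re s < 0 \<Longrightarrow> P (s + 2 * of_real pi * \<i>) = P s + d"
    have exp_d: "exp (w + d) = exp w" for w using d exp_c by auto
    define Q where "Q = (\<lambda>s. p + exp (P s))"
    have holQ: "Q holomorphic_on ?S" unfolding Q_def by (intro holomorphic_intros P)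
    have per_nat: "Q (s + of_nat j * (2 * of_real pi * \<i>)) = Q s" if "s \<in> ?S" for s j
    proof (induction j)
      case (Suc j)
      have "P (s + of_nat (Suc j) * (2 * of_real pi * \<i>)) = P (s + of_nat j * (2 * of_real pi * \<i>) + 2 * of_real pi * \<i>)"
        by (simp add: algebra_simps)
      also have "\<dots> = P (s + of_nat j * (2 * of_real pi * \<i>)) + d"
        by (rule per) (use that in simp)
      finally show ?case using Suc by (simp add: Q_def exp_d)
    qed simp
    have Q_eq: "Q s = Q s'" if s: "s \<in> ?S" "s' \<in> ?S" "exp s = exp s'" for s s'
    proof -
      obtain j :: int where "s' - s = 2 * of_real pi * \<i> * of_int j"
        using exp_eq_imp_diff_period [of s' s] s(3) by auto
      then have s': "s' = s + of_int j * (2 * of_real pi * \<i>)" by (simp add: algebra_simps)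
      show ?thesis
      proof (cases j rule: int_cases2)
        case (nonneg k)
        then show ?thesis using per_nat [OF s(1), of k] s' by simp
      next
        case (nonpos k)
        then show ?thesis using per_nat [OF s(2), of k] s' by simp
      qed
    qed
    have "open ?S" by (rule open_halfspace_Re_lt)
    then obtain f where f: "f holomorphic_on exp ` ?S" "\<And>s. s \<in> ?S \<Longrightarrow> f (exp s) = Q s"
      using holomorphic_descends_through_exp [OF _ holQ Q_eq] by blast
    have disc: "exp ` ?S = ball 0 1 - {0}"
    proof
      show "ball 0 1 - {0} \<subseteq> exp ` ?S"
      proof
        fix z :: complex assume "z \<in> ball 0 1 - {0}"
        then have "z = exp (Ln z)" "Re (Ln z) < 0" by auto
        then show "z \<in> exp ` ?S" by blast
      qed
    qed auto
    have "f ` exp ` ?S \<subseteq> \<Omega>" using f(2) im P(2) by (auto simp: Q_def)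
    moreover have "winding_number (f \<circ> circlepath 0 r) p \<noteq> 0" if r: "0 < r" "r < 1" for r
    proof -
      have "winding_number (f \<circ> circlepath 0 (exp (ln r))) p
          = (P (of_real (ln r) + 2 * of_real pi * \<i>) - P (of_real (ln r))) / (2 * of_real pi * \<i>)"
      proof (rule winding_number_lift)
        show "f (exp s) = p + exp (P s)" if "Re s = ln r" for s using f(2) [of s] that r by (simp add: Q_def)
        show "continuous_on {s. Re s = ln r} P"
          by (rule continuous_on_subset [OF holomorphic_on_imp_continuous_on [OF P(1)]]) (use r in auto)
      qed
      then show ?thesis using per [of "of_real (ln r)"] r d c by auto
    qed
    ultimately show thesis
      using no_essential_map_from_punctured_disc [OF ring p L] f(1) unfolding disc by blast
  qed
qed

section \<open>The conformal modulus as a maximum over essential maps\<close>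

text \<open>
The degrees of h and k are non-zero since their composition has degree 1.
\<close>
lemma modulus_eq_of_biholomorphic:
  assumes m: "0 < m" "0 < m'"
    and hol: "h holomorphic_on round_annulus m" "k holomorphic_on round_annulus m'"
    and inv: "\<And>z. z \<in> round_annulus m \<Longrightarrow> h z \<in> round_annulus m' \<and> k (h z) = z"
      "\<And>z. z \<in> round_annulus m' \<Longrightarrow> k z \<in> round_annulus m \<and> h (k z) = z"
  shows "m = m'"
proof -
  have le: "m \<le> m'"
    if m: "0 < m" "0 < m'"
      and hol: "h holomorphic_on round_annulus m" "k holomorphic_on round_annulus m'"
      and inv: "\<And>z. z \<in> round_annulus m \<Longrightarrow> h z \<in> round_annulus m' \<and> k (h z) = z"
        "\<And>z. z \<in> round_annulus m' \<Longrightarrow> k z \<in> round_annulus m \<and> h (k z) = z"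
    for m m' h k
  proof (rule modulus_le_of_nonzero_degree [OF m hol(1)])
    show sub: "h ` round_annulus m \<subseteq> round_annulus m'" using inv(1) by blast
    have "winding_number (k \<circ> h \<circ> circlepath 0 1) 0 = winding_number (circlepath 0 1) 0"
    proof (rule winding_number_cong)
      fix t :: real assume "0 \<le> t" "t \<le> 1"
      then have "circlepath 0 1 t \<in> path_image (circlepath 0 1)" by (auto simp: path_image_def)
      then have "circlepath 0 1 t \<in> round_annulus m" using circle_in_round_annulus [OF m(1)] by blast
      then show "(k \<circ> h \<circ> circlepath 0 1) t = circlepath 0 1 t" using inv(1) by simp
    qed
    then have wn: "winding_number (k \<circ> h \<circ> circlepath 0 1) 0 \<noteq> 0"
      by (simp add: winding_number_circlepath_centre)
    show "winding_number (h \<circ> circlepath 0 1) 0 \<noteq> 0"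
      by (rule degree_nonzero_of_composite [OF m hol(1) sub hol(2) _ wn])
        (use inv(2) round_annulus_nonzero in blast)
  qed
  show ?thesis using le [OF m hol inv] le [OF m(2,1) hol(2,1) inv(2,1)] by simp
qed

text \<open>
For a ring domain with complementary parts K and L, and p in K, a map is essential if it does
not contract the core curve of the annulus.
\<close>
definition essential_map :: "real \<Rightarrow> complex set \<Rightarrow> complex \<Rightarrow> (complex \<Rightarrow> complex) \<Rightarrow> bool" where
  "essential_map m \<Omega> p f \<longleftrightarrow>
     f holomorphic_on round_annulus m \<and> f ` round_annulus m \<subseteq> \<Omega> \<and> winding_number (f \<circ> circlepath 0 1) p \<noteq> 0"

text \<open>
The maximum is attained by a uniformizing map f; composing any competitor with the inverse of f gives a
map of non-zero degree between annuli.
\<close>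
theorem conformal_modulus_extremal:
  assumes ring: "ring_domain \<Omega> K L" and p: "p \<in> K" "p' \<in> K" "p' \<noteq> p" and L: "L \<noteq> {}"
    and nd: "non_degenerate \<Omega>"
  obtains m f where "0 < m" "conformal_modulus \<Omega> = ereal m" "essential_map m \<Omega> p f"
    "\<And>m' g. 0 < m' \<Longrightarrow> essential_map m' \<Omega> p g \<Longrightarrow> m' \<le> m"
proof -
  obtain m f where m: "0 < m" and holf: "f holomorphic_on round_annulus m"
    and inj: "inj_on f (round_annulus m)" and im: "f ` round_annulus m = \<Omega>"
    and wn: "winding_number (f \<circ> circlepath 0 1) p \<noteq> 0"
    using ring_domain_uniformization [OF ring p L] by blast
  obtain g where holg: "g holomorphic_on \<Omega>" and gf: "\<And>z. z \<in> round_annulus m \<Longrightarrow> g (f z) = z"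
    using holomorphic_has_inverse [OF holf open_round_annulus inj] im by metis
  have fg: "g w \<in> round_annulus m \<and> f (g w) = w" if "w \<in> \<Omega>" for w
    using that gf unfolding im [symmetric] by auto
  have f\<Omega>: "f z \<in> \<Omega>" if "z \<in> round_annulus m" for z using im that by blast
  have "(THE x. \<exists>r R. 0 < r \<and> r < R \<and> conformally_equivalent \<Omega> (annulus r R) \<and> x = ln (R / r)) = m"
  proof (rule the_equality)
    have "conformally_equivalent \<Omega> (round_annulus m)"
      unfolding conformally_equivalent_def using holf holg gf fg f\<Omega> by blast
    moreover have "m = ln (exp (m / 2) / exp (- m / 2))" by (simp add: exp_diff [symmetric])
    ultimately show "\<exists>r R. 0 < r \<and> r < R \<and> conformally_equivalent \<Omega> (annulus r R) \<and> m = ln (R / r)"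
      unfolding round_annulus_def using m by (intro exI [of _ "exp (- m / 2)"] exI [of _ "exp (m / 2)"]) simp
  next
    fix x assume "\<exists>r R. 0 < r \<and> r < R \<and> conformally_equivalent \<Omega> (annulus r R) \<and> x = ln (R / r)"
    then obtain r R u v where r: "0 < r" "r < R" and x: "x = ln (R / r)"
      and hol: "u holomorphic_on \<Omega>" "v holomorphic_on annulus r R"
      and u: "\<And>z. z \<in> \<Omega> \<Longrightarrow> u z \<in> annulus r R \<and> v (u z) = z"
      and v: "\<And>w. w \<in> annulus r R \<Longrightarrow> v w \<in> \<Omega> \<and> u (v w) = w"
      unfolding conformally_equivalent_def by blast
    \<comment> \<open>The geometric mean of r and R scales the annulus to a normalised one of modulus x.\<close>
    define t where "t = exp ((ln r + ln R) / 2)"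
    have x': "x = ln R - ln r" using r x by (simp add: ln_div)
    have "0 < x" using r x' by simp
    have t: "t > 0" by (simp add: t_def)
    have tr: "t * exp (- x / 2) = r"
    proof -
      have "t * exp (- x / 2) = exp (ln r)"
        unfolding t_def x' exp_add [symmetric] by (rule arg_cong [of _ _ exp]) (simp add: field_simps)
      then show ?thesis using r by simp
    qed
    have tR: "t * exp (x / 2) = R"
    proof -
      have "t * exp (x / 2) = exp (ln R)"
        unfolding t_def x' exp_add [symmetric] by (rule arg_cong [of _ _ exp]) (simp add: field_simps)
      then show ?thesis using r by simp
    qed
    have scale: "of_real t * z \<in> annulus r R \<longleftrightarrow> z \<in> round_annulus x" for z
      using t unfolding annulus_def mem_round_annulus tr [symmetric] tR [symmetric]
      by (simp add: norm_mult)
    define h where "h = g \<circ> (v \<circ> (\<lambda>z. of_real t * z))"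
    define k where "k = (\<lambda>w. w / of_real t) \<circ> (u \<circ> f)"
    have "v \<circ> (\<lambda>z. of_real t * z) holomorphic_on round_annulus x"
      by (rule holomorphic_on_compose_gen [OF _ hol(2)]) (auto intro!: holomorphic_intros simp: scale)
    then have holh: "h holomorphic_on round_annulus x"
      unfolding h_def by (rule holomorphic_on_compose_gen [OF _ holg]) (use v scale in auto)
    have "u \<circ> f holomorphic_on round_annulus m"
      by (rule holomorphic_on_compose_gen [OF holf hol(1)]) (use im in auto)
    then have holk: "k holomorphic_on round_annulus m"
      unfolding k_def by (rule holomorphic_on_compose_gen [where t = UNIV]) (use t in \<open>auto intro!: holomorphic_intros\<close>)
    have "x = m"
    proof (rule modulus_eq_of_biholomorphic [OF \<open>0 < x\<close> m holh holk])
      fix z assume "z \<in> round_annulus x"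
      then have "v (of_real t * z) \<in> \<Omega> \<and> u (v (of_real t * z)) = of_real t * z" using v scale by blast
      then show "h z \<in> round_annulus m \<and> k (h z) = z" using fg t by (simp add: h_def k_def)
    next
      fix z assume z: "z \<in> round_annulus m"
      then have uf: "u (f z) \<in> annulus r R \<and> v (u (f z)) = f z" using u f\<Omega> by blast
      have "of_real t * (u (f z) / of_real t) = u (f z)" using t by simp
      then show "k z \<in> round_annulus x \<and> h (k z) = z"
        using uf scale [of "u (f z) / of_real t"] gf [OF z] by (simp add: h_def k_def)
    qed
    then show "x = m" .
  qed
  then have "conformal_modulus \<Omega> = ereal m" using nd by (simp add: conformal_modulus_def)
  moreover have "essential_map m \<Omega> p f" using holf im wn by (simp add: essential_map_def)
  moreover have "m' \<le> m" if m': "0 < m'" and e: "essential_map m' \<Omega> p e" for m' e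
  proof (rule modulus_le_of_nonzero_degree [OF m' m])
    have hole: "e holomorphic_on round_annulus m'" and e\<Omega>: "e ` round_annulus m' \<subseteq> \<Omega>"
      and wne: "winding_number (e \<circ> circlepath 0 1) p \<noteq> 0"
      using e by (auto simp: essential_map_def)
    show holh: "g \<circ> e holomorphic_on round_annulus m'"
      by (rule holomorphic_on_compose_gen [OF hole holg e\<Omega>])
    show sub: "(g \<circ> e) ` round_annulus m' \<subseteq> round_annulus m" using fg e\<Omega> by auto
    have omit: "f z \<noteq> p" if "z \<in> round_annulus m" for z
      using f\<Omega> [OF that] p(1) ring unfolding ring_domain_def by blast
    have "winding_number (f \<circ> (g \<circ> e) \<circ> circlepath 0 1) p = winding_number (e \<circ> circlepath 0 1) p"
    proof (rule winding_number_cong)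
      fix t :: real assume "0 \<le> t" "t \<le> 1"
      then have "circlepath 0 1 t \<in> path_image (circlepath 0 1)" by (auto simp: path_image_def)
      then have "circlepath 0 1 t \<in> round_annulus m'" using circle_in_round_annulus [OF m'] by blast
      then show "(f \<circ> (g \<circ> e) \<circ> circlepath 0 1) t = (e \<circ> circlepath 0 1) t" using fg e\<Omega> by auto
    qed
    then show "winding_number (g \<circ> e \<circ> circlepath 0 1) 0 \<noteq> 0"
      using degree_nonzero_of_composite [OF m' m holh sub holf omit] wne by simp
  qed
  ultimately show thesis using that m by blast
qed

lemma conformally_equivalent_similarity:
  assumes "s \<noteq> 0" and ce: "conformally_equivalent \<Omega> X"
  shows "conformally_equivalent ((\<lambda>w. s * w + c) ` \<Omega>) X"
proof -
  obtain f g where fg: "f holomorphic_on \<Omega>" "g holomorphic_on X"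
    "\<And>z. z \<in> \<Omega> \<Longrightarrow> f z \<in> X \<and> g (f z) = z" "\<And>w. w \<in> X \<Longrightarrow> g w \<in> \<Omega> \<and> f (g w) = w"
    using ce unfolding conformally_equivalent_def by blast
  have "f \<circ> (\<lambda>w. (w - c) / s) holomorphic_on (\<lambda>w. s * w + c) ` \<Omega>"
    by (rule holomorphic_on_compose_gen [OF _ fg(1)]) (use assms(1) in \<open>auto intro!: holomorphic_intros\<close>)
  moreover have "(\<lambda>w. s * g w + c) holomorphic_on X" by (intro holomorphic_intros fg)
  ultimately show ?thesis
    unfolding conformally_equivalent_def using fg(3,4) assms(1)
    by (intro exI [of _ "f \<circ> (\<lambda>w. (w - c) / s)"] exI [of _ "\<lambda>w. s * g w + c"]) auto
qed

lemma conformal_modulus_similarity: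
  assumes s: "s \<noteq> 0"
  shows "conformal_modulus ((\<lambda>w. s * w + c) ` \<Omega>) = conformal_modulus \<Omega>"
proof -
  have "homeomorphism UNIV UNIV (\<lambda>w. s * w + c) (\<lambda>w. (w - c) / s)"
    by (rule homeomorphismI) (use s in \<open>auto intro!: continuous_intros\<close>)
  then have "non_degenerate ((\<lambda>w. s * w + c) ` \<Omega>) \<longleftrightarrow> non_degenerate \<Omega>"
    by (rule non_degenerate_homeomorphic_image)
  moreover have "conformally_equivalent ((\<lambda>w. s * w + c) ` \<Omega>) X \<longleftrightarrow> conformally_equivalent \<Omega> X" for X
  proof
    assume "conformally_equivalent ((\<lambda>w. s * w + c) ` \<Omega>) X"
    then have "conformally_equivalent ((\<lambda>w. inverse s * w + - c / s) ` (\<lambda>w. s * w + c) ` \<Omega>) X"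
      by (rule conformally_equivalent_similarity [rotated]) (use s in simp)
    moreover have "(\<lambda>w. inverse s * w + - c / s) ` (\<lambda>w. s * w + c) ` \<Omega> = \<Omega>"
      unfolding image_image using s by (simp add: field_simps)
    ultimately show "conformally_equivalent \<Omega> X" by simp
  qed (rule conformally_equivalent_similarity [OF s])
  ultimately show ?thesis unfolding conformal_modulus_def by simp
qed

section \<open>Compactness of essential maps\<close>

text \<open>
For large n the curve of f n, shifted by q n, stays closer to the curve of g, shifted by a, than
that curve comes to 0.
\<close>
lemma winding_number_uniform_limit:
  assumes lim: "uniform_limit (sphere 0 1) f g sequentially" and q: "q \<longlonglongrightarrow> a"
    and contf: "\<And>n. continuous_on (sphere 0 1) (f n)" and contg: "continuous_on (sphere 0 1) g"
    and a: "a \<notin> g ` sphere 0 1"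
  shows "\<forall>\<^sub>F n in sequentially.
           winding_number (f n \<circ> circlepath 0 1) (q n) = winding_number (g \<circ> circlepath 0 1) a"
proof -
  have "closed (g ` sphere 0 1)"
    by (intro compact_imp_closed compact_continuous_image contg) auto
  then obtain e where e: "0 < e" "\<And>x. x \<in> sphere 0 1 \<Longrightarrow> e \<le> dist a (g x)"
    using separate_point_closed a by (metis imageI)
  have "\<forall>\<^sub>F n in sequentially. \<forall>x\<in>sphere 0 1. dist (f n x) (g x) < e / 2"
    by (rule uniform_limitD [OF lim]) (use e in simp)
  moreover have "\<forall>\<^sub>F n in sequentially. dist (q n) a < e / 2"
    by (rule tendstoD [OF q]) (use e in simp)
  ultimately show ?thesis
  proof eventually_elim
    case (elim n)
    have paths: "path (\<lambda>t. (f n \<circ> circlepath 0 1) t - q n)" "path (\<lambda>t. (g \<circ> circlepath 0 1) t - a)"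
      using path_compose_circle(1) [OF contf] path_compose_circle(1) [OF contg]
      unfolding path_def by (auto intro!: continuous_intros)
    show ?case
      unfolding winding_number_offset [of "f n \<circ> circlepath 0 1"] winding_number_offset [of "g \<circ> circlepath 0 1"]
    proof (rule winding_number_nearby_loops_eq [OF paths(2) paths(1)])
      fix t :: real assume "t \<in> {0..1}"
      then have x: "circlepath 0 1 t \<in> sphere 0 (1::real)"
        by (metis imageI path_image_circlepath path_image_def abs_one)
      have "cmod ((f n (circlepath 0 1 t) - q n) - (g (circlepath 0 1 t) - a))
          \<le> dist (f n (circlepath 0 1 t)) (g (circlepath 0 1 t)) + dist (q n) a"
        using norm_triangle_ineq4 [of "f n (circlepath 0 1 t) - g (circlepath 0 1 t)" "q n - a"]
        by (simp add: dist_norm algebra_simps)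
      also have "\<dots> < e / 2 + e / 2"
        using elim(1) x elim(2) by (intro add_strict_mono) blast+
      also have "\<dots> = e" by simp
      also have "e \<le> cmod (g (circlepath 0 1 t) - a)"
        using e(2) [OF x] by (simp add: dist_norm norm_minus_commute)
      finally show "cmod (((f n \<circ> circlepath 0 1) t - q n) - ((g \<circ> circlepath 0 1) t - a))
          < cmod ((g \<circ> circlepath 0 1) t - a - 0)" by simp
    qed (simp_all add: pathstart_def pathfinish_def circlepath)
  qed
qed

lemma winding_number_const_on_circle:
  assumes "\<And>z. z \<in> sphere 0 1 \<Longrightarrow> g z = k" "k \<noteq> a"
  shows "winding_number (g \<circ> circlepath 0 1) a = 0"
proof -
  have "winding_number (g \<circ> circlepath 0 1) a = winding_number (\<lambda>t. k) a"
  proof (rule winding_number_cong)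
    fix t :: real assume "0 \<le> t" "t \<le> 1"
    then have "circlepath 0 1 t \<in> sphere 0 (1::real)"
      by (simp add: circlepath norm_mult)
    then show "(g \<circ> circlepath 0 1) t = k" using assms by simp
  qed
  then show ?thesis using assms winding_number_zero_const by metis
qed

text \<open>
By the theorem of Schottky a bound at one point spreads to a bound on each compact set.
\<close>
lemma Montel_omitting_two_values_at_point:
  fixes G :: "nat \<Rightarrow> complex \<Rightarrow> complex"
  assumes S: "open S" "connected S" "w \<in> S"
    and hol: "\<And>n. G n holomorphic_on S"
    and omit: "\<And>n z. z \<in> S \<Longrightarrow> G n z \<noteq> 0 \<and> G n z \<noteq> 1"
    and w: "\<And>n. cmod (G n w) \<le> 1"
  obtains g r where "g holomorphic_on S" "strict_mono (r :: nat \<Rightarrow> nat)"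
    "\<And>K. compact K \<Longrightarrow> K \<subseteq> S \<Longrightarrow> uniform_limit K (G \<circ> r) g sequentially"
proof -
  have "\<exists>B. \<forall>h\<in>range G. \<forall>z\<in>K. cmod (h z) \<le> B" if K: "compact K" "K \<subseteq> S" for K
  proof -
    obtain B where "\<And>h z. \<lbrakk>h \<in> range G; z \<in> K\<rbrakk> \<Longrightarrow> cmod (h z) \<le> B"
      by (rule GPicard3 [OF S subset_refl _ _ _ K, of "range G"]) (use hol omit w in auto)
    then show ?thesis by blast
  qed
  then obtain g r where "g holomorphic_on S" "strict_mono (r :: nat \<Rightarrow> nat)"
    "\<And>K. compact K \<Longrightarrow> K \<subseteq> S \<Longrightarrow> uniform_limit K (G \<circ> r) g sequentially"
    by (rule Montel [OF S(1) _ _ subset_refl, rotated]) (use hol in auto)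
  then show thesis by (rule that)
qed

text \<open>
If infinitely many G n are bounded by 1 at w, these contain a convergent subsequence. Otherwise
the reciprocals, which omit the same two values, contain one; by the theorem of Hurwitz its limit either
has no zero, so that the subsequence of the G n converges as well, or vanishes identically.
\<close>
lemma Montel_omitting_two_values:
  fixes G :: "nat \<Rightarrow> complex \<Rightarrow> complex"
  assumes S: "open S" "connected S" "w \<in> S"
    and hol: "\<And>n. G n holomorphic_on S"
    and omit: "\<And>n z. z \<in> S \<Longrightarrow> G n z \<noteq> 0 \<and> G n z \<noteq> 1"
  obtains (finite) g r where "g holomorphic_on S" "strict_mono (r :: nat \<Rightarrow> nat)"
      "\<And>K. compact K \<Longrightarrow> K \<subseteq> S \<Longrightarrow> uniform_limit K (G \<circ> r) g sequentially"
    | (infinite) r where "strict_mono (r :: nat \<Rightarrow> nat)"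
      "\<And>K. compact K \<Longrightarrow> K \<subseteq> S \<Longrightarrow> uniform_limit K (\<lambda>n z. inverse (G (r n) z)) (\<lambda>_. 0) sequentially"
proof (cases "infinite {n. cmod (G n w) \<le> 1}")
  case True
  then obtain r1 :: "nat \<Rightarrow> nat" where r1: "strict_mono r1" "\<And>n. cmod (G (r1 n) w) \<le> 1"
    using infinite_enumerate by (metis mem_Collect_eq)
  obtain g r2 where g: "g holomorphic_on S" and r2: "strict_mono (r2 :: nat \<Rightarrow> nat)"
    and lim: "\<And>K. compact K \<Longrightarrow> K \<subseteq> S \<Longrightarrow> uniform_limit K ((\<lambda>n. G (r1 n)) \<circ> r2) g sequentially"
    by (rule Montel_omitting_two_values_at_point [OF S, of "\<lambda>n. G (r1 n)"]) (use hol omit r1 in auto)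
  then show thesis
    using finite [OF g strict_mono_o [OF r1(1) r2]] by (simp add: o_def)
next
  case False
  then have "infinite (- {n. cmod (G n w) \<le> 1})"
    by (metis finite_compl infinite_UNIV_nat)
  then obtain r1 :: "nat \<Rightarrow> nat" where r1: "strict_mono r1" "\<And>n. \<not> cmod (G (r1 n) w) \<le> 1"
    using infinite_enumerate by (metis ComplD mem_Collect_eq)
  define H where "H = (\<lambda>n z. inverse (G (r1 n) z))"
  have holH: "H n holomorphic_on S" for n
    unfolding H_def by (intro holomorphic_intros hol) (use omit in auto)
  have omitH: "H n z \<noteq> 0 \<and> H n z \<noteq> 1" if "z \<in> S" for n z
    using omit [OF that] by (auto simp: H_def)
  have Hw: "cmod (H n w) \<le> 1" for n
    using r1(2) [of n] by (simp add: H_def norm_inverse inverse_le_1_iff)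
  obtain h r2 where h: "h holomorphic_on S" and r2: "strict_mono (r2 :: nat \<Rightarrow> nat)"
    and lim: "\<And>K. compact K \<Longrightarrow> K \<subseteq> S \<Longrightarrow> uniform_limit K (H \<circ> r2) h sequentially"
    by (rule Montel_omitting_two_values_at_point [where G = H, OF S holH omitH Hw]) auto
  have r: "strict_mono (r1 \<circ> r2)" by (rule strict_mono_o [OF r1(1) r2])
  show thesis
  proof (cases "\<exists>z\<in>S. h z = 0")
    case True
    then obtain z0 where z0: "z0 \<in> S" "h z0 = 0" by blast
    have "h constant_on S"
      using Hurwitz_no_zeros [OF S(1,2) _ h lim _ _ z0(1)] holH omitH z0 by (auto simp: o_def)
    then have "\<forall>z\<in>S. h z = 0" using z0 unfolding constant_on_def by metis
    moreover have "uniform_limit K (H \<circ> r2) (\<lambda>_. 0) sequentially"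
      if "compact K" "K \<subseteq> S" for K
      using lim [OF that] that(2) calculation
      by (subst (asm) uniform_limit_cong' [where g = "H \<circ> r2" and i = "\<lambda>_. 0"]) auto
    ultimately show thesis
      using infinite [OF r] by (simp add: H_def o_def)
  next
    case False
    have "uniform_limit K (G \<circ> (r1 \<circ> r2)) (inverse \<circ> h) sequentially" if K: "compact K" "K \<subseteq> S" for K
    proof -
      have hK: "compact (h ` K)"
        using K h holomorphic_on_imp_continuous_on continuous_on_subset compact_continuous_image by blast
      have "0 \<notin> h ` K" using False K by auto
      then obtain b where b: "0 < b" "\<forall>y\<in>h ` K. b \<le> dist 0 y"
        using separate_point_closed [OF compact_imp_closed [OF hK], of 0] by auto
      then have "b \<le> cmod (h x)" if "x \<in> K" for x using that by auto
      then have "uniform_limit K (\<lambda>n z. inverse ((H \<circ> r2) n z)) (inverse \<circ> h) sequentially"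
        using uniform_lim_inverse [OF lim [OF K]] b(1) by blast
      then show ?thesis by (simp add: H_def o_def)
    qed
    moreover have "(inverse \<circ> h) holomorphic_on S"
      unfolding o_def by (intro holomorphic_intros h) (use False in auto)
    ultimately show thesis using finite [OF _ r] by blast
  qed
qed

lemma uniform_limit_of_tendsto: "(q \<longlongrightarrow> a) F \<Longrightarrow> uniform_limit K (\<lambda>n z. q n) (\<lambda>z. a) F"
  by (rule uniform_limitI) (auto dest!: tendstoD elim: eventually_mono)

text \<open>
The affine normalisation sending p n to 0 and p' n to 1 gives functions that omit 0 and 1. A limit
\<open>\<infinity>\<close> is impossible because the curves would then run outside a large disc containing p n and l n
and wind equally often about both. A constant limit differs from a or from b, and the curves would not wind
about p n or p' n for large n.
\<close>
theorem essential_maps_compactness: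
  fixes f :: "nat \<Rightarrow> complex \<Rightarrow> complex"
  assumes m: "0 < m"
    and hol: "\<And>n. f n holomorphic_on round_annulus m"
    and omit: "\<And>n z. z \<in> round_annulus m \<Longrightarrow> f n z \<noteq> p n \<and> f n z \<noteq> p' n"
    and lims: "p \<longlonglongrightarrow> a" "p' \<longlonglongrightarrow> b" "l \<longlonglongrightarrow> c"
    and ne: "a \<noteq> b" "\<And>n. p n \<noteq> p' n"
    and wn: "\<And>n. winding_number (f n \<circ> circlepath 0 1) (p n) \<noteq> 0"
      "\<And>n. winding_number (f n \<circ> circlepath 0 1) (p' n) \<noteq> 0"
      "\<And>n. winding_number (f n \<circ> circlepath 0 1) (l n) = 0"
  obtains g r where "g holomorphic_on round_annulus m" "strict_mono (r :: nat \<Rightarrow> nat)"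
    "\<not> g constant_on round_annulus m"
    "\<And>K. compact K \<Longrightarrow> K \<subseteq> round_annulus m \<Longrightarrow> uniform_limit K (\<lambda>n. f (r n)) g sequentially"
proof -
  let ?A = "round_annulus m"
  have sphere: "sphere 0 1 \<subseteq> ?A" using circle_in_round_annulus [OF m] by simp
  define G where "G = (\<lambda>n z. (f n z - p n) / (p' n - p n))"
  have holG: "G n holomorphic_on ?A" for n
    unfolding G_def by (intro holomorphic_intros hol) (use ne(2) [of n] in simp)
  have omitG: "G n z \<noteq> 0 \<and> G n z \<noteq> 1" if "z \<in> ?A" for n z
    using omit [OF that, of n] ne(2) [of n] by (auto simp: G_def)
  have fG: "f n z = p n + (p' n - p n) * G n z" for n z
    using ne(2) [of n] by (simp add: G_def)
  have "1 \<in> ?A" using sphere by auto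
  show thesis
  proof (rule Montel_omitting_two_values [OF open_round_annulus connected_round_annulus \<open>1 \<in> ?A\<close> holG omitG])
    fix g r
    assume g: "g holomorphic_on ?A" and r: "strict_mono (r :: nat \<Rightarrow> nat)"
      and lim: "\<And>K. compact K \<Longrightarrow> K \<subseteq> ?A \<Longrightarrow> uniform_limit K (G \<circ> r) g sequentially"
    define k where "k = (\<lambda>z. a + (b - a) * g z)"
    have holk: "k holomorphic_on ?A" unfolding k_def by (intro holomorphic_intros g)
    have lims_r: "(\<lambda>n. p (r n)) \<longlonglongrightarrow> a" "(\<lambda>n. p' (r n)) \<longlonglongrightarrow> b"
      using LIMSEQ_subseq_LIMSEQ [OF _ r] lims by (auto simp: o_def)
    have limf: "uniform_limit K (\<lambda>n. f (r n)) k sequentially" if K: "compact K" "K \<subseteq> ?A" for K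
    proof -
      have bdd: "bounded (g ` K)"
        using K g holomorphic_on_imp_continuous_on continuous_on_subset compact_continuous_image
          compact_imp_bounded by blast
      have c1: "uniform_limit K (\<lambda>n z. p (r n)) (\<lambda>z. a) sequentially"
        and c2: "uniform_limit K (\<lambda>n z. p' (r n) - p (r n)) (\<lambda>z. b - a) sequentially"
        using lims_r by (auto intro!: uniform_limit_of_tendsto tendsto_diff)
      have "uniform_limit K (\<lambda>n z. p (r n) + (p' (r n) - p (r n)) * (G \<circ> r) n z) (\<lambda>z. a + (b - a) * g z) sequentially"
        by (intro uniform_limit_add c1 uniform_lim_mult c2 lim K bdd) (auto intro: bounded_subset [of "{b - a}"])
      moreover have "(\<lambda>n. f (r n)) = (\<lambda>n z. p (r n) + (p' (r n) - p (r n)) * (G \<circ> r) n z)"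
        using fG by (auto simp: fun_eq_iff)
      ultimately show ?thesis by (simp only: k_def)
    qed
    have "\<not> k constant_on ?A"
    proof
      assume "k constant_on ?A"
      then obtain v where v: "\<And>z. z \<in> ?A \<Longrightarrow> k z = v" unfolding constant_on_def by blast
      have cf: "continuous_on (sphere 0 1) (f n)" for n
        using hol sphere holomorphic_on_imp_continuous_on continuous_on_subset by blast
      have ck: "continuous_on (sphere 0 1) k"
        using holk sphere holomorphic_on_imp_continuous_on continuous_on_subset by blast
      have ls: "uniform_limit (sphere 0 1) (\<lambda>n. f (r n)) k sequentially"
        by (rule limf) (use sphere in auto)
      have absurd: False if "q \<longlonglongrightarrow> d" "v \<noteq> d"
        "\<And>n. winding_number (f (r n) \<circ> circlepath 0 1) (q n) \<noteq> 0" for q d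
      proof -
        have "d \<notin> k ` sphere 0 1" using v sphere that by auto
        then have "\<forall>\<^sub>F n in sequentially. winding_number (f (r n) \<circ> circlepath 0 1) (q n)
              = winding_number (k \<circ> circlepath 0 1) d"
          using winding_number_uniform_limit [OF ls that(1) cf ck] by simp
        moreover have "winding_number (k \<circ> circlepath 0 1) d = 0"
          by (rule winding_number_const_on_circle [of k v]) (use v sphere that in auto)
        ultimately show False using that(3) by simp
      qed
      show False
        using absurd [OF lims_r(1)] absurd [OF lims_r(2)] wn ne(1) by metis
    qed
    then show thesis using that [OF holk r _ limf] by blast
  next
    fix r
    assume r: "strict_mono (r :: nat \<Rightarrow> nat)"
      and lim: "\<And>K. compact K \<Longrightarrow> K \<subseteq> ?A \<Longrightarrow>
        uniform_limit K (\<lambda>n z. inverse (G (r n) z)) (\<lambda>_. 0) sequentially"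
    have "(\<lambda>n. l n - p n) \<longlonglongrightarrow> c - a" by (intro tendsto_diff lims)
    then have "Bseq (\<lambda>n. l n - p n)" by (intro convergent_imp_Bseq convergentI)
    then obtain B where B: "0 < B" "\<And>n. cmod (l n - p n) \<le> B" by (rule BseqE) blast
    \<comment> \<open>Eventually p n and p' n are at least \<delta> apart, and B bounds the distance of p n and l n. Where the
    normalised function exceeds \<open>B / \<delta>\<close>, the function f n is farther than B from p n.\<close>
    define \<delta> where "\<delta> = cmod (b - a) / 2"
    have \<delta>: "0 < \<delta>" using ne by (simp add: \<delta>_def)
    have "(\<lambda>n. cmod (p' (r n) - p (r n))) \<longlonglongrightarrow> cmod (b - a)"
      using LIMSEQ_subseq_LIMSEQ [OF _ r] lims by (auto simp: o_def intro!: tendsto_intros)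
    then have "\<forall>\<^sub>F n in sequentially. \<delta> < cmod (p' (r n) - p (r n))"
      by (rule order_tendstoD) (use ne in \<open>simp add: \<delta>_def\<close>)
    moreover have "\<forall>\<^sub>F n in sequentially. \<forall>z\<in>sphere 0 1. dist (inverse (G (r n) z)) 0 < \<delta> / B"
      by (rule uniform_limitD [OF lim]) (use sphere \<delta> B in auto)
    ultimately have "\<forall>\<^sub>F n in sequentially. False"
    proof eventually_elim
      case (elim n)
      let ?\<gamma> = "f (r n) \<circ> circlepath 0 1"
      have far: "B < cmod (f (r n) z - p (r n))" if "z \<in> sphere 0 1" for z
      proof -
        have Gnz: "G (r n) z \<noteq> 0" using omitG that sphere by blast
        have "inverse (cmod (G (r n) z)) < \<delta> / B" using elim that by (simp add: norm_inverse)
        then have "B < \<delta> * cmod (G (r n) z)" using Gnz B \<delta> by (simp add: field_simps)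
        also have "\<dots> \<le> cmod (p' (r n) - p (r n)) * cmod (G (r n) z)"
          using elim by (intro mult_right_mono) auto
        also have "\<dots> = cmod (f (r n) z - p (r n))" by (simp add: fG norm_mult)
        finally show ?thesis .
      qed
      have "winding_number ?\<gamma> (p (r n)) = winding_number ?\<gamma> (l (r n))"
      proof (rule winding_number_eq)
        show "path ?\<gamma>" "pathfinish ?\<gamma> = pathstart ?\<gamma>" using loop_through_annulus [OF hol m] by auto
        show "connected (cball (p (r n)) B)" by simp
        show "cball (p (r n)) B \<inter> path_image ?\<gamma> = {}"
          unfolding loop_through_annulus(3) [OF hol m] using far by (force simp: dist_norm norm_minus_commute)
        show "p (r n) \<in> cball (p (r n)) B" "l (r n) \<in> cball (p (r n)) B"
          using B(1) B(2) [of "r n"] by (auto simp: dist_norm norm_minus_commute)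
      qed
      then show False using wn(1,3) by metis
    qed
    then show thesis by simp
  qed
qed

section \<open>Real-linear maps of the plane\<close>

abbreviation real_linear :: "complex \<Rightarrow> complex \<Rightarrow> complex \<Rightarrow> complex" where
  "real_linear a b z \<equiv> a * z + b * cnj z"

text \<open>
The determinant of the real-linear map is \<open>\<bar>a\<bar>\<^sup>2 - \<bar>b\<bar>\<^sup>2\<close>.
\<close>
lemma real_linear_homeomorphism:
  assumes "cmod a \<noteq> cmod b"
  obtains \<psi> where "homeomorphism UNIV UNIV (real_linear a b) \<psi>"
proof -
  define d where "d = complex_of_real ((cmod a)\<^sup>2 - (cmod b)\<^sup>2)"
  have "(cmod a)\<^sup>2 \<noteq> (cmod b)\<^sup>2" using assms by simp
  then have d: "d \<noteq> 0" by (simp only: d_def of_real_eq_0_iff right_minus_eq not_False_eq_True)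
  have d_eq: "d = a * cnj a - b * cnj b"
    unfolding d_def by (simp add: complex_norm_square del: of_real_power flip: of_real_power)
  have cnj_d: "cnj d = d" by (simp add: d_def)
  define \<psi> where "\<psi> = (\<lambda>w. (cnj a * w - b * cnj w) / d)"
  have "homeomorphism UNIV UNIV (real_linear a b) \<psi>"
  proof (rule homeomorphismI)
    show "continuous_on UNIV (real_linear a b)" "continuous_on UNIV \<psi>"
      unfolding \<psi>_def using d by (auto intro!: continuous_intros)
    show "\<psi> (real_linear a b z) = z" for z
    proof -
      have "cnj a * real_linear a b z - b * cnj (real_linear a b z) = d * z"
        by (simp add: d_eq algebra_simps)
      then show ?thesis using d by (simp add: \<psi>_def)
    qed
    show "real_linear a b (\<psi> w) = w" for w
    proof -
      have "real_linear a b (\<psi> w) = (a * (cnj a * w - b * cnj w) + b * (a * cnj w - cnj b * w)) / d"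
        using cnj_d by (simp add: \<psi>_def add_divide_distrib)
      also have "a * (cnj a * w - b * cnj w) + b * (a * cnj w - cnj b * w) = d * w"
        by (simp add: d_eq algebra_simps)
      finally show ?thesis using d by simp
    qed
  qed auto
  then show thesis by (rule that)
qed

text \<open>
The modulus is invariant under complex affine maps, so the translation part can be dropped and the
coefficients can be divided by their Euclidean norm. This makes the set of coefficients relatively compact.
\<close>
lemma conformal_modulus_affine_normalised:
  assumes "affine_transformation \<phi>"
  obtains a b where "(cmod a)\<^sup>2 + (cmod b)\<^sup>2 = 1" "cmod a \<noteq> cmod b"
    "\<And>\<Omega>. conformal_modulus (\<phi> ` \<Omega>) = conformal_modulus (real_linear a b ` \<Omega>)"
proof -
  obtain a b c where abc: "(cmod a)\<^sup>2 - (cmod b)\<^sup>2 \<noteq> 0" and \<phi>: "\<phi> = (\<lambda>z. a * z + b * cnj z + c)"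
    using assms by (auto simp: affine_transformation_def)
  define s where "s = sqrt ((cmod a)\<^sup>2 + (cmod b)\<^sup>2)"
  have "0 < (cmod a)\<^sup>2 + (cmod b)\<^sup>2"
    using abc by (metis add_nonneg_eq_0_iff diff_self less_le sum_power2_ge_zero zero_le_power2)
  then have s: "0 < s" "s\<^sup>2 = (cmod a)\<^sup>2 + (cmod b)\<^sup>2" by (auto simp: s_def)
  show thesis
  proof (rule that [of "a / of_real s" "b / of_real s"])
    have "(cmod (a / of_real s))\<^sup>2 + (cmod (b / of_real s))\<^sup>2 = ((cmod a)\<^sup>2 + (cmod b)\<^sup>2) / s\<^sup>2"
      by (simp add: norm_divide power_divide add_divide_distrib)
    also have "\<dots> = 1" unfolding s(2) [symmetric] using s(1) by simp
    finally show "(cmod (a / of_real s))\<^sup>2 + (cmod (b / of_real s))\<^sup>2 = 1" .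
    show "cmod (a / of_real s) \<noteq> cmod (b / of_real s)"
      using abc s by (auto simp: norm_divide)
    show "conformal_modulus (\<phi> ` \<Omega>) = conformal_modulus (real_linear (a / of_real s) (b / of_real s) ` \<Omega>)" for \<Omega>
    proof -
      have "\<phi> ` \<Omega> = (\<lambda>w. of_real s * w + c) ` real_linear (a / of_real s) (b / of_real s) ` \<Omega>"
        unfolding image_image by (rule image_cong [OF refl]) (use s in \<open>simp add: \<phi> distrib_left\<close>)
      then show ?thesis using conformal_modulus_similarity s by simp
    qed
  qed
qed

lemma affine_transformation_real_linear:
  assumes "cmod a \<noteq> cmod b"
  shows "affine_transformation (real_linear a b)"
  unfolding affine_transformation_def
  using assms by (intro exI [of _ a] exI [of _ b] exI [of _ 0]) simp

text \<open>
If a and b have equal modulus and arguments A and B, then with \<open>\<theta> = (B - A) / 2\<close> one has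
\<open>a * z + b * cnj z = 2 * \<bar>a\<bar> * exp (\<i> * (A + B) / 2) * Re (exp (- \<i> * \<theta>) * z)\<close>. An angle outside
\<open>[0, pi)\<close> is shifted by pi, which only changes the sign.
\<close>
lemma degenerate_real_linear_is_projection:
  assumes "cmod a = cmod b" "a \<noteq> 0"
  obtains \<theta> u where "\<theta> \<in> {0..<pi}" "u \<noteq> 0" "\<And>z. real_linear a b z = u * of_real (proj_dir \<theta> z)"
proof -
  define \<theta>0 where "\<theta>0 = (Arg b - Arg a) / 2"
  define v where "v = 2 * of_real (cmod a) * exp (\<i> * of_real ((Arg a + Arg b) / 2))"
  have v: "v \<noteq> 0" using assms(2) by (simp add: v_def)
  have "b \<noteq> 0"
  proof
    assume "b = 0"
    then have "cmod a = 0" using assms(1) by simp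
    then show False using assms(2) by simp
  qed
  have polar_a: "a = of_real (cmod a) * exp (\<i> * of_real (Arg a))" by (rule Arg_eq [OF assms(2)])
  have polar_b: "b = of_real (cmod a) * exp (\<i> * of_real (Arg b))"
    unfolding assms(1) by (rule Arg_eq [OF \<open>b \<noteq> 0\<close>])
  have eq: "real_linear a b z = v * of_real (proj_dir \<theta>0 z)" for z
  proof -
    define x where "x = exp (- \<i> * of_real \<theta>0) * z"
    have "of_real (proj_dir \<theta>0 z) = (x + cnj x) / 2"
      unfolding proj_dir_def x_def [symmetric] complex_add_cnj by simp
    then have "v * of_real (proj_dir \<theta>0 z) = of_real (cmod a) *
        (exp (\<i> * of_real ((Arg a + Arg b) / 2)) * x + exp (\<i> * of_real ((Arg a + Arg b) / 2)) * cnj x)"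
      by (simp only: v_def) (simp add: distrib_left)
    also have "exp (\<i> * of_real ((Arg a + Arg b) / 2)) * x = exp (\<i> * of_real (Arg a)) * z"
    proof -
      have "\<i> * of_real ((Arg a + Arg b) / 2) + - \<i> * of_real \<theta>0 = \<i> * complex_of_real (Arg a)"
        by (simp add: \<theta>0_def complex_eq_iff field_simps)
      then show ?thesis unfolding x_def mult.assoc [symmetric] exp_add [symmetric] by simp
    qed
    also have "exp (\<i> * of_real ((Arg a + Arg b) / 2)) * cnj x = exp (\<i> * of_real (Arg b)) * cnj z"
    proof -
      have "cnj x = exp (\<i> * of_real \<theta>0) * cnj z" by (simp add: x_def exp_cnj)
      moreover have "\<i> * of_real ((Arg a + Arg b) / 2) + \<i> * of_real \<theta>0 = \<i> * complex_of_real (Arg b)"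
        by (simp add: \<theta>0_def complex_eq_iff field_simps)
      ultimately show ?thesis by (simp only: mult.assoc [symmetric] exp_add [symmetric])
    qed
    finally have "v * of_real (proj_dir \<theta>0 z) = (of_real (cmod a) * exp (\<i> * of_real (Arg a))) * z
        + (of_real (cmod a) * exp (\<i> * of_real (Arg b))) * cnj z"
      by (simp only: distrib_left mult.assoc)
    then show ?thesis by (simp only: polar_a [symmetric] polar_b [symmetric])
  qed
  show thesis
  proof (cases "0 \<le> \<theta>0")
    case True
    have "\<theta>0 < pi" using mpi_less_Arg [of a] Arg_le_pi [of b] by (simp add: \<theta>0_def)
    then show thesis using that [OF _ v eq] True by simp
  next
    case False
    have "- pi < \<theta>0" using mpi_less_Arg [of b] Arg_le_pi [of a] by (simp add: \<theta>0_def)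
    moreover have "proj_dir (\<theta>0 + pi) z = - proj_dir \<theta>0 z" for z
    proof -
      have "- \<i> * complex_of_real (\<theta>0 + pi) = - \<i> * of_real \<theta>0 - \<i> * of_real pi"
        by (simp add: algebra_simps)
      then have "exp (- \<i> * complex_of_real (\<theta>0 + pi)) = - exp (- \<i> * of_real \<theta>0)"
        by (simp only: exp_diff) (simp add: exp_pi_i' mult.commute)
      then show ?thesis by (simp add: proj_dir_def)
    qed
    ultimately show thesis
      using False that [of "\<theta>0 + pi" "- v"] v eq by simp
  qed
qed

text \<open>
The set lies on a line perpendicular to the direction \<theta>; on this line, the non-empty connected
compact sets are the segments and the points.
\<close>
lemma line_segment_of_constant_projection:
  assumes K: "compact K" "connected K" "p \<in> K" "p' \<in> K" "p \<noteq> p'"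
    and const: "\<And>z. z \<in> K \<Longrightarrow> proj_dir \<theta> z = c"
  shows "is_line_segment K"
proof -
  define e where "e = exp (\<i> * complex_of_real \<theta>)"
  define h where "h = (\<lambda>t::real. e * of_real c + of_real t * (\<i> * e))"
  define T where "T = (\<lambda>z. Im (exp (- \<i> * of_real \<theta>) * z)) ` K"
  have e: "e * exp (- \<i> * of_real \<theta>) = 1" by (simp add: e_def exp_minus)
  have hz: "h (Im (exp (- \<i> * of_real \<theta>) * z)) = z" if "z \<in> K" for z
  proof -
    define x where "x = exp (- \<i> * of_real \<theta>) * z"
    have "Re x = c" using const [OF that] by (simp add: proj_dir_def x_def)
    then have "h (Im x) = e * x" by (simp add: h_def complex_eq_iff algebra_simps)
    also have "\<dots> = z" unfolding x_def mult.assoc [symmetric] e by simp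
    finally show ?thesis by (simp add: x_def)
  qed
  have "connected T" "compact T" unfolding T_def
    by (auto intro!: connected_continuous_image compact_continuous_image continuous_intros K(1,2))
  then obtain s t where T: "T = {s..t}" using connected_compact_interval_1 by blast
  have KT: "K = h ` T" unfolding T_def image_image using hz by (force simp: image_iff)
  have "T \<noteq> {}" using K(3) by (auto simp: T_def)
  then have "s \<le> t" using T by simp
  have "s \<noteq> t"
  proof
    assume "s = t"
    then have "K = {h s}" using KT T by simp
    then show False using K by auto
  qed
  have seg: "h ` {s..t} = closed_segment (h s) (h t)"
  proof -
    have "{s..t} = closed_segment s t" using \<open>s \<le> t\<close> by (simp add: closed_segment_eq_real_ivl)
    moreover have "h ` closed_segment s t = closed_segment (h s) (h t)"
    proof -
      have "h ((1 - u) * s + u * t) = (1 - u) *\<^sub>R h s + u *\<^sub>R h t" for u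
        by (simp add: h_def scaleR_conv_of_real algebra_simps)
      then show ?thesis by (auto simp: closed_segment_def image_iff) metis+
    qed
    ultimately show ?thesis by simp
  qed
  have "h s \<noteq> h t" using \<open>s \<noteq> t\<close> by (simp add: h_def e_def)
  then show ?thesis unfolding is_line_segment_def using KT T seg by blast
qed

section \<open>Degenerating sequences of linear images\<close>

text \<open>
The limit g is obtained by compactness. It omits the limits of the omitted values by the theorem of
Hurwitz, and so the winding numbers about these values pass to the limit as well. This includes limits that are
not invertible, which is the case that will lead to a contradiction.
\<close>
theorem essential_map_limit:
  assumes ring: "ring_domain \<Omega> K L" and p: "p \<in> K" "p' \<in> K" "l \<in> L"
    and ab: "\<And>n. cmod (a n) \<noteq> cmod (b n)" and lim: "a \<longlonglongrightarrow> \<alpha>" "b \<longlonglongrightarrow> \<beta>"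
    and ne: "real_linear \<alpha> \<beta> p \<noteq> real_linear \<alpha> \<beta> p'" and M: "0 < M"
    and ess: "\<And>n. essential_map M (real_linear (a n) (b n) ` \<Omega>) (real_linear (a n) (b n) p) (f n)"
  obtains g where "g holomorphic_on round_annulus M"
    "\<And>z q. z \<in> round_annulus M \<Longrightarrow> q \<in> K \<union> L \<Longrightarrow> g z \<noteq> real_linear \<alpha> \<beta> q"
    "winding_number (g \<circ> circlepath 0 1) (real_linear \<alpha> \<beta> p) \<noteq> 0"
    "winding_number (g \<circ> circlepath 0 1) (real_linear \<alpha> \<beta> l) = 0"
proof -
  let ?A = "round_annulus M"
  define \<Lambda> where "\<Lambda> = (\<lambda>n. real_linear (a n) (b n))"
  have ess': "f n holomorphic_on ?A" "f n ` ?A \<subseteq> \<Lambda> n ` \<Omega>"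
    "winding_number (f n \<circ> circlepath 0 1) (\<Lambda> n p) \<noteq> 0" for n
    using ess by (auto simp: essential_map_def \<Lambda>_def)
  have ring\<Lambda>: "ring_domain (\<Lambda> n ` \<Omega>) (\<Lambda> n ` K) (\<Lambda> n ` L)" for n
    unfolding \<Lambda>_def using real_linear_homeomorphism [OF ab] ring_domain_homeomorphic_image [OF _ ring] by metis
  have omit: "f n z \<noteq> \<Lambda> n q" if "z \<in> ?A" "q \<in> K \<union> L" for n z q
  proof -
    have "f n z \<in> \<Lambda> n ` \<Omega>" using ess'(2) that by blast
    moreover have "\<Lambda> n q \<in> \<Lambda> n ` K \<union> \<Lambda> n ` L" using that(2) by blast
    moreover have "\<Lambda> n ` K \<union> \<Lambda> n ` L = - \<Lambda> n ` \<Omega>"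
      using ring\<Lambda> [of n] unfolding ring_domain_def by (elim conjE)
    ultimately show ?thesis by auto
  qed
  note loop = loop_through_annulus [OF ess'(1) M]
  have loop\<Omega>: "path_image (f n \<circ> circlepath 0 1) \<subseteq> \<Lambda> n ` \<Omega>" for n
    using loop(4) ess'(2) by blast
  have wn': "winding_number (f n \<circ> circlepath 0 1) (\<Lambda> n p') \<noteq> 0" for n
  proof -
    have "winding_number (f n \<circ> circlepath 0 1) (\<Lambda> n p) = winding_number (f n \<circ> circlepath 0 1) (\<Lambda> n p')"
      by (rule ring_domain_winding_inner [OF ring\<Lambda> loop(1,2) loop\<Omega>]) (use p in auto)
    then show ?thesis using ess'(3) by metis
  qed
  have wnl: "winding_number (f n \<circ> circlepath 0 1) (\<Lambda> n l) = 0" for n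
    by (rule ring_domain_winding_outer [OF ring\<Lambda> loop(1,2) loop\<Omega>]) (use p in auto)
  have lim\<Lambda>: "(\<lambda>n. \<Lambda> n q) \<longlonglongrightarrow> real_linear \<alpha> \<beta> q" for q
    unfolding \<Lambda>_def by (intro tendsto_intros lim)
  have inj: "\<Lambda> n p \<noteq> \<Lambda> n p'" for n
  proof -
    obtain \<psi> where "homeomorphism UNIV UNIV (\<Lambda> n) \<psi>"
      using real_linear_homeomorphism [OF ab] unfolding \<Lambda>_def by metis
    then have "\<psi> (\<Lambda> n z) = z" for z by (simp add: homeomorphism_def)
    then show ?thesis using ne by metis
  qed
  obtain g r where g: "g holomorphic_on ?A" and r: "strict_mono (r :: nat \<Rightarrow> nat)"
    and nonconst: "\<not> g constant_on ?A"
    and ulim: "\<And>X. compact X \<Longrightarrow> X \<subseteq> ?A \<Longrightarrow> uniform_limit X (\<lambda>n. f (r n)) g sequentially"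
  proof (rule essential_maps_compactness [OF M ess'(1) _ lim\<Lambda> lim\<Lambda> lim\<Lambda> ne inj ess'(3) wn' wnl])
    show "f n z \<noteq> \<Lambda> n p \<and> f n z \<noteq> \<Lambda> n p'" if "z \<in> ?A" for n z
      using omit [OF that] p by blast
  qed blast
  have lim_r: "(\<lambda>n. \<Lambda> (r n) q) \<longlonglongrightarrow> real_linear \<alpha> \<beta> q" for q
    using LIMSEQ_subseq_LIMSEQ [OF lim\<Lambda> r] by (simp add: o_def)
  have omit_g: "g z \<noteq> real_linear \<alpha> \<beta> q" if z: "z \<in> ?A" and q: "q \<in> K \<union> L" for z q
  proof -
    have "g z - real_linear \<alpha> \<beta> q \<noteq> 0"
    proof (rule Hurwitz_no_zeros [OF open_round_annulus connected_round_annulus _ _ _ _ _ z,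
          where \<F> = "\<lambda>n z. f (r n) z - \<Lambda> (r n) q"])
      show "(\<lambda>z. f (r n) z - \<Lambda> (r n) q) holomorphic_on ?A" for n
        by (intro holomorphic_intros ess'(1))
      show "(\<lambda>z. g z - real_linear \<alpha> \<beta> q) holomorphic_on ?A"
        by (intro holomorphic_intros g)
      show "uniform_limit X (\<lambda>n z. f (r n) z - \<Lambda> (r n) q) (\<lambda>z. g z - real_linear \<alpha> \<beta> q) sequentially"
        if "compact X" "X \<subseteq> ?A" for X
        by (intro uniform_limit_minus ulim that uniform_limit_of_tendsto lim_r)
      show "\<not> (\<lambda>z. g z - real_linear \<alpha> \<beta> q) constant_on ?A"
      proof
        assume "(\<lambda>z. g z - real_linear \<alpha> \<beta> q) constant_on ?A"
        then obtain k where "\<And>z. z \<in> ?A \<Longrightarrow> g z - real_linear \<alpha> \<beta> q = k"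
          unfolding constant_on_def by blast
        then have "g z = k + real_linear \<alpha> \<beta> q" if "z \<in> ?A" for z
          using that by (metis diff_add_cancel)
        then show False using nonconst unfolding constant_on_def by blast
      qed
      show "f (r n) z - \<Lambda> (r n) q \<noteq> 0" if "z \<in> ?A" for n z using omit [OF that q] by simp
    qed
    then show ?thesis by simp
  qed
  have sphere: "sphere 0 1 \<subseteq> ?A" using circle_in_round_annulus [OF M] by simp
  have wn_ev: "\<forall>\<^sub>F n in sequentially. winding_number (f (r n) \<circ> circlepath 0 1) (\<Lambda> (r n) q)
      = winding_number (g \<circ> circlepath 0 1) (real_linear \<alpha> \<beta> q)" if "q \<in> K \<union> L" for q
  proof (rule winding_number_uniform_limit [OF _ lim_r])
    show "uniform_limit (sphere 0 1) (\<lambda>n. f (r n)) g sequentially" by (rule ulim [OF _ sphere]) simp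
    show "continuous_on (sphere 0 1) (f (r n))" for n
      using ess'(1) sphere holomorphic_on_imp_continuous_on continuous_on_subset by blast
    show "continuous_on (sphere 0 1) g"
      using g sphere holomorphic_on_imp_continuous_on continuous_on_subset by blast
    show "real_linear \<alpha> \<beta> q \<notin> g ` sphere 0 1" using omit_g [OF _ that] sphere by force
  qed
  show thesis
  proof (rule that [OF g omit_g])
    show "winding_number (g \<circ> circlepath 0 1) (real_linear \<alpha> \<beta> p) \<noteq> 0"
      using eventually_happens [OF wn_ev [of p]] p ess'(3) by auto
    show "winding_number (g \<circ> circlepath 0 1) (real_linear \<alpha> \<beta> l) = 0"
      using eventually_happens [OF wn_ev [of l]] p wnl by auto
  qed
qed

section \<open>Attainment of the affine modulus\<close>

lemma essential_map_restrict:
  assumes "essential_map m \<Omega> p f" "M \<le> m"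
  shows "essential_map M \<Omega> p f"
proof -
  have "round_annulus M \<subseteq> round_annulus m"
  proof
    fix z assume "z \<in> round_annulus M"
    moreover have "exp (- m / 2) \<le> exp (- M / 2)" "exp (M / 2) \<le> exp (m / 2)" using assms(2) by simp_all
    ultimately show "z \<in> round_annulus m" unfolding mem_round_annulus by linarith
  qed
  then show ?thesis
    using assms(1) holomorphic_on_subset unfolding essential_map_def by blast
qed

lemma affine_modulus_normalised:
  "affine_modulus \<Omega> = Sup {conformal_modulus (real_linear a b ` \<Omega>) |a b.
     (cmod a)\<^sup>2 + (cmod b)\<^sup>2 = 1 \<and> cmod a \<noteq> cmod b}"
proof -
  have "{conformal_modulus (\<phi> ` \<Omega>) |\<phi>. affine_transformation \<phi>}
      = {conformal_modulus (real_linear a b ` \<Omega>) |a b. (cmod a)\<^sup>2 + (cmod b)\<^sup>2 = 1 \<and> cmod a \<noteq> cmod b}"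
    (is "?X = ?Y")
  proof
    show "?X \<subseteq> ?Y"
    proof
      fix x assume "x \<in> ?X"
      then obtain \<phi> where \<phi>: "x = conformal_modulus (\<phi> ` \<Omega>)" "affine_transformation \<phi>" by blast
      obtain a b where "(cmod a)\<^sup>2 + (cmod b)\<^sup>2 = 1" "cmod a \<noteq> cmod b"
        "\<And>\<Omega>. conformal_modulus (\<phi> ` \<Omega>) = conformal_modulus (real_linear a b ` \<Omega>)"
        using conformal_modulus_affine_normalised [OF \<phi>(2)] by blast
      then show "x \<in> ?Y" using \<phi>(1) by blast
    qed
    show "?Y \<subseteq> ?X" using affine_transformation_real_linear by blast
  qed
  then show ?thesis by (simp only: affine_modulus_def)
qed

lemma conformal_modulus_le_affine_modulus:
  assumes "cmod a \<noteq> cmod b"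
  shows "conformal_modulus (real_linear a b ` \<Omega>) \<le> affine_modulus \<Omega>"
  unfolding affine_modulus_def
  by (rule Sup_upper) (use affine_transformation_real_linear [OF assms] in blast)

theorem theorem1:
  fixes \<Omega> :: "complex set" and \<Omega>\<^sub>b \<Omega>\<^sub>u :: "complex option set"
  assumes "doubly_connected_domain \<Omega>"
    and "\<Omega>\<^sub>b = bounded_component \<Omega>"
    and "\<Omega>\<^sub>u = unbounded_component \<Omega>"
    and "\<not> is_line_segment (finite_points \<Omega>\<^sub>b)"
    and "\<forall>\<theta>\<in>{0..<pi}.
           proj_dir \<theta> ` finite_points \<Omega>\<^sub>b \<inter> proj_dir \<theta> ` finite_points \<Omega>\<^sub>u \<noteq> {}"
  shows "\<exists>\<phi>. affine_transformation \<phi> \<and> affine_modulus \<Omega> = conformal_modulus (\<phi> ` \<Omega>)"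
proof -
  obtain K L where ring: "ring_domain \<Omega> K L"
    and comps: "complement_components \<Omega> = {Some ` K, insert None (Some ` L)}"
    using complement_components_ring_domain [OF assms(1)] by blast
  have "bounded_component \<Omega> = Some ` K" "unbounded_component \<Omega> = insert None (Some ` L)"
    unfolding bounded_component_def unbounded_component_def comps by (rule the_equality; auto)+
  then have fin: "finite_points \<Omega>\<^sub>b = K" "finite_points \<Omega>\<^sub>u = L"
    using assms(2,3) by (auto simp: finite_points_def)
  show ?thesis
  proof (cases "non_degenerate \<Omega>")
    case False
    have inf: "conformal_modulus (real_linear a b ` \<Omega>) = \<infinity>" if ab: "cmod a \<noteq> cmod b" for a b
    proof -
      obtain \<psi> where "homeomorphism UNIV UNIV (real_linear a b) \<psi>"
        using real_linear_homeomorphism [OF ab] by blast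
      then show ?thesis using False non_degenerate_homeomorphic_image by (simp add: conformal_modulus_def)
    qed
    have ne: "cmod 1 \<noteq> cmod 0" by simp
    have "affine_modulus \<Omega> = conformal_modulus (real_linear 1 0 ` \<Omega>)"
      using conformal_modulus_le_affine_modulus [OF ne, of \<Omega>] inf [OF ne] by (simp only: ereal_infty_less_eq)
    then show ?thesis using affine_transformation_real_linear [OF ne] by blast
  next
    case True
    have "\<exists>x\<in>Some ` K. \<exists>y\<in>Some ` K. x \<noteq> y" "\<exists>x\<in>insert None (Some ` L). \<exists>y\<in>insert None (Some ` L). x \<noteq> y"
      using True unfolding non_degenerate_def comps by blast+
    then obtain p p' where p: "p \<in> K" "p' \<in> K" "p \<noteq> p'" and L: "L \<noteq> {}" by fastforce
    let ?E = "\<lambda>a b m q. essential_map m (real_linear a b ` \<Omega>) (real_linear a b q)"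
    have modulus: "\<exists>m f. 0 < m \<and> conformal_modulus (real_linear a b ` \<Omega>) = ereal m \<and> ?E a b m q f \<and>
        (\<forall>m' g. 0 < m' \<longrightarrow> ?E a b m' q g \<longrightarrow> m' \<le> m)" if ab: "cmod a \<noteq> cmod b" and q: "q \<in> K" for a b q
    proof -
      obtain \<psi> where hom: "homeomorphism UNIV UNIV (real_linear a b) \<psi>"
        using real_linear_homeomorphism [OF ab] by blast
      obtain q' where q': "q' \<in> K" "q' \<noteq> q" using p by metis
      have "\<psi> (real_linear a b z) = z" for z using hom by (simp add: homeomorphism_def)
      then have ne: "real_linear a b q' \<noteq> real_linear a b q" using q'(2) by metis
      show ?thesis
        by (rule conformal_modulus_extremal [OF ring_domain_homeomorphic_image [OF hom ring] _ _ ne])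
          (use q q' L True non_degenerate_homeomorphic_image [OF hom] in blast)+
    qed
    define S where "S = affine_modulus \<Omega>"
    let ?X = "{conformal_modulus (real_linear a b ` \<Omega>) |a b. (cmod a)\<^sup>2 + (cmod b)\<^sup>2 = 1 \<and> cmod a \<noteq> cmod b}"
    have SX: "S = Sup ?X" unfolding S_def by (rule affine_modulus_normalised)
    have "conformal_modulus (real_linear 1 0 ` \<Omega>) \<in> ?X"
      by (intro CollectI exI [of _ 1] exI [of _ 0]) simp
    then have "?X \<noteq> {}" by blast
    then obtain F :: "nat \<Rightarrow> ereal" where F: "incseq F" "range F \<subseteq> ?X" "S = (SUP n. F n)"
      using Sup_countable_SUP [of ?X] unfolding SX by blast
    have "\<exists>a b. F n = conformal_modulus (real_linear a b ` \<Omega>) \<and> (cmod a)\<^sup>2 + (cmod b)\<^sup>2 = 1 \<and> cmod a \<noteq> cmod b" for n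
      using F(2) by blast
    then obtain a b where Fab: "\<And>n. F n = conformal_modulus (real_linear (a n) (b n) ` \<Omega>)"
      and norm_ab: "\<And>n. (cmod (a n))\<^sup>2 + (cmod (b n))\<^sup>2 = 1" and ab: "\<And>n. cmod (a n) \<noteq> cmod (b n)"
      by metis
    have in_cball: "(a n, b n) \<in> cball 0 1 \<times> cball 0 1" for n
    proof -
      have sq: "(cmod (a n))\<^sup>2 \<le> 1\<^sup>2" "(cmod (b n))\<^sup>2 \<le> 1\<^sup>2"
        using norm_ab [of n] zero_le_power2 [of "cmod (a n)"] zero_le_power2 [of "cmod (b n)"]
        unfolding one_power2 by linarith+
      then have "cmod (a n) \<le> 1" "cmod (b n) \<le> 1"
        by (blast intro: power2_le_imp_le zero_le_one)+
      then show ?thesis by simp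
    qed
    have "compact (cball 0 1 \<times> cball 0 1 :: (complex \<times> complex) set)"
      by (intro compact_Times compact_cball)
    from this [unfolded compact_def, THEN spec, of "\<lambda>n. (a n, b n)"]
    obtain ab0 r where r: "strict_mono (r :: nat \<Rightarrow> nat)" and "((\<lambda>n. (a n, b n)) \<circ> r) \<longlonglongrightarrow> ab0"
      using in_cball by blast
    then obtain \<alpha> \<beta> where ab_lim: "(\<lambda>n. (a (r n), b (r n))) \<longlonglongrightarrow> (\<alpha>, \<beta>)"
      by (cases ab0) (simp add: o_def)
    have lim: "(\<lambda>n. a (r n)) \<longlonglongrightarrow> \<alpha>" "(\<lambda>n. b (r n)) \<longlonglongrightarrow> \<beta>"
      using tendsto_fst [OF ab_lim] tendsto_snd [OF ab_lim] by simp_all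
    have norm_lim: "(cmod \<alpha>)\<^sup>2 + (cmod \<beta>)\<^sup>2 = 1"
    proof (rule LIMSEQ_unique)
      show "(\<lambda>n. (cmod (a (r n)))\<^sup>2 + (cmod (b (r n)))\<^sup>2) \<longlonglongrightarrow> (cmod \<alpha>)\<^sup>2 + (cmod \<beta>)\<^sup>2"
        by (intro tendsto_intros lim)
    qed (simp add: norm_ab)
    have FS: "(\<lambda>n. F (r n)) \<longlonglongrightarrow> S"
      using LIMSEQ_subseq_LIMSEQ [OF LIMSEQ_SUP [OF F(1)] r] F(3) by (simp add: o_def)
    have limit_map: "\<exists>g. g holomorphic_on round_annulus M \<and>
        (\<forall>z q. z \<in> round_annulus M \<longrightarrow> q \<in> K \<union> L \<longrightarrow> g z \<noteq> real_linear \<alpha> \<beta> q) \<and>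
        winding_number (g \<circ> circlepath 0 1) (real_linear \<alpha> \<beta> q) \<noteq> 0 \<and>
        winding_number (g \<circ> circlepath 0 1) (real_linear \<alpha> \<beta> l) = 0"
      if M: "0 < M" "ereal M < S" and q: "q \<in> K" "q' \<in> K" "l \<in> L" "real_linear \<alpha> \<beta> q \<noteq> real_linear \<alpha> \<beta> q'"
      for M q q' l
    proof -
      obtain N where N: "\<And>n. N \<le> n \<Longrightarrow> ereal M < F (r n)"
        using order_tendstoD(1) [OF FS M(2)] unfolding eventually_sequentially by blast
      have "\<exists>f. ?E (a (r (n + N))) (b (r (n + N))) M q f" for n
      proof -
        obtain m f where m: "F (r (n + N)) = ereal m" and f: "?E (a (r (n + N))) (b (r (n + N))) m q f"
          using modulus [OF ab q(1), of "r (n + N)"] Fab by metis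
        have "M \<le> m" using N [of "n + N"] m by simp
        then show ?thesis using essential_map_restrict [OF f] by blast
      qed
      then obtain f where f: "\<And>n. ?E (a (r (n + N))) (b (r (n + N))) M q (f n)" by metis
      show ?thesis
        by (rule essential_map_limit [OF ring q(1-3) ab LIMSEQ_ignore_initial_segment [OF lim(1)]
              LIMSEQ_ignore_initial_segment [OF lim(2)] q(4) M(1) f]) blast
    qed
    show ?thesis
    proof (cases "cmod \<alpha> = cmod \<beta>")
      case True
      then have "\<alpha> \<noteq> 0" using norm_lim by auto
      then obtain \<theta> u where \<theta>: "\<theta> \<in> {0..<pi}" and u: "u \<noteq> 0"
        and proj: "\<And>z. real_linear \<alpha> \<beta> z = u * of_real (proj_dir \<theta> z)"
        using degenerate_real_linear_is_projection [OF True] by blast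
      \<comment> \<open>The limit is a projection. The hypotheses on K and L contradict the winding numbers
      of a limit of essential maps, for any annulus of modulus less than the supremum.\<close>
      obtain q l where ql: "q \<in> K" "l \<in> L" "proj_dir \<theta> q = proj_dir \<theta> l"
        using assms(5) \<theta> unfolding fin by fastforce
      obtain q' where q': "q' \<in> K" "proj_dir \<theta> q' \<noteq> proj_dir \<theta> q"
        using line_segment_of_constant_projection [of K p p' \<theta> "proj_dir \<theta> q"] p ring assms(4)
        unfolding fin ring_domain_def by blast
      obtain m where m: "0 < m" "conformal_modulus (real_linear 1 0 ` \<Omega>) = ereal m"
        using modulus [of 1 0 p] p by auto
      have "ereal m \<le> S" unfolding S_def m(2) [symmetric] by (rule conformal_modulus_le_affine_modulus) simp
      moreover have "ereal (m / 2) < ereal m" using m(1) by simp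
      ultimately have "ereal (m / 2) < S" by (rule less_le_trans [rotated])
      moreover have "real_linear \<alpha> \<beta> q \<noteq> real_linear \<alpha> \<beta> q'" using q'(2) u unfolding proj by simp
      ultimately have "\<exists>g. winding_number (g \<circ> circlepath 0 1) (real_linear \<alpha> \<beta> q) \<noteq> 0 \<and>
          winding_number (g \<circ> circlepath 0 1) (real_linear \<alpha> \<beta> l) = 0"
        using limit_map [of "m / 2" q q' l] m(1) ql q' by auto
      moreover have "real_linear \<alpha> \<beta> q = real_linear \<alpha> \<beta> l" unfolding proj ql(3) ..
      ultimately show ?thesis by simp
    next
      case False
      obtain m where m: "0 < m" "conformal_modulus (real_linear \<alpha> \<beta> ` \<Omega>) = ereal m"
        and maximal: "\<And>m' g. 0 < m' \<Longrightarrow> ?E \<alpha> \<beta> m' p g \<Longrightarrow> m' \<le> m"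
        using modulus [OF False p(1)] by blast
      obtain \<psi> where hom: "homeomorphism UNIV UNIV (real_linear \<alpha> \<beta>) \<psi>"
        using real_linear_homeomorphism [OF False] by blast
      have inv: "\<psi> (real_linear \<alpha> \<beta> z) = z" "real_linear \<alpha> \<beta> (\<psi> z) = z" for z
        using hom by (simp_all add: homeomorphism_def)
      \<comment> \<open>Every annulus of modulus less than the supremum admits an essential limit map into the image of \<Omega>.\<close>
      have "S \<le> ereal m"
      proof (rule ccontr)
        assume "\<not> S \<le> ereal m"
        then have "ereal m < S" by (simp only: not_le)
        then obtain M where M: "ereal m < ereal M" "ereal M < S"
          using ereal_dense2 by blast
        then have "0 < M" using m(1) by simp
        obtain l where l: "l \<in> L" using L by blast
        have "real_linear \<alpha> \<beta> p \<noteq> real_linear \<alpha> \<beta> p'" using inv p(3) by metis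
        then obtain g where g: "g holomorphic_on round_annulus M"
          and omit: "\<And>z q. z \<in> round_annulus M \<Longrightarrow> q \<in> K \<union> L \<Longrightarrow> g z \<noteq> real_linear \<alpha> \<beta> q"
          and wn: "winding_number (g \<circ> circlepath 0 1) (real_linear \<alpha> \<beta> p) \<noteq> 0"
          using limit_map [OF \<open>0 < M\<close> M(2) p(1,2) l] by blast
        have "g z \<in> real_linear \<alpha> \<beta> ` \<Omega>" if "z \<in> round_annulus M" for z
        proof (rule image_eqI)
          show "g z = real_linear \<alpha> \<beta> (\<psi> (g z))" by (simp only: inv)
          then have "\<psi> (g z) \<notin> K \<union> L" using omit [OF that] by metis
          then show "\<psi> (g z) \<in> \<Omega>" using ring by (auto simp: ring_domain_def)
        qed
        then have "?E \<alpha> \<beta> M p g" using g wn unfolding essential_map_def by blast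
        then show False using maximal [OF \<open>0 < M\<close>] M(1) by fastforce
      qed
      moreover have "ereal m \<le> S"
        unfolding S_def m(2) [symmetric] by (rule conformal_modulus_le_affine_modulus [OF False])
      ultimately have "affine_modulus \<Omega> = conformal_modulus (real_linear \<alpha> \<beta> ` \<Omega>)"
        using m(2) S_def by simp
      then show ?thesis using affine_transformation_real_linear [OF False] by blast
    qed
  qed
qed

end
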